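(* Let $0<s<1$, $r>0$, $V,\psi\in L^\infty(B_{2r}\times(-2r^2,0])$, and let $u\in\mathrm{Dom}(H^s)$, $u\ge0$, be a solution of $$H^su=Vu+\psi\qquad\text{in }B_{2r}\times(-2r^2,0].$$ Then the following Harnack inequality holds: $$\sup_{B_r\times(-r^2,-\frac{r^2}2)}u\le C\Big(\inf_{B_r\times(-\frac{r^2}4,0)}u+r^{2s}\|\psi\|_{L^\infty(B_{2r}\times(-2r^2,0])}\Big),$$ where $C>0$ depends only on $n$, $s$ and $r^{2s}\|V\|_{L^\infty(B_{2r}\times(-2r^2,0])}$.
   Context: Points of $\mathbb R^{n+1}$ are $(x,t)$, $x\in\mathbb R^n$, $t\in\mathbb R$; $B_r=\{x\in\mathbb R^n:|x|<r\}$. $\hat u(\xi,\sigma)=\int e^{-2\pi i(\langle\xi,x\rangle+\sigma t)}u\,dx\,dt$; $H^s=(\partial_t-\Delta)^s$ is defined by $\widehat{H^su}=((2\pi|\xi|)^2+2\pi i\sigma)^s\hat u$ (principal branch), with $\mathrm{Dom}(H^s)=\{u\in L^2(\mathbb R^{n+1}):((2\pi|\xi|)^2+2\pi i\sigma)^s\hat u\in L^2(\mathbb R^{n+1})\}$. The condition $u\ge 0$ is on all of $\mathbb R^{n+1}$; the supremum and infimum are understood as essential (or for the continuous representative). *)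

theory Defs
  imports "HOL-Probability.Essential_Supremum"
begin

text \<open>
  A point \<open>(x, t)\<close> of \<open>\<real>\<^sup>n\<^sup>+\<^sup>1\<close> is an element of \<^typ>\<open>(real^'n) \<times> real\<close>, so \<open>n = CARD('n)\<close>.
\<close>

definition L2_fun :: "('a::euclidean_space \<Rightarrow> complex) \<Rightarrow> bool" where
  "L2_fun f \<longleftrightarrow> f \<in> borel_measurable lebesgue \<and>
     (\<integral>\<^sup>+ z. ennreal ((norm (f z))\<^sup>2) \<partial>lebesgue) < \<infinity>"

definition L2_tendsto ::
    "(nat \<Rightarrow> 'a::euclidean_space \<Rightarrow> complex) \<Rightarrow> ('a \<Rightarrow> complex) \<Rightarrow> bool" where
  "L2_tendsto f g \<longleftrightarrow>
     (\<lambda>k. \<integral>\<^sup>+ z. ennreal ((norm (f k z - g z))\<^sup>2) \<partial>lebesgue) \<longlonglongrightarrow> 0"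

definition fourier_integral ::
    "((real^'n) \<times> real \<Rightarrow> complex) \<Rightarrow> (real^'n) \<times> real \<Rightarrow> complex" where
  "fourier_integral u = (\<lambda>(\<xi>, \<sigma>).
     \<integral>(x, t). exp (- 2 * of_real pi * \<i> * of_real (\<xi> \<bullet> x + \<sigma> * t)) * u (x, t) \<partial>lebesgue)"

text \<open>
  The Fourier transform on \<open>L\<^sup>2\<close> is the continuous extension of the integral formula from
  \<open>L\<^sup>1 \<inter> L\<^sup>2\<close>. Functions equal almost everywhere are not identified, so it is a relation:
  \<open>has_L2_fourier u U\<close> says that \<open>U\<close> represents the transform of \<open>u\<close>.
\<close>

definition has_L2_fourier ::
    "((real^'n) \<times> real \<Rightarrow> complex) \<Rightarrow> ((real^'n) \<times> real \<Rightarrow> complex) \<Rightarrow> bool" where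
  "has_L2_fourier u U \<longleftrightarrow> L2_fun u \<and> L2_fun U \<and>
     (\<exists>v :: nat \<Rightarrow> (real^'n) \<times> real \<Rightarrow> complex.
        (\<forall>k. integrable lebesgue (v k) \<and> L2_fun (v k)) \<and>
        L2_tendsto v u \<and> L2_tendsto (\<lambda>k. fourier_integral (v k)) U)"

text \<open>\<^const>\<open>powr\<close> on \<^typ>\<open>complex\<close> uses the principal branch, with \<open>0 powr s = 0\<close>.\<close>

definition heat_symbol :: "real \<Rightarrow> (real^'n) \<times> real \<Rightarrow> complex" where
  "heat_symbol s = (\<lambda>(\<xi>, \<sigma>).
     (of_real ((2 * pi * norm \<xi>)\<^sup>2) + 2 * of_real pi * \<i> * of_real \<sigma>) powr of_real s)"

definition heat_pow_dom :: "real \<Rightarrow> ((real^'n) \<times> real \<Rightarrow> complex) set" where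
  "heat_pow_dom s = {u. L2_fun u \<and>
     (\<exists>U. has_L2_fourier u U \<and> L2_fun (\<lambda>\<zeta>. heat_symbol s \<zeta> * U \<zeta>))}"

text \<open>\<open>has_heat_pow s u w\<close> says that \<open>w\<close> represents \<open>H\<^sup>s u\<close>.\<close>

definition has_heat_pow ::
    "real \<Rightarrow> ((real^'n) \<times> real \<Rightarrow> complex) \<Rightarrow> ((real^'n) \<times> real \<Rightarrow> complex) \<Rightarrow> bool" where
  "has_heat_pow s u w \<longleftrightarrow>
     (\<exists>U. has_L2_fourier u U \<and> has_L2_fourier w (\<lambda>\<zeta>. heat_symbol s \<zeta> * U \<zeta>))"

definition esssup_on :: "'a::euclidean_space set \<Rightarrow> ('a \<Rightarrow> real) \<Rightarrow> ereal" where
  "esssup_on S f = esssup (restrict_space lebesgue S) (\<lambda>z. ereal (f z))"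

definition essinf_on :: "'a::euclidean_space set \<Rightarrow> ('a \<Rightarrow> real) \<Rightarrow> ereal" where
  "essinf_on S f = - esssup_on S (\<lambda>z. - f z)"

definition Linf_on :: "'a::euclidean_space set \<Rightarrow> ('a \<Rightarrow> real) set" where
  "Linf_on S = {f. f \<in> borel_measurable (restrict_space lebesgue S) \<and>
     esssup_on S (\<lambda>z. \<bar>f z\<bar>) < \<infinity>}"

definition Linf_norm :: "'a::euclidean_space set \<Rightarrow> ('a \<Rightarrow> real) \<Rightarrow> real" where
  "Linf_norm S f = real_of_ereal (esssup_on S (\<lambda>z. \<bar>f z\<bar>))"

text \<open>
  \<open>u \<in> Dom(H\<^sup>s)\<close> solves \<open>H\<^sup>s u = V u + \<psi>\<close> in \<open>Q\<close>; as \<open>H\<^sup>s u\<close> is an \<open>L\<^sup>2\<close> function, the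
  equation is an almost everywhere identity. Only the values of \<open>V\<close> and \<open>\<psi>\<close> on \<open>Q\<close> matter.
\<close>

definition heat_pow_solution ::
    "real \<Rightarrow> ((real^'n) \<times> real) set \<Rightarrow> ((real^'n) \<times> real \<Rightarrow> real) \<Rightarrow>
     ((real^'n) \<times> real \<Rightarrow> real) \<Rightarrow> ((real^'n) \<times> real \<Rightarrow> real) \<Rightarrow> bool" where
  "heat_pow_solution s Q V \<psi> u \<longleftrightarrow>
     (\<lambda>z. complex_of_real (u z)) \<in> heat_pow_dom s \<and>
     (\<exists>w. has_heat_pow s (\<lambda>z. complex_of_real (u z)) w \<and>
          (AE z in lebesgue. z \<in> Q \<longrightarrow> w z = complex_of_real (V z * u z + \<psi> z)))"

end

theory Submission
  imports Defs "HOL-Probability.Characteristic_Functions" "HOL-Complex_Analysis.Conformal_Mappings"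
    "HOL-Real_Asymp.Real_Asymp"
begin

text \<open>
  Up to a constant \<open>H\<^sup>s u(P)\<close> is the integral of \<open>u(P) - u(P - Z)\<close> against the positive kernel
  \<open>k(z, \<tau>) = \<tau>\<^sup>-\<^sup>1\<^sup>-\<^sup>s h\<^sub>\<tau>(z)\<close> with the heat kernel \<open>h\<close>, so the whole past of \<open>P\<close> enters the equation.
  Let \<open>T(P)\<close> be the integral of \<open>u(Y) k(P - Y)\<close> over a fixed earlier half space. Sliding a bump under
  \<open>u\<close> until it touches \<open>u\<close> at \<open>P\<close> and evaluating the equation there bounds \<open>T(P)\<close> by the infimum of
  \<open>u\<close> over the later cylinder. At a maximum point of \<open>u\<close> times a power of a cut-off the jumps of at
  least the size of the cut-off give \<open>u \<le> C (T(P) + \<psi>)\<close> on the earlier cylinder, because \<open>P\<close> is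
  later by a definite amount and so sees all jump targets with comparable weight. The two bounds
  together are the inequality, without any chaining. The Fourier definition of \<open>H\<^sup>s\<close> is reduced to
  this pointwise one by averaging \<open>u\<close> with a Gaussian: since \<open>u \<ge> 0\<close>, the average still satisfies
  \<open>\<bar>H\<^sup>s u\<bar> \<le> \<parallel>V\<parallel> u + \<parallel>\<psi>\<parallel> + o(1)\<close> inside the cylinder.
\<close>


section \<open>Gaussian integrals\<close>

text \<open>The bound \<open>K\<close> on V need not be small. At the maximum point the jumps
  lasting longer than R = (\<theta> p0)^2 give a gain of order R to the power -s, and for small
  \<theta> this exceeds both the singular part of the operator and \<open>K\<close>. The price is a
  negative power of p0, and the cut-off carries the power n + 2 exactly to cancel it. The argument
  needs a continuous function with a convergent singular integral, while u is only an L^2 function.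
  Averaging supplies both, but a Gaussian also reaches into the future, and the equation stops at
  time 0. For the average it therefore holds only up to some time t2 < 0. This does no harm, because
  the operator never looks forward, and the inequality for bounded functions is stated with such a
  t2. Its constant does not depend on the supremum of the function, which may blow up as the width
  of the Gaussian tends to 0. Since the limit has no point values, the inequality is integrated
  against weights before the limit is taken, and the essential bounds are recovered from compact
  subsets of level sets.\<close>

lemma has_bochner_integral_lborel_prod:
  fixes f :: "'a::euclidean_space \<Rightarrow> real \<Rightarrow> complex"
  assumes "\<And>b. b \<in> Basis \<Longrightarrow> has_bochner_integral lborel (f b) (I b)"
  shows "has_bochner_integral lborel (\<lambda>x::'a. \<Prod>b\<in>Basis. f b (x \<bullet> b)) (\<Prod>b\<in>Basis. I b)"
proof -
  interpret product_sigma_finite "\<lambda>b::'a. lborel :: real measure"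
    by standard
  let ?M = "\<Pi>\<^sub>M b\<in>(Basis::'a set). (lborel :: real measure)"
  let ?T = "\<lambda>g. \<Sum>b\<in>Basis. g b *\<^sub>R b :: 'a"
  have int: "integrable lborel (f b)" if "b \<in> Basis" for b
    using assms[OF that] by (simp add: has_bochner_integral_iff)
  have [measurable]: "f b \<in> borel_measurable borel" if "b \<in> Basis" for b
    using int[OF that] by (auto dest: borel_measurable_integrable)
  have T[measurable]: "?T \<in> ?M \<rightarrow>\<^sub>M borel"
    by measurable
  have 1: "integrable ?M (\<lambda>x. \<Prod>b\<in>Basis. f b (x b))"
    using int by (intro product_integrable_prod) auto
  have 2: "(\<integral>x. (\<Prod>b\<in>Basis. f b (x b)) \<partial>?M) = (\<Prod>b\<in>Basis. I b)"
    using int assms by (subst product_integral_prod) (auto simp: has_bochner_integral_iff)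
  have 3: "(\<Prod>b\<in>Basis. f b (?T x \<bullet> b)) = (\<Prod>b\<in>Basis. f b (x b))" for x
    by (intro prod.cong refl) simp
  have meas: "(\<lambda>x::'a. \<Prod>b\<in>Basis. f b (x \<bullet> b)) \<in> borel_measurable borel"
    by measurable
  have "has_bochner_integral (distr ?M borel ?T) (\<lambda>x::'a. \<Prod>b\<in>Basis. f b (x \<bullet> b)) (\<Prod>b\<in>Basis. I b)"
    using 1 2 by (simp add: has_bochner_integral_iff integrable_distr_eq[OF T meas] integral_distr[OF T meas] 3)
  then show ?thesis
    by (subst lborel_eq)
qed

lemma gaussian_fourier_real:
  fixes a w :: real
  assumes a: "0 < a"
  shows "has_bochner_integral lborel (\<lambda>x. complex_of_real (exp (- a * x\<^sup>2)) * cis (w * x))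
    (complex_of_real (sqrt (pi / a) * exp (- w\<^sup>2 / (4 * a))))"
proof -
  have meas: "(\<lambda>x. cis (t * x)) \<in> borel_measurable borel" for t :: real
    unfolding cis_conv_exp by measurable
  have std: "has_bochner_integral lborel (\<lambda>x. std_normal_density x *\<^sub>R cis (t * x))
      (complex_of_real (exp (- t\<^sup>2 / 2)))" for t :: real
  proof -
    have i: "integrable lborel (\<lambda>x. std_normal_density x *\<^sub>R cis (t * x))"
      by (rule Bochner_Integration.integrable_bound[OF integrable_std_normal_moment[of 0]])
        (use meas in auto)
    have "char std_normal_distribution t = (\<integral>x. std_normal_density x *\<^sub>R cis (t * x) \<partial>lborel)"
      unfolding char_def
      by (subst integral_density) (auto simp: normal_density_nonneg cis_conv_exp)
    with i show ?thesis
      by (simp add: has_bochner_integral_iff char_std_normal_distribution)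
  qed
  \<comment> \<open>The standard normal density at c x is a multiple of exp(-a x^2), so the integral
    becomes the characteristic function at w / c.\<close>
  define c where "c = sqrt (2 * a)"
  have c: "c > 0" "c\<^sup>2 = 2 * a" using a by (auto simp: c_def)
  have "has_bochner_integral lborel (\<lambda>x. std_normal_density (0 + c * x) *\<^sub>R cis ((w / c) * (0 + c * x)))
      (complex_of_real (exp (- (w / c)\<^sup>2 / 2)) /\<^sub>R \<bar>c\<bar>)"
    by (rule lborel_has_bochner_integral_real_affine_iff[THEN iffD1, OF _ std]) (use c in auto)
  then have "has_bochner_integral lborel (\<lambda>x. sqrt (2 * pi) *\<^sub>R (std_normal_density (0 + c * x) *\<^sub>R cis ((w / c) * (0 + c * x))))
      (sqrt (2 * pi) *\<^sub>R (complex_of_real (exp (- (w / c)\<^sup>2 / 2)) /\<^sub>R \<bar>c\<bar>))"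
    by (intro has_bochner_integral_scaleR_right) simp
  moreover have "sqrt (2 * pi) *\<^sub>R (std_normal_density (0 + c * x) *\<^sub>R cis ((w / c) * (0 + c * x)))
      = complex_of_real (exp (- a * x\<^sup>2)) * cis (w * x)" for x
    using c by (simp add: std_normal_density_def power_mult_distrib scaleR_conv_of_real)
  moreover have "sqrt (2 * pi) *\<^sub>R (complex_of_real (exp (- (w / c)\<^sup>2 / 2)) /\<^sub>R \<bar>c\<bar>)
      = complex_of_real (sqrt (pi / a) * exp (- w\<^sup>2 / (4 * a)))"
  proof -
    have "sqrt (2 * pi) / c = sqrt (pi / a)"
      using a by (simp add: c_def real_sqrt_divide real_sqrt_mult)
    moreover have "- (w / c)\<^sup>2 / 2 = - w\<^sup>2 / (4 * a)"
      using c by (simp add: power_divide)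
    moreover have "r *\<^sub>R (complex_of_real E /\<^sub>R \<bar>c\<bar>) = complex_of_real (r / c * E)" for r E
      using c(1) by (simp add: scaleR_conv_of_real divide_inverse)
    ultimately show ?thesis by metis
  qed
  ultimately show ?thesis by simp
qed

lemma gaussian_fourier:
  fixes w :: "'a::euclidean_space"
  assumes a: "0 < a"
  shows "has_bochner_integral lborel (\<lambda>x::'a. complex_of_real (exp (- a * (norm x)\<^sup>2)) * cis (w \<bullet> x))
    (complex_of_real ((pi / a) powr (DIM('a) / 2) * exp (- (norm w)\<^sup>2 / (4 * a))))"
proof -
  have n2: "(norm x)\<^sup>2 = (\<Sum>b\<in>Basis. (x \<bullet> b)\<^sup>2)" for x :: 'a
    unfolding power2_norm_eq_inner euclidean_inner[of x x] by (simp add: power2_eq_square)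
  have cisum: "cis (\<Sum>b\<in>A. g b) = (\<Prod>b\<in>A. cis (g b))" if "finite A" for g and A :: "'a set"
    using that by (induction A) (auto simp: cis_mult[symmetric])
  have "has_bochner_integral lborel (\<lambda>x::'a. \<Prod>b\<in>Basis. complex_of_real (exp (- a * (x \<bullet> b)\<^sup>2)) * cis ((w \<bullet> b) * (x \<bullet> b)))
    (\<Prod>b\<in>(Basis::'a set). complex_of_real (sqrt (pi / a) * exp (- (w \<bullet> b)\<^sup>2 / (4 * a))))"
    by (intro has_bochner_integral_lborel_prod gaussian_fourier_real a)
  moreover have "(\<Prod>b\<in>Basis. complex_of_real (exp (- a * (x \<bullet> b)\<^sup>2)) * cis ((w \<bullet> b) * (x \<bullet> b)))
      = complex_of_real (exp (- a * (norm x)\<^sup>2)) * cis (w \<bullet> x)" for x :: 'a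
  proof -
    have "cis (w \<bullet> x) = (\<Prod>b\<in>Basis. cis ((w \<bullet> b) * (x \<bullet> b)))"
      unfolding euclidean_inner[of w x] by (rule cisum) simp
    moreover have "- a * (norm x)\<^sup>2 = (\<Sum>b\<in>Basis. - a * (x \<bullet> b)\<^sup>2)"
      unfolding n2 by (rule sum_distrib_left)
    then have "exp (- a * (norm x)\<^sup>2) = (\<Prod>b\<in>Basis. exp (- a * (x \<bullet> b)\<^sup>2))"
      by (simp only: exp_sum finite_Basis)
    ultimately show ?thesis
      by (simp only: prod.distrib of_real_prod)
  qed
  moreover have "(\<Prod>b\<in>(Basis::'a set). complex_of_real (sqrt (pi / a) * exp (- (w \<bullet> b)\<^sup>2 / (4 * a))))
     = complex_of_real ((pi / a) powr (DIM('a) / 2) * exp (- (norm w)\<^sup>2 / (4 * a)))"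
  proof -
    have "sqrt (pi / a) ^ DIM('a) = (pi / a) powr (DIM('a) / 2)"
      using a by (simp add: powr_half_sqrt[symmetric] powr_power)
    moreover have "- (norm w)\<^sup>2 / (4 * a) = (\<Sum>b\<in>Basis. - (w \<bullet> b)\<^sup>2 / (4 * a))"
      unfolding n2 sum_negf[symmetric] by (rule sum_divide_distrib)
    then have "(\<Prod>b\<in>(Basis::'a set). exp (- (w \<bullet> b)\<^sup>2 / (4 * a))) = exp (- (norm w)\<^sup>2 / (4 * a))"
      by (simp only: exp_sum finite_Basis)
    ultimately show ?thesis
      by (simp only: prod.distrib prod_constant flip: of_real_prod)
  qed
  ultimately show ?thesis by simp
qed

lemma gaussian_integral:
  assumes a: "0 < a"
  shows "has_bochner_integral lborel (\<lambda>x::'a::euclidean_space. exp (- a * (norm x)\<^sup>2)) ((pi / a) powr (DIM('a) / 2))"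
  using gaussian_fourier[OF a, of "0::'a"] by (auto dest: has_bochner_integral_Re)


section \<open>The heat kernel and the kernel of the fractional heat operator\<close>

lemma borel_measurable_fst_snd [measurable]:
  "(fst :: 'a::euclidean_space \<times> 'b::euclidean_space \<Rightarrow> 'a) \<in> borel_measurable borel"
  "(snd :: 'a::euclidean_space \<times> 'b::euclidean_space \<Rightarrow> 'b) \<in> borel_measurable borel"
  by (auto intro!: borel_measurable_continuous_onI continuous_intros)

text \<open>Normalised for the Laplacian, not for half of it. The dimension comes from the type, so
  the same definition serves on R^n inside \<open>frac_kernel\<close> and on R^(n+1) inside
  \<open>gauss_average\<close>.\<close>

definition heat_kernel :: "real \<Rightarrow> 'a::euclidean_space \<Rightarrow> real" where
  "heat_kernel t z = (4 * pi * t) powr (- (DIM('a) / 2)) * exp (- (norm z)\<^sup>2 / (4 * t))"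

definition frac_kernel :: "real \<Rightarrow> 'a::euclidean_space \<times> real \<Rightarrow> real" where
  "frac_kernel s Z = (if 0 < snd Z then snd Z powr (- 1 - s) * heat_kernel (snd Z) (fst Z) else 0)"

lemma heat_kernel_nonneg [simp]: "0 \<le> heat_kernel t z"
  by (simp add: heat_kernel_def)

lemma frac_kernel_nonneg [simp]: "0 \<le> frac_kernel s Z"
  by (simp add: frac_kernel_def)

lemma frac_kernel_minus [simp]: "frac_kernel s (- z, t) = frac_kernel s (z, t)"
  by (simp add: frac_kernel_def heat_kernel_def)

lemma heat_kernel_measurable [measurable]:
  "(\<lambda>Z :: 'a::euclidean_space \<times> real. heat_kernel (snd Z) (fst Z)) \<in> borel_measurable borel"
  "heat_kernel t \<in> borel_measurable (borel :: 'a measure)"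
  unfolding heat_kernel_def by measurable

lemma frac_kernel_measurable [measurable]:
  "frac_kernel s \<in> borel_measurable (borel :: ('a::euclidean_space \<times> real) measure)"
  unfolding frac_kernel_def by measurable

text \<open>The real part of the Gaussian transform. The cosine is all that occurs later, because
  jumps are symmetrised in space.\<close>

lemma heat_kernel_fourier:
  fixes w :: "'a::euclidean_space"
  assumes t: "0 < t"
  shows "has_bochner_integral lborel (\<lambda>z::'a. heat_kernel t z * cos (w \<bullet> z)) (exp (- t * (norm w)\<^sup>2))"
proof -
  have "has_bochner_integral lborel (\<lambda>z::'a. exp (- (1 / (4 * t)) * (norm z)\<^sup>2) * cos (w \<bullet> z))
      ((pi / (1 / (4 * t))) powr (DIM('a) / 2) * exp (- (norm w)\<^sup>2 / (4 * (1 / (4 * t)))))"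
    using has_bochner_integral_Re[OF gaussian_fourier[of "1 / (4 * t)" w]] t by simp
  then have "has_bochner_integral lborel
      (\<lambda>z::'a. (4 * pi * t) powr (- (DIM('a) / 2)) * (exp (- (1 / (4 * t)) * (norm z)\<^sup>2) * cos (w \<bullet> z)))
      ((4 * pi * t) powr (- (DIM('a) / 2)) * ((pi / (1 / (4 * t))) powr (DIM('a) / 2) * exp (- (norm w)\<^sup>2 / (4 * (1 / (4 * t))))))"
    by (intro has_bochner_integral_mult_right) simp
  moreover have "(4 * pi * t) powr (- (DIM('a) / 2)) * (exp (- (1 / (4 * t)) * (norm z)\<^sup>2) * cos (w \<bullet> z))
      = heat_kernel t z * cos (w \<bullet> z)" for z :: 'a
    by (simp add: heat_kernel_def)
  moreover have "(4 * pi * t) powr (- (DIM('a) / 2)) * ((pi / (1 / (4 * t))) powr (DIM('a) / 2) * exp (- (norm w)\<^sup>2 / (4 * (1 / (4 * t)))))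
      = exp (- t * (norm w)\<^sup>2)"
  proof -
    have "pi / (1 / (4 * t)) = 4 * pi * t" "4 * (1 / (4 * t)) = 1 / t"
      using t by auto
    moreover have "(4 * pi * t) powr (- (DIM('a) / 2)) * (4 * pi * t) powr (DIM('a) / 2) = 1"
      using t by (simp add: powr_minus)
    ultimately show ?thesis
      by (simp only: mult.assoc[symmetric] mult_1_left) (simp add: mult.commute)
  qed
  ultimately show ?thesis by (simp only:)
qed

lemma heat_kernel_integral:
  "0 < t \<Longrightarrow> has_bochner_integral lborel (heat_kernel t :: 'a::euclidean_space \<Rightarrow> real) 1"
  using heat_kernel_fourier[of t "0::'a"] by simp

lemma nn_integral_heat_kernel:
  assumes "0 < t"
  shows "(\<integral>\<^sup>+ z. ennreal (heat_kernel t (z::'a::euclidean_space)) \<partial>lborel) = 1"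
  using heat_kernel_integral[OF assms, where 'a='a]
  by (simp add: nn_integral_eq_integral has_bochner_integral_iff)

text \<open>With y = |z|^2 / (8 t) this reduces to y \<le> exp y: the polynomial weight is paid for
  with half of the Gaussian decay, that is, by doubling the time.\<close>

lemma heat_kernel_moment_bound:
  assumes t: "0 < t"
  shows "(norm z)\<^sup>2 * heat_kernel t z \<le> 8 * t * 2 powr (DIM('a) / 2) * heat_kernel (2 * t) (z :: 'a::euclidean_space)"
proof -
  define y where "y = (norm z)\<^sup>2 / (8 * t)"
  have y: "(norm z)\<^sup>2 = 8 * t * y" "(norm z)\<^sup>2 / (4 * t) = 2 * y" "(norm z)\<^sup>2 / (4 * (2 * t)) = y"
    using t by (auto simp: y_def)
  have "(4 * pi * t) powr (- (DIM('a) / 2)) = 2 powr (DIM('a) / 2) * (4 * pi * (2 * t)) powr (- (DIM('a) / 2))"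
  proof -
    have e: "4 * pi * (2 * t) = 2 * (4 * pi * t)" by simp
    show ?thesis
      unfolding e powr_mult by (simp add: mult.assoc[symmetric] powr_minus)
  qed
  then have 1: "heat_kernel t z = 2 powr (DIM('a) / 2) * (4 * pi * (2 * t)) powr (- (DIM('a) / 2)) * exp (- (2 * y))"
    using y by (simp add: heat_kernel_def)
  have 2: "heat_kernel (2 * t) z = (4 * pi * (2 * t)) powr (- (DIM('a) / 2)) * exp (- y)"
    using y by (simp add: heat_kernel_def)
  have "y \<le> exp y"
    using exp_ge_add_one_self[of y] by linarith
  then have "y * exp (- (2 * y)) \<le> exp y * exp (- (2 * y))"
    by (rule mult_right_mono) simp
  also have "\<dots> = exp (- y)"
    by (simp add: mult_exp_exp)
  finally have "y * exp (- (2 * y)) \<le> exp (- y)" .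
  then have "(8 * t * 2 powr (DIM('a) / 2) * (4 * pi * (2 * t)) powr (- (DIM('a) / 2))) * (y * exp (- (2 * y)))
      \<le> (8 * t * 2 powr (DIM('a) / 2) * (4 * pi * (2 * t)) powr (- (DIM('a) / 2))) * exp (- y)"
    using t by (intro mult_left_mono) auto
  then show ?thesis
    unfolding 1 2 y(1) by (simp add: mult_ac)
qed

text \<open>A crude bound: the exact mean of |z|^2 + t is (2 n + 1) t. The last summand 1 accounts
  for the term t.\<close>

definition moment_const :: "'a::euclidean_space itself \<Rightarrow> real" where
  "moment_const _ = 8 * 2 powr (DIM('a) / 2) + 1"

lemma moment_const_ge: "1 \<le> moment_const TYPE('a::euclidean_space)"
  by (simp add: moment_const_def)

lemma heat_kernel_moment:
  assumes t: "0 < t"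
  shows "(\<integral>\<^sup>+ z. ennreal (((norm z)\<^sup>2 + t) * heat_kernel t (z::'a::euclidean_space)) \<partial>lborel)
    \<le> ennreal (moment_const TYPE('a) * t)"
proof -
  have "ennreal (((norm z)\<^sup>2 + t) * heat_kernel t z)
      \<le> ennreal (8 * t * 2 powr (DIM('a) / 2)) * ennreal (heat_kernel (2 * t) z) + ennreal t * ennreal (heat_kernel t z)" for z :: 'a
  proof -
    have "((norm z)\<^sup>2 + t) * heat_kernel t z \<le> 8 * t * 2 powr (DIM('a) / 2) * heat_kernel (2 * t) z + t * heat_kernel t z"
      using heat_kernel_moment_bound[OF t, of z] by (simp add: distrib_right)
    also have "ennreal (8 * t * 2 powr (DIM('a) / 2) * heat_kernel (2 * t) z + t * heat_kernel t z) =
        ennreal (8 * t * 2 powr (DIM('a) / 2)) * ennreal (heat_kernel (2 * t) z) + ennreal t * ennreal (heat_kernel t z)"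
      using t by (subst ennreal_plus) (auto simp: ennreal_mult)
    finally show ?thesis using ennreal_leI by blast
  qed
  then have "(\<integral>\<^sup>+ z. ennreal (((norm z)\<^sup>2 + t) * heat_kernel t (z::'a)) \<partial>lborel)
      \<le> (\<integral>\<^sup>+ z. ennreal (8 * t * 2 powr (DIM('a) / 2)) * ennreal (heat_kernel (2 * t) (z::'a))
          + ennreal t * ennreal (heat_kernel t z) \<partial>lborel)"
    by (rule nn_integral_mono)
  also have "\<dots> = ennreal (8 * t * 2 powr (DIM('a) / 2)) + ennreal t"
    using t by (simp add: nn_integral_add nn_integral_cmult nn_integral_heat_kernel)
  also have "\<dots> = ennreal (moment_const TYPE('a) * t)"
    using t by (subst ennreal_plus[symmetric]) (auto simp: moment_const_def algebra_simps)
  finally show ?thesis .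
qed

lemma nn_integral_frac_kernel:
  fixes f :: "'a::euclidean_space \<times> real \<Rightarrow> real"
  assumes [measurable]: "f \<in> borel_measurable borel" and f: "\<And>Z. 0 \<le> f Z"
  shows "(\<integral>\<^sup>+ Z. ennreal (f Z * frac_kernel s Z) \<partial>lborel) =
    (\<integral>\<^sup>+ t. ennreal (indicator {0<..} t * t powr (- 1 - s)) *
       (\<integral>\<^sup>+ z. ennreal (f (z, t) * heat_kernel t z) \<partial>lborel) \<partial>lborel)"
proof -
  have [measurable]: "(\<lambda>Z. f Z * frac_kernel s Z) \<in> borel_measurable (lborel \<Otimes>\<^sub>M lborel)"
    by (simp add: lborel_prod)
  have [measurable]: "(\<lambda>z. f (z, t)) \<in> borel_measurable borel" for t
    by measurable
  have "(\<integral>\<^sup>+ Z. ennreal (f Z * frac_kernel s Z) \<partial>lborel)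
      = (\<integral>\<^sup>+ t. (\<integral>\<^sup>+ z. ennreal (f (z, t) * frac_kernel s (z, t)) \<partial>lborel) \<partial>lborel)"
    unfolding lborel_prod[symmetric] by (subst lborel_pair.nn_integral_snd[symmetric]) auto
  also have "\<dots> = (\<integral>\<^sup>+ t. (\<integral>\<^sup>+ z. ennreal (indicator {0<..} t * t powr (- 1 - s)) * ennreal (f (z, t) * heat_kernel t z) \<partial>lborel) \<partial>lborel)"
    using f by (intro nn_integral_cong) (auto simp: frac_kernel_def indicator_def mult_ac simp flip: ennreal_mult)
  also have "\<dots> = (\<integral>\<^sup>+ t. ennreal (indicator {0<..} t * t powr (- 1 - s)) *
       (\<integral>\<^sup>+ z. ennreal (f (z, t) * heat_kernel t z) \<partial>lborel) \<partial>lborel)"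
    by (intro nn_integral_cong nn_integral_cmult) measurable
  finally show ?thesis .
qed

lemma nn_integral_powr_from_0:
  assumes "s < 1" "0 \<le> R"
  shows "(\<integral>\<^sup>+ t. ennreal (indicator {0<..R} t * t powr (- s)) \<partial>lborel) = ennreal (R powr (1 - s) / (1 - s))"
proof -
  have "(\<integral>\<^sup>+ t. ennreal (indicator {0<..R} t * t powr (- s)) \<partial>lborel)
      = (\<integral>\<^sup>+ t. ennreal (indicator {0..R} t * t powr (- s)) \<partial>lborel)"
    by (intro nn_integral_cong) (auto simp: indicator_def)
  also have "\<dots> = ennreal (R powr (- s + 1) / (- s + 1))"
    using assms by (intro nn_integral_has_integral_lebesgue has_integral_powr_from_0) auto
  finally show ?thesis by simp
qed

lemma nn_integral_powr_to_inf:
  assumes "0 < s" "0 < R"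
  shows "(\<integral>\<^sup>+ t. ennreal (indicator {R<..} t * t powr (- 1 - s)) \<partial>lborel) = ennreal (R powr (- s) / s)"
proof -
  have "(\<integral>\<^sup>+ t. ennreal (indicator {R<..} t * t powr (- 1 - s)) \<partial>lborel)
      = (\<integral>\<^sup>+ t. ennreal (indicator {R..} t * t powr (- 1 - s)) \<partial>lborel)"
    by (intro nn_integral_cong_AE AE_I[where N="{R}"]) (auto simp: indicator_def)
  also have "\<dots> = ennreal (- (R powr (- 1 - s + 1)) / (- 1 - s + 1))"
    using assms by (intro nn_integral_has_integral_lebesgue has_integral_powr_to_inf) auto
  finally show ?thesis by simp
qed

lemma frac_kernel_far:
  assumes "0 < s" "0 < R"
  shows "(\<integral>\<^sup>+ Z. ennreal (indicator {Z. R < snd Z} Z * frac_kernel s (Z :: 'a::euclidean_space \<times> real)) \<partial>lborel)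
    = ennreal (R powr (- s) / s)"
proof -
  have [measurable]: "{Z :: 'a \<times> real. R < snd Z} \<in> sets borel"
    by measurable
  have "(\<integral>\<^sup>+ Z. ennreal (indicator {Z. R < snd Z} Z * frac_kernel s (Z :: 'a \<times> real)) \<partial>lborel) =
    (\<integral>\<^sup>+ t. ennreal (indicator {0<..} t * t powr (- 1 - s)) *
       (\<integral>\<^sup>+ z. ennreal (indicator {Z. R < snd Z} (z::'a, t) * heat_kernel t z) \<partial>lborel) \<partial>lborel)"
    by (rule nn_integral_frac_kernel) auto
  also have "\<dots> = (\<integral>\<^sup>+ t. ennreal (indicator {R<..} t * t powr (- 1 - s)) \<partial>lborel)"
    using assms by (intro nn_integral_cong) (auto simp: indicator_def nn_integral_heat_kernel)
  also have "\<dots> = ennreal (R powr (- s) / s)"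
    using assms by (rule nn_integral_powr_to_inf)
  finally show ?thesis .
qed

text \<open>The kernel has infinite mass near time 0. Under the heat kernel the weight |z|^2 + t has
  mean of order t, which turns the power -1 - s of t into the integrable power -s.\<close>

lemma frac_kernel_near:
  assumes "s < 1" "0 \<le> R"
  shows "(\<integral>\<^sup>+ Z. ennreal ((indicator {Z. snd Z \<le> R} Z * ((norm (fst Z))\<^sup>2 + \<bar>snd Z\<bar>)) * frac_kernel s (Z :: 'a::euclidean_space \<times> real)) \<partial>lborel)
    \<le> ennreal (moment_const TYPE('a) * (R powr (1 - s) / (1 - s)))"
proof -
  have [measurable]: "{Z :: 'a \<times> real. snd Z \<le> R} \<in> sets borel"
    by measurable
  have "(\<integral>\<^sup>+ Z. ennreal ((indicator {Z. snd Z \<le> R} Z * ((norm (fst Z))\<^sup>2 + \<bar>snd Z\<bar>)) * frac_kernel s (Z :: 'a \<times> real)) \<partial>lborel) =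
    (\<integral>\<^sup>+ t. ennreal (indicator {0<..} t * t powr (- 1 - s)) *
       (\<integral>\<^sup>+ z. ennreal ((indicator {Z. snd Z \<le> R} (z::'a, t) * ((norm (fst (z, t)))\<^sup>2 + \<bar>snd (z, t)\<bar>)) * heat_kernel t z) \<partial>lborel) \<partial>lborel)"
    by (rule nn_integral_frac_kernel) auto
  also have "\<dots> \<le> (\<integral>\<^sup>+ t. ennreal (moment_const TYPE('a)) * ennreal (indicator {0<..R} t * t powr (- s)) \<partial>lborel)"
  proof (rule nn_integral_mono)
    fix t :: real
    show "ennreal (indicator {0<..} t * t powr (- 1 - s)) *
       (\<integral>\<^sup>+ z. ennreal ((indicator {Z. snd Z \<le> R} (z::'a, t) * ((norm (fst (z, t)))\<^sup>2 + \<bar>snd (z, t)\<bar>)) * heat_kernel t z) \<partial>lborel)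
      \<le> ennreal (moment_const TYPE('a)) * ennreal (indicator {0<..R} t * t powr (- s))"
    proof (cases "0 < t \<and> t \<le> R")
      case True
      have "ennreal (t powr (- 1 - s)) * (\<integral>\<^sup>+ z. ennreal (((norm z)\<^sup>2 + t) * heat_kernel t (z::'a)) \<partial>lborel)
          \<le> ennreal (t powr (- 1 - s)) * ennreal (moment_const TYPE('a) * t)"
        using True by (intro mult_left_mono heat_kernel_moment) auto
      also have "\<dots> = ennreal (moment_const TYPE('a)) * ennreal (t powr (- s))"
      proof -
        have "t powr (- 1 - s) * t = t powr (- s)"
          using True powr_mult_base[of t "- 1 - s"] by (simp add: mult.commute)
        then have "t powr (- 1 - s) * (moment_const TYPE('a) * t) = moment_const TYPE('a) * t powr (- s)"
          by (simp add: mult.left_commute)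
        then show ?thesis
          using True moment_const_ge[where 'a='a] by (simp flip: ennreal_mult)
      qed
      finally show ?thesis using True by (simp add: indicator_def)
    qed (auto simp: indicator_def)
  qed
  also have "\<dots> = ennreal (moment_const TYPE('a)) * ennreal (R powr (1 - s) / (1 - s))"
    using assms by (subst nn_integral_cmult) (auto simp: nn_integral_powr_from_0)
  also have "\<dots> = ennreal (moment_const TYPE('a) * (R powr (1 - s) / (1 - s)))"
    using assms moment_const_ge[where 'a='a] by (simp flip: ennreal_mult)
  finally show ?thesis .
qed

definition kernel_const :: "'a::euclidean_space itself \<Rightarrow> real \<Rightarrow> real" where
  "kernel_const _ s = moment_const TYPE('a) / (1 - s) + 1 / s"

lemma kernel_const_pos: "0 < s \<Longrightarrow> s < 1 \<Longrightarrow> 0 < kernel_const TYPE('a::euclidean_space) s"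
  using moment_const_ge[where 'a='a] by (simp add: kernel_const_def add_pos_pos)

text \<open>The weight has the size of a symmetrised difference of a bounded smooth function:
  quadratic in space and linear in time for small jumps, bounded for large ones. It is the
  dominating function for the singular integrals below.\<close>

lemma nn_integral_min_frac_kernel:
  assumes "0 < s" "s < 1"
  shows "(\<integral>\<^sup>+ Z. ennreal (min 1 ((norm (fst Z))\<^sup>2 + \<bar>snd Z\<bar>) * frac_kernel s (Z :: 'a::euclidean_space \<times> real)) \<partial>lborel)
    \<le> ennreal (kernel_const TYPE('a) s)"
proof -
  have [measurable]: "{Z :: 'a \<times> real. snd Z \<le> R} \<in> sets borel" "{Z :: 'a \<times> real. R < snd Z} \<in> sets borel" for R
    by measurable
  have "(\<integral>\<^sup>+ Z. ennreal (min 1 ((norm (fst Z))\<^sup>2 + \<bar>snd Z\<bar>) * frac_kernel s (Z :: 'a \<times> real)) \<partial>lborel)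
    \<le> (\<integral>\<^sup>+ Z. ennreal ((indicator {Z. snd Z \<le> 1} Z * ((norm (fst Z))\<^sup>2 + \<bar>snd Z\<bar>)) * frac_kernel s (Z :: 'a \<times> real))
        + ennreal (indicator {Z. 1 < snd Z} Z * frac_kernel s Z) \<partial>lborel)"
  proof (rule nn_integral_mono)
    fix Z :: "'a \<times> real"
    show "ennreal (min 1 ((norm (fst Z))\<^sup>2 + \<bar>snd Z\<bar>) * frac_kernel s Z)
      \<le> ennreal ((indicator {Z. snd Z \<le> 1} Z * ((norm (fst Z))\<^sup>2 + \<bar>snd Z\<bar>)) * frac_kernel s Z)
        + ennreal (indicator {Z. 1 < snd Z} Z * frac_kernel s Z)"
    proof (cases "snd Z \<le> 1")
      case True
      have "min 1 ((norm (fst Z))\<^sup>2 + \<bar>snd Z\<bar>) * frac_kernel s Z \<le> ((norm (fst Z))\<^sup>2 + \<bar>snd Z\<bar>) * frac_kernel s Z"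
        by (intro mult_right_mono) auto
      with True show ?thesis by (simp add: ennreal_leI)
    next
      case False
      have "min 1 ((norm (fst Z))\<^sup>2 + \<bar>snd Z\<bar>) * frac_kernel s Z \<le> 1 * frac_kernel s Z"
        by (intro mult_right_mono) auto
      with False show ?thesis by (simp add: ennreal_leI)
    qed
  qed
  also have "\<dots> = (\<integral>\<^sup>+ Z. ennreal ((indicator {Z. snd Z \<le> 1} Z * ((norm (fst Z))\<^sup>2 + \<bar>snd Z\<bar>)) * frac_kernel s (Z :: 'a \<times> real)) \<partial>lborel)
        + (\<integral>\<^sup>+ Z. ennreal (indicator {Z. 1 < snd Z} Z * frac_kernel s (Z :: 'a \<times> real)) \<partial>lborel)"
    by (intro nn_integral_add) measurable
  also have "\<dots> \<le> ennreal (moment_const TYPE('a) * (1 powr (1 - s) / (1 - s))) + ennreal (1 powr (- s) / s)"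
    using assms by (intro add_mono frac_kernel_near) (auto simp: frac_kernel_far)
  also have "\<dots> = ennreal (kernel_const TYPE('a) s)"
    using assms moment_const_ge[where 'a='a]
    by (subst ennreal_plus[symmetric]) (auto simp: kernel_const_def)
  finally show ?thesis .
qed

lemma integrable_min_frac_kernel:
  assumes "0 < s" "s < 1"
  shows "integrable lborel (\<lambda>Z :: 'a::euclidean_space \<times> real. min 1 ((norm (fst Z))\<^sup>2 + \<bar>snd Z\<bar>) * frac_kernel s Z)"
    and "(\<integral>Z. min 1 ((norm (fst Z))\<^sup>2 + \<bar>snd Z\<bar>) * frac_kernel s (Z :: 'a \<times> real) \<partial>lborel) \<le> kernel_const TYPE('a) s"
proof -
  show "integrable lborel (\<lambda>Z :: 'a \<times> real. min 1 ((norm (fst Z))\<^sup>2 + \<bar>snd Z\<bar>) * frac_kernel s Z)"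
    by (rule integrableI_nonneg)
      (use le_less_trans[OF nn_integral_min_frac_kernel[OF assms, where 'a='a] ennreal_less_top] in simp_all)
  show "(\<integral>Z. min 1 ((norm (fst Z))\<^sup>2 + \<bar>snd Z\<bar>) * frac_kernel s (Z :: 'a \<times> real) \<partial>lborel) \<le> kernel_const TYPE('a) s"
    using kernel_const_pos[OF assms, where 'a='a]
    by (intro integral_real_bounded nn_integral_min_frac_kernel assms) simp
qed


section \<open>Comparison of the kernel at displaced points\<close>

text \<open>The difference of the two sides is a square over a positive denominator.\<close>

lemma square_sum_divide_le:
  fixes A B x y :: real
  assumes "0 < x" "0 < y"
  shows "(A + B)\<^sup>2 / (x + y) \<le> A\<^sup>2 / x + B\<^sup>2 / y"
proof -
  have "A\<^sup>2 / x + B\<^sup>2 / y - (A + B)\<^sup>2 / (x + y) = (A * y - B * x)\<^sup>2 / (x * y * (x + y))"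
    using assms by (simp add: field_simps power2_eq_square)
  also have "\<dots> \<ge> 0"
    using assms by simp
  finally show ?thesis by simp
qed

text \<open>This is ln x \<le> x - 1 at x = c y / a; the additional factor exp(-a) of the sharp
  bound is given up.\<close>

lemma powr_le_exp:
  fixes a c y :: real
  assumes "0 < a" "0 < c" "0 < y"
  shows "y powr a \<le> (a / c) powr a * exp (c * y)"
proof -
  have "ln (c * y / a) \<le> c * y / a - 1"
    using assms by (intro ln_le_minus_one) simp
  then have "a * ln (c * y / a) \<le> a * (c * y / a - 1)"
    using assms by (intro mult_left_mono) auto
  also have "a * (c * y / a - 1) = c * y - a"
    using assms by (simp add: right_diff_distrib)
  finally have "a * ln (c * y / a) \<le> c * y"
    using assms by simp
  moreover have "ln y = ln (a / c) + ln (c * y / a)"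
    using assms by (simp add: ln_mult ln_div)
  ultimately have "a * ln y \<le> a * ln (a / c) + c * y"
    by (simp add: distrib_left)
  then have "exp (a * ln y) \<le> exp (a * ln (a / c) + c * y)"
    by simp
  then show ?thesis
    using assms by (simp add: powr_def exp_add)
qed

abbreviation kernel_order :: "'a::euclidean_space itself \<Rightarrow> real \<Rightarrow> real" where
  "kernel_order _ s \<equiv> 1 + s + DIM('a) / 2"

lemma frac_kernel_alt:
  fixes z :: "'a::euclidean_space"
  assumes "0 < t"
  shows "frac_kernel s (z, t) = (4 * pi) powr (- (DIM('a) / 2)) *
    (t powr (- kernel_order TYPE('a) s) * exp (- (norm z)\<^sup>2 / (4 * t)))"
proof -
  have "t powr (- 1 - s) * t powr (- (DIM('a) / 2)) = t powr (- kernel_order TYPE('a) s)"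
    by (simp add: powr_add[symmetric])
  then show ?thesis
    using assms by (simp add: frac_kernel_def heat_kernel_def powr_mult)
qed

text \<open>
  Moving the base point forward in time by a definite amount compensates a bounded spatial
  displacement, because \<open>(A + B)\<^sup>2 / (t + g) \<le> A\<^sup>2 / t + B\<^sup>2 / g\<close>.
\<close>

lemma frac_kernel_compare:
  assumes s: "0 < s"
  obtains C where "0 < C"
    "\<And>z z' :: 'a::euclidean_space. \<And>t g R. \<lbrakk>0 < R; R \<le> 1; 0 < t; 1 / 20 \<le> g; g \<le> 2; norm (z' - z) \<le> 4;
       R < t \<or> R < (norm z)\<^sup>2\<rbrakk> \<Longrightarrow>
       frac_kernel s (z, t) \<le> C * R powr (- kernel_order TYPE('a) s) * frac_kernel s (z', t + g)"
proof -
  define a where "a = kernel_order TYPE('a) s"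
  \<comment> \<open>The number 160 is a quarter of 640 = 32 * 20, the cost of the displacement when
    only half of g pays for it. The 3 comes from t + g \<le> 3 t / R in the first case and t + g
    \<le> 3 in the second, and 168 = 4 * 42 from the decay left over in the second case.\<close>
  define C where "C = exp 160 * 3 powr a * (1 + (168 * a) powr a)"
  have a: "0 < a" using s by (simp add: a_def)
  have C: "0 < C" by (simp add: C_def add_pos_nonneg)
  have *: "t powr (- a) * exp (- (norm z)\<^sup>2 / (4 * t)) \<le>
      C * R powr (- a) * ((t + g) powr (- a) * exp (- (norm z')\<^sup>2 / (4 * (t + g))))"
    if R: "0 < R" "R \<le> 1" and t: "0 < t" and g: "1 / 20 \<le> g" "g \<le> 2" and z: "norm (z' - z) \<le> 4"
      and far: "R < t \<or> R < (norm z)\<^sup>2" for z z' :: 'a and t g R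
  proof -
    define A where "A = norm z"
    have "norm z' \<le> A + 4"
      using norm_triangle_ineq[of z "z' - z"] z by (simp add: A_def)
    then have z'2: "(norm z')\<^sup>2 \<le> (A + 4)\<^sup>2"
      by (intro power_mono) auto
    have g0: "0 < g" using g by simp
    have lin1: "- Y / 4 \<le> 160 + - X / 4" if "X \<le> Y + 16 * G" "G \<le> 20" for X Y G :: real
      using that by simp
    have lin2: "- Y / 4 \<le> - Y / 168 + (160 + - X / 4)" if "X \<le> (41 / 42) * Y + 640" for X Y :: real
      using that by simp
    have ginv: "1 / g \<le> 20" using g by (simp add: field_simps)
    define E' where "E' = exp (- (norm z')\<^sup>2 / (4 * (t + g)))"
    have E': "0 < E'" by (simp add: E'_def)
    show ?thesis
    proof (cases "R < t")
      case True
      have "(norm z')\<^sup>2 / (t + g) \<le> A\<^sup>2 / t + 4\<^sup>2 / g"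
        using square_sum_divide_le[OF t g0, of A 4] z'2 t g0
        by (meson add_pos_pos divide_right_mono less_imp_le order_trans)
      then have "(norm z')\<^sup>2 / (t + g) \<le> A\<^sup>2 / t + 16 * (1 / g)" by simp
      then have "- (A\<^sup>2 / t) / 4 \<le> 160 + (- ((norm z')\<^sup>2 / (t + g)) / 4)"
        using lin1[OF _ ginv] by blast
      then have "- A\<^sup>2 / (4 * t) \<le> 160 + (- (norm z')\<^sup>2 / (4 * (t + g)))"
        by (simp add: mult.commute)
      then have e: "exp (- A\<^sup>2 / (4 * t)) \<le> exp 160 * E'"
        unfolding E'_def exp_add[symmetric] by simp
      have "t + g \<le> 3 * (t / R)"
      proof -
        have "t \<le> t / R" "1 \<le> t / R" using R t True by (auto simp: field_simps)
        then show ?thesis using g by linarith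
      qed
      then have "(t + g) powr a \<le> (3 * (t / R)) powr a"
        using a t g0 by (intro powr_mono2) auto
      also have "\<dots> = 3 powr a * t powr a * R powr (- a)"
        using t R by (simp add: powr_mult powr_divide powr_minus_divide)
      finally have "t powr (- a) \<le> 3 powr a * R powr (- a) * (t + g) powr (- a)"
        using t g0 R by (simp add: powr_minus field_simps)
      then have "t powr (- a) * exp (- A\<^sup>2 / (4 * t)) \<le> (3 powr a * R powr (- a) * (t + g) powr (- a)) * (exp 160 * E')"
        using e by (intro mult_mono) auto
      also have "\<dots> = (exp 160 * 3 powr a * 1) * (R powr (- a) * (t + g) powr (- a) * E')"
        by simp
      also have "\<dots> \<le> C * (R powr (- a) * (t + g) powr (- a) * E')"
        unfolding C_def using E' by (intro mult_right_mono mult_left_mono) auto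
      finally show ?thesis by (simp add: A_def E'_def mult_ac)
    next
      case False
      with far have A2: "R < A\<^sup>2" by (simp add: A_def)
      have t1: "t \<le> 1" using False R by simp
      \<comment> \<open>Now t may be tiny, and its negative power must be beaten by Gaussian decay.
        One half of g pays for the displacement. The other half is added to t, and as t \<le> 1 it
        enlarges t at least by the factor 42 / 41. The share 1 / 42 of A^2 / t that is saved leaves
        the factor exp(-R / (168 t)), which turns the power of t into one of R.\<close>
      have g2: "0 < t + g / 2" "0 < g / 2" using t g0 by auto
      have "(A + 4)\<^sup>2 / (t + g / 2 + g / 2) \<le> A\<^sup>2 / (t + g / 2) + 4\<^sup>2 / (g / 2)"
        by (rule square_sum_divide_le[OF g2])
      then have "(A + 4)\<^sup>2 / (t + g) \<le> A\<^sup>2 / (t + g / 2) + 32 * (1 / g)"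
        by (simp add: algebra_simps)
      moreover have "A\<^sup>2 / (t + g / 2) \<le> A\<^sup>2 * ((41 / 42) / t)"
      proof -
        have "1 / (t + g / 2) \<le> (41 / 42) / t"
          using t t1 g g2 by (simp add: field_simps)
        then show ?thesis
          using mult_left_mono[of "1 / (t + g / 2)" "(41 / 42) / t" "A\<^sup>2"] by simp
      qed
      moreover have "(norm z')\<^sup>2 / (t + g) \<le> (A + 4)\<^sup>2 / (t + g)"
        using z'2 t g0 by (intro divide_right_mono) auto
      ultimately have "(norm z')\<^sup>2 / (t + g) \<le> (41 / 42) * (A\<^sup>2 / t) + 640"
        using ginv by simp
      then have "- (A\<^sup>2 / t) / 4 \<le> - (A\<^sup>2 / t) / 168 + (160 + (- ((norm z')\<^sup>2 / (t + g)) / 4))"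
        by (rule lin2)
      then have "- A\<^sup>2 / (4 * t) \<le> - (A\<^sup>2 / t) / 168 + (160 + (- (norm z')\<^sup>2 / (4 * (t + g))))"
        by (simp add: mult.commute)
      moreover have "R / t \<le> A\<^sup>2 / t"
        using A2 t by (intro divide_right_mono) auto
      ultimately have "- A\<^sup>2 / (4 * t) \<le> - ((1 / 168) * (R / t)) + (160 + (- (norm z')\<^sup>2 / (4 * (t + g))))"
        by simp
      then have "exp (- A\<^sup>2 / (4 * t)) \<le> exp (- ((1 / 168) * (R / t)) + (160 + (- (norm z')\<^sup>2 / (4 * (t + g)))))"
        by simp
      then have e: "exp (- A\<^sup>2 / (4 * t)) \<le> exp (- ((1 / 168) * (R / t))) * (exp 160 * E')"
        unfolding E'_def exp_add .
      have "(R / t) powr a \<le> (a / (1 / 168)) powr a * exp ((1 / 168) * (R / t))"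
        using R t a by (intro powr_le_exp) auto
      then have "t powr (- a) * exp (- ((1 / 168) * (R / t))) \<le> (168 * a) powr a * R powr (- a)"
        using R t by (simp add: powr_divide powr_minus exp_minus field_simps)
      moreover have "(t + g) powr a \<le> 3 powr a"
        using a t t1 g by (intro powr_mono2) auto
      then have "1 \<le> 3 powr a * (t + g) powr (- a)"
        using t g0 by (simp add: powr_minus field_simps)
      ultimately have "t powr (- a) * exp (- ((1 / 168) * (R / t))) * 1
          \<le> (168 * a) powr a * R powr (- a) * (3 powr a * (t + g) powr (- a))"
        by (rule mult_mono) auto
      then have "t powr (- a) * exp (- ((1 / 168) * (R / t))) * (exp 160 * E')
          \<le> (168 * a) powr a * R powr (- a) * (3 powr a * (t + g) powr (- a)) * (exp 160 * E')"
        using E' by (intro mult_right_mono) auto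
      moreover have "t powr (- a) * exp (- A\<^sup>2 / (4 * t)) \<le> t powr (- a) * (exp (- ((1 / 168) * (R / t))) * (exp 160 * E'))"
        using e by (intro mult_left_mono) auto
      ultimately have "t powr (- a) * exp (- A\<^sup>2 / (4 * t))
          \<le> (exp 160 * 3 powr a * (168 * a) powr a) * (R powr (- a) * (t + g) powr (- a) * E')"
        by (simp add: mult_ac)
      also have "\<dots> \<le> C * (R powr (- a) * (t + g) powr (- a) * E')"
        unfolding C_def using E' by (intro mult_right_mono mult_left_mono) auto
      finally show ?thesis by (simp add: A_def E'_def mult_ac)
    qed
  qed
  show ?thesis
  proof
    show "0 < C" by fact
    fix z z' :: 'a and t g R :: real
    assume h: "0 < R" "R \<le> 1" "0 < t" "1 / 20 \<le> g" "g \<le> 2" "norm (z' - z) \<le> 4" "R < t \<or> R < (norm z)\<^sup>2"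
    then have "0 < t + g" by simp
    show "frac_kernel s (z, t) \<le> C * R powr (- kernel_order TYPE('a) s) * frac_kernel s (z', t + g)"
      using mult_left_mono[OF *[OF h], of "(4 * pi) powr (- (DIM('a) / 2))"]
      unfolding frac_kernel_alt[OF \<open>0 < t\<close>] frac_kernel_alt[OF \<open>0 < t + g\<close>] a_def
      by (simp add: mult_ac)
  qed
qed

text \<open>A Taylor bound that keeps the linear term exact: when two opposite jumps are averaged,
  the first-order parts of their e cancel, and the rest is of second order. Each induction step
  multiplies by 1 / (1 + e) \<le> 1 - e + 2 e^2.\<close>

lemma inverse_power_bound:
  obtains C :: real where "0 \<le> C"
    "\<And>e. \<bar>e\<bar> \<le> 1 / 2 \<Longrightarrow> inverse (1 + e) ^ N \<le> 1 - N * e + C * e\<^sup>2"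
proof -
  have "\<exists>C\<ge>0. \<forall>e::real. \<bar>e\<bar> \<le> 1 / 2 \<longrightarrow> inverse (1 + e) ^ N \<le> 1 - N * e + C * e\<^sup>2"
  proof (induction N)
    case 0
    then show ?case by (intro exI[of _ 0]) auto
  next
    case (Suc N)
    then obtain C where C: "0 \<le> C" "\<And>e::real. \<bar>e\<bar> \<le> 1 / 2 \<Longrightarrow> inverse (1 + e) ^ N \<le> 1 - N * e + C * e\<^sup>2"
      by blast
    define D where "D = 2 + N + N + 3 * C"
    have "inverse (1 + e) ^ Suc N \<le> 1 - Suc N * e + D * e\<^sup>2" if e: "\<bar>e\<bar> \<le> 1 / 2" for e :: real
    proof -
      have e1: "0 < 1 + e" "- 1/2 \<le> e" "e \<le> 1/2" using e by (auto simp: abs_le_iff)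
      have e2: "e\<^sup>2 \<le> 1 / 4"
        using e power_mono[of "\<bar>e\<bar>" "1/2" 2] by (simp add: power2_eq_square)
      have "(1 + e) * (1 - e + 2 * e\<^sup>2) = 1 + e\<^sup>2 * (1 + 2 * e)"
        by (simp add: algebra_simps power2_eq_square)
      also have "\<dots> \<ge> 1" using e1 by simp
      finally have i: "inverse (1 + e) \<le> 1 - e + 2 * e\<^sup>2"
        using e1 by (simp add: field_simps)
      have pos: "0 \<le> inverse (1 + e)" using e1 by simp
      have "inverse (1 + e) ^ Suc N \<le> (1 - e + 2 * e\<^sup>2) * (1 - N * e + C * e\<^sup>2)"
        unfolding power_Suc using i C(2)[OF e] pos e1(1)
        by (intro mult_mono) (auto intro: order_trans[OF pos i])
      also have "\<dots> = 1 - Suc N * e + (C + N + 2) * e\<^sup>2 - (C + 2 * N) * e * e\<^sup>2 + 2 * C * e\<^sup>2 * e\<^sup>2"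
        by (simp add: algebra_simps power2_eq_square)
      also have "\<dots> \<le> 1 - Suc N * e + D * e\<^sup>2"
      proof -
        have "- (C + 2 * N) * e * e\<^sup>2 \<le> (C + 2 * N) * (1 / 2) * e\<^sup>2"
          using e1 C(1) mult_left_mono[of "- e" "1/2" "C + 2 * N"]
          by (intro mult_right_mono) (auto simp: algebra_simps)
        moreover have "2 * C * e\<^sup>2 * e\<^sup>2 \<le> 2 * C * (1 / 4) * e\<^sup>2"
          using e2 C(1) by (intro mult_right_mono mult_left_mono) auto
        moreover have "0 \<le> C * e\<^sup>2" using C(1) by simp
        ultimately show ?thesis unfolding D_def by (simp add: algebra_simps)
      qed
      finally show ?thesis .
    qed
    moreover have "0 \<le> D" using C by (simp add: D_def)
    ultimately show ?case by blast
  qed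
  then show ?thesis using that by blast
qed

section \<open>Affine changes of variables: reflections and parabolic dilations\<close>

lemma lborel_affine_prod:
  fixes P :: "'a::euclidean_space \<times> real"
  assumes "a \<noteq> 0" "b \<noteq> 0"
  shows "lborel = density (distr lborel borel (\<lambda>Z. (fst P + a *\<^sub>R fst Z, snd P + b * snd Z)))
    (\<lambda>_. ennreal (\<bar>a\<bar> ^ DIM('a) * \<bar>b\<bar>))"
proof -
  define c where "c j = (if snd j = 0 then a else b)" for j :: "'a \<times> real"
  have T: "P + (\<Sum>j\<in>Basis. (c j * (Z \<bullet> j)) *\<^sub>R j) = (fst P + a *\<^sub>R fst Z, snd P + b * snd Z)" for Z
  proof -
    have "(\<Sum>j\<in>Basis. (c j * (Z \<bullet> j)) *\<^sub>R j) =
        (\<Sum>i\<in>Basis. (a * (fst Z \<bullet> i)) *\<^sub>R (i, 0::real)) + (b * snd Z) *\<^sub>R (0::'a, 1::real)"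
      by (subst sum_Basis_prod_eq) (simp add: c_def inner_prod_def)
    also have "(\<Sum>i\<in>Basis. (a * (fst Z \<bullet> i)) *\<^sub>R (i, 0::real)) = (a *\<^sub>R fst Z, 0)"
    proof -
      have "(\<Sum>i\<in>Basis. (a * (fst Z \<bullet> i)) *\<^sub>R (i, 0::real)) = (\<Sum>i\<in>Basis. (a * (fst Z \<bullet> i)) *\<^sub>R i, 0)"
        by (simp add: prod_eq_iff fst_sum snd_sum)
      also have "(\<Sum>i\<in>Basis. (a * (fst Z \<bullet> i)) *\<^sub>R i) = a *\<^sub>R fst Z"
        by (simp add: euclidean_representation flip: scaleR_scaleR scaleR_sum_right)
      finally show ?thesis .
    qed
    finally show ?thesis by (simp add: prod_eq_iff)
  qed
  have "(\<Prod>j\<in>(Basis :: ('a \<times> real) set). \<bar>c j\<bar>) = \<bar>a\<bar> ^ DIM('a) * \<bar>b\<bar>"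
  proof -
    have "(\<Prod>j\<in>(Basis :: ('a \<times> real) set). \<bar>c j\<bar>) =
      (\<Prod>j\<in>(\<lambda>u. (u, 0)) ` (Basis :: 'a set). \<bar>c j\<bar>) * (\<Prod>j\<in>(\<lambda>u. (0, u)) ` (Basis :: real set). \<bar>c j\<bar>)"
      unfolding Basis_prod_def by (subst prod.union_disjoint) (auto simp: nonzero_Basis)
    then show ?thesis
      by (simp add: prod.reindex inj_on_def c_def)
  qed
  moreover have "c j \<noteq> 0" for j using assms by (simp add: c_def)
  ultimately show ?thesis
    using lborel_affine_euclidean[of c P] unfolding T by simp
qed

lemma lborel_affine_prod_integral:
  fixes P :: "'a::euclidean_space \<times> real" and f :: "'a \<times> real \<Rightarrow> real"
  assumes ab: "a \<noteq> 0" "b \<noteq> 0" and f: "f \<in> borel_measurable borel"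
  shows "integrable lborel (\<lambda>Z. f (fst P + a *\<^sub>R fst Z, snd P + b * snd Z)) \<longleftrightarrow> integrable lborel f"
    and "(\<integral>Y. f Y \<partial>lborel) = \<bar>a\<bar> ^ DIM('a) * \<bar>b\<bar> * (\<integral>Z. f (fst P + a *\<^sub>R fst Z, snd P + b * snd Z) \<partial>lborel)"
proof -
  note [measurable] = f
  have pos: "0 < \<bar>a\<bar> ^ DIM('a) * \<bar>b\<bar>" using ab by simp
  have [measurable]: "(\<lambda>Z::'a \<times> real. (fst P + a *\<^sub>R fst Z, snd P + b * snd Z)) \<in> borel_measurable borel"
    by (intro borel_measurable_continuous_onI continuous_intros)
  show "integrable lborel (\<lambda>Z. f (fst P + a *\<^sub>R fst Z, snd P + b * snd Z)) \<longleftrightarrow> integrable lborel f"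
    using pos ab by (subst (2) lborel_affine_prod[OF ab, of P])
      (simp add: integrable_density integrable_distr_eq)
  show "(\<integral>Y. f Y \<partial>lborel) = \<bar>a\<bar> ^ DIM('a) * \<bar>b\<bar> * (\<integral>Z. f (fst P + a *\<^sub>R fst Z, snd P + b * snd Z) \<partial>lborel)"
    using pos ab by (subst lborel_affine_prod[OF ab, of P])
      (simp add: integral_density integral_distr)
qed


section \<open>The Harnack inequality for bounded solutions\<close>

text \<open>Averaging over z and -z removes the term linear in z. That term has size about the
  square root of t, against which the kernel is integrable near time 0 only for s < 1 / 2.\<close>

definition sdiff :: "('a::euclidean_space \<times> real \<Rightarrow> real) \<Rightarrow> 'a \<times> real \<Rightarrow> 'a \<times> real \<Rightarrow> real" where
  "sdiff u P Z = u P - (u (fst P + fst Z, snd P - snd Z) + u (fst P - fst Z, snd P - snd Z)) / 2"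

definition frac_heat :: "real \<Rightarrow> ('a::euclidean_space \<times> real \<Rightarrow> real) \<Rightarrow> 'a \<times> real \<Rightarrow> real" where
  "frac_heat s u P = (\<integral>Z. sdiff u P Z * frac_kernel s Z \<partial>lborel)"

definition past_potential ::
    "real \<Rightarrow> ('a::euclidean_space \<times> real \<Rightarrow> real) \<Rightarrow> real \<Rightarrow> 'a \<times> real \<Rightarrow> real" where
  "past_potential s u a P = (\<integral>Y. indicator {Y. snd Y < a} Y * u Y * frac_kernel s (P - Y) \<partial>lborel)"

lemma parallelogram_identity:
  fixes x z :: "'a::real_inner"
  shows "(norm (x + z))\<^sup>2 + (norm (x - z))\<^sup>2 = 2 * (norm x)\<^sup>2 + 2 * (norm z)\<^sup>2"
  unfolding power2_norm_eq_inner by (simp add: inner_simps inner_commute)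

lemma integral_reflect_shift:
  fixes G :: "'a::euclidean_space \<times> real \<Rightarrow> real"
  assumes [measurable]: "G \<in> borel_measurable borel"
  shows "integrable lborel (\<lambda>Z. G (fst P + fst Z, snd P - snd Z)) \<longleftrightarrow> integrable lborel G"
    "integrable lborel (\<lambda>Z. G (fst P - fst Z, snd P - snd Z)) \<longleftrightarrow> integrable lborel G"
    "(\<integral>Z. G (fst P + fst Z, snd P - snd Z) \<partial>lborel) = (\<integral>Y. G Y \<partial>lborel)"
    "(\<integral>Z. G (fst P - fst Z, snd P - snd Z) \<partial>lborel) = (\<integral>Y. G Y \<partial>lborel)"
  using lborel_affine_prod_integral[of 1 "-1" G P] lborel_affine_prod_integral[of "-1" "-1" G P]
  by (simp_all add: assms)

section \<open>The past potential bounded from above and from below\<close>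

text \<open>A bounded continuous function need not have a convergent singular integral, and a
  divergent one would give \<open>frac_heat\<close> the default value 0; hence the last assumption.
  The bound \<open>B\<close> is qualitative and enters no constant of the Harnack
  inequality.\<close>

locale bounded_heat_function =
  fixes s :: real and u :: "'a::euclidean_space \<times> real \<Rightarrow> real" and B :: real
  assumes s: "0 < s" "s < 1"
    and cont: "continuous_on UNIV u"
    and nonneg: "\<And>P. 0 \<le> u P"
    and bdd: "\<And>P. u P \<le> B"
    and integrable_sdiff: "\<And>P. integrable lborel (\<lambda>Z. sdiff u P Z * frac_kernel s Z)"
begin

lemma u_measurable [measurable]: "u \<in> borel_measurable borel"
  using cont by (rule borel_measurable_continuous_onI)

definition past_part :: "real \<Rightarrow> 'a \<times> real \<Rightarrow> real" where
  "past_part a Y = indicator {Y. snd Y < a} Y * u Y"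

lemma past_part_measurable [measurable]: "past_part a \<in> borel_measurable borel"
  unfolding past_part_def by measurable

lemma past_part_nonneg [simp]: "0 \<le> past_part a Y"
  using nonneg by (simp add: past_part_def)

lemma past_potential_eq: "past_potential s u a P = (\<integral>Y. past_part a Y * frac_kernel s (P - Y) \<partial>lborel)"
  by (simp add: past_potential_def past_part_def)

lemma past_potential_nonneg: "0 \<le> past_potential s u a P"
  unfolding past_potential_eq by (intro integral_nonneg_AE AE_I2) simp

text \<open>A jump from P into the half space lasts longer than snd P - a. On such jumps the weight
  min 1 (|z|^2 + t) is bounded below, so the bounded function u is at most a multiple of it.\<close>

lemma integrable_past:
  assumes a: "a < snd P"
  shows "integrable lborel (\<lambda>Y. past_part a Y * frac_kernel s (P - Y))"
proof -
  let ?G = "\<lambda>Y. past_part a Y * frac_kernel s (P - Y)"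
  define d where "d = min 1 (snd P - a)"
  have d: "0 < d" using a by (simp add: d_def)
  have G[measurable]: "?G \<in> borel_measurable borel" by measurable
  have "integrable lborel (\<lambda>Z. ?G (fst P - fst Z, snd P - snd Z))"
  proof (rule Bochner_Integration.integrable_bound)
    show "integrable lborel (\<lambda>Z :: 'a \<times> real. (B / d) * (min 1 ((norm (fst Z))\<^sup>2 + \<bar>snd Z\<bar>) * frac_kernel s Z))"
      by (intro integrable_mult_right integrable_min_frac_kernel s)
    show "(\<lambda>Z. ?G (fst P - fst Z, snd P - snd Z)) \<in> borel_measurable lborel"
      by measurable
    show "AE Z in lborel. norm (?G (fst P - fst Z, snd P - snd Z)) \<le> norm ((B / d) * (min 1 ((norm (fst Z))\<^sup>2 + \<bar>snd Z\<bar>) * frac_kernel s Z))"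
    proof (rule AE_I2)
      fix Z :: "'a \<times> real"
      have B: "0 \<le> B" using nonneg[of P] bdd[of P] by linarith
      have e: "P - (fst P - fst Z, snd P - snd Z) = Z" by (simp add: prod_eq_iff)
      have "past_part a (fst P - fst Z, snd P - snd Z) \<le> (B / d) * min 1 ((norm (fst Z))\<^sup>2 + \<bar>snd Z\<bar>)"
      proof (cases "snd P - snd Z < a")
        case True
        then have "snd P - a \<le> (norm (fst Z))\<^sup>2 + \<bar>snd Z\<bar>"
          using zero_le_power2[of "norm (fst Z)"] abs_ge_self[of "snd Z"] by linarith
        then have "d \<le> min 1 ((norm (fst Z))\<^sup>2 + \<bar>snd Z\<bar>)" by (simp add: d_def)
        then have "(B / d) * d \<le> (B / d) * min 1 ((norm (fst Z))\<^sup>2 + \<bar>snd Z\<bar>)"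
          using B d by (intro mult_left_mono) auto
        then show ?thesis using d bdd[of "(fst P - fst Z, snd P - snd Z)"] True
          by (simp add: past_part_def)
      qed (use B d in \<open>simp add: past_part_def\<close>)
      then have "past_part a (fst P - fst Z, snd P - snd Z) * frac_kernel s Z
          \<le> (B / d) * min 1 ((norm (fst Z))\<^sup>2 + \<bar>snd Z\<bar>) * frac_kernel s Z"
        by (rule mult_right_mono) simp
      then show "norm (?G (fst P - fst Z, snd P - snd Z)) \<le> norm ((B / d) * (min 1 ((norm (fst Z))\<^sup>2 + \<bar>snd Z\<bar>) * frac_kernel s Z))"
        using B d by (simp add: e abs_mult mult.assoc)
    qed
  qed
  then show ?thesis
    by (subst (asm) integral_reflect_shift(2)) auto
qed

text \<open>
  A multiple of \<open>max 0 q\<close> is slid under \<open>u\<close>. At the contact point the jumps cost at most as much as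
  for the quadratic \<open>q\<close>, and those into the half space \<open>t < - 1 / 2\<close> contribute the past potential
  in addition. The coefficients of \<open>q\<close> make it at least \<open>1\<close> at \<open>P2\<close> and confine \<open>q > 0\<close>, \<open>t \<le> 0\<close> to
  \<open>\<bar>x\<bar> \<le> 19 / 10\<close>, \<open>t \<ge> - 9 / 20\<close>.
\<close>

lemma past_potential_le:
  assumes t2: "t2 \<le> 0" and P2: "norm (fst P2) \<le> 1" "- 1 / 4 \<le> snd P2" "snd P2 \<le> t2"
    and K: "0 \<le> K" and \<eta>: "0 < \<eta>"
    and eq: "\<And>P. norm (fst P) \<le> 19 / 10 \<Longrightarrow> - 19 / 10 \<le> snd P \<Longrightarrow> snd P \<le> t2 \<Longrightarrow>
      \<bar>frac_heat s u P\<bar> \<le> K * u P + \<Psi>"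
  obtains P where "norm (fst P) \<le> 19 / 10" "- 9 / 20 \<le> snd P" "snd P \<le> t2"
    "past_potential s u (- 1 / 2) P \<le> (u P2 + \<eta>) * (15 * kernel_const TYPE('a) s + 27 / 4 * K) + \<Psi>"
proof -
  define q where "q Y = 27 / 4 - 2 * (norm (fst Y))\<^sup>2 + 15 * snd Y" for Y :: "'a \<times> real"
  define \<phi> where "\<phi> Y = max 0 (q Y)" for Y
  \<comment> \<open>The excess \<eta> makes \<open>F\<close> strictly negative at P2, even where u
    vanishes. The minimum point of \<open>F\<close> is then a point with q > 0.\<close>
  define \<theta> where "\<theta> = u P2 + \<eta>"
  define F where "F Y = u Y - \<theta> * \<phi> Y" for Y
  \<comment> \<open>The lower end - 9 / 20 stays 1 / 20 above the half space t < - 1 / 2. This gap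
    is the least time shift g for which the kernels are compared.\<close>
  define S where "S = cball (0::'a) (19 / 10) \<times> {- 9 / 20..t2}"
  have \<theta>: "0 < \<theta>" using nonneg[of P2] \<eta> by (simp add: \<theta>_def)
  have q_out: "q Y \<le> 0" if "snd Y \<le> 0" "Y \<notin> S" "snd Y \<le> t2" for Y
  proof (cases "norm (fst Y) \<le> 19 / 10")
    case True
    with that have "snd Y < - 9 / 20" by (auto simp: S_def mem_Times_iff)
    then show ?thesis using zero_le_power2[of "norm (fst Y)"] unfolding q_def by linarith
  next
    case False
    then have "(19 / 10)\<^sup>2 \<le> (norm (fst Y))\<^sup>2" by (intro power_mono) auto
    then have "361 / 100 \<le> (norm (fst Y))\<^sup>2" by (simp add: power2_eq_square)
    then show ?thesis using that(1) unfolding q_def by linarith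
  qed
  have "(norm (fst P2))\<^sup>2 \<le> 1" using P2(1) power_mono[of "norm (fst P2)" 1 2] by simp
  then have qP2: "1 \<le> q P2" unfolding q_def using P2(2) by linarith
  have "compact S" unfolding S_def by (intro compact_Times) auto
  moreover have P2S: "P2 \<in> S" using P2 by (auto simp: S_def mem_Times_iff)
  moreover have "continuous_on S F"
    unfolding F_def \<phi>_def q_def by (intro continuous_intros continuous_on_subset[OF cont]) auto
  ultimately obtain P where P: "P \<in> S" and Pmin: "\<And>Y. Y \<in> S \<Longrightarrow> F P \<le> F Y"
    using continuous_attains_inf[of S F] by blast
  have "F P2 \<le> u P2 - \<theta> * 1"
    unfolding F_def using qP2 \<theta> by (intro diff_left_mono mult_left_mono) (auto simp: \<phi>_def)
  then have FP: "F P < 0" using Pmin[OF P2S] \<eta> by (simp add: \<theta>_def)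
  have qP: "0 < q P"
  proof (rule ccontr)
    assume "\<not> 0 < q P"
    then have "F P = u P" by (simp add: F_def \<phi>_def)
    then show False using FP nonneg[of P] by simp
  qed
  have P': "norm (fst P) \<le> 19 / 10" "- 9 / 20 \<le> snd P" "snd P \<le> t2"
    using P by (auto simp: S_def mem_Times_iff)
  have qP_le: "q P \<le> 27 / 4"
    using P'(3) t2 zero_le_power2[of "norm (fst P)"] unfolding q_def by linarith
  have uP: "u P < \<theta> * q P" using FP qP by (simp add: F_def \<phi>_def)
  \<comment> \<open>Jumps go back in time, so only Y with snd Y \<le> t2 matter. In the half space
    the minimality of P is not spent: \<phi> vanishes there and u P < \<theta> * q P holds anyway,
    so all of u Y remains as a gain.\<close>
  have key: "u P - u Y \<le> \<theta> * (q P - \<phi> Y) - past_part (- 1 / 2) Y" if Y: "snd Y \<le> t2" for Y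
  proof (cases "snd Y < - 1 / 2")
    case True
    then have "Y \<notin> S" by (auto simp: S_def)
    then have "\<phi> Y = 0" using q_out[of Y] Y t2 by (simp add: \<phi>_def)
    then show ?thesis using uP True by (simp add: past_part_def)
  next
    case False
    have "F P \<le> F Y"
    proof (cases "Y \<in> S")
      case False
      then have "\<phi> Y = 0" using q_out[of Y] Y t2 by (simp add: \<phi>_def)
      then show ?thesis using FP nonneg[of Y] by (simp add: F_def)
    qed (rule Pmin)
    then show ?thesis using False qP by (simp add: F_def \<phi>_def past_part_def right_diff_distrib)
  qed
  let ?m = "\<lambda>Z :: 'a \<times> real. min 1 ((norm (fst Z))\<^sup>2 + \<bar>snd Z\<bar>) * frac_kernel s Z"
  let ?G = "\<lambda>Y. past_part (- 1 / 2) Y * frac_kernel s (P - Y)"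
  let ?Yp = "\<lambda>Z. (fst P + fst Z, snd P - snd Z)" and ?Ym = "\<lambda>Z. (fst P - fst Z, snd P - snd Z)"
  have G[measurable]: "?G \<in> borel_measurable borel" by measurable
  have intG: "integrable lborel ?G" using P' by (intro integrable_past) simp
  have minle: "y \<le> 15 * min 1 x" if "y \<le> w" "y \<le> 15" "w \<le> 15 * x" for w x y :: real
    using that by (simp add: min_def)
  have mid: "x - (a + a') / 2 \<le> \<theta> * (y - (b + b') / 2) - (c + c') / 2"
    if "x - a \<le> \<theta> * (y - b) - c" "x - a' \<le> \<theta> * (y - b') - c'" for x y a a' b b' c c' :: real
    using that by (simp add: field_simps)
  have bound: "sdiff u P Z * frac_kernel s Z \<le> 15 * \<theta> * ?m Z - (?G (?Yp Z) + ?G (?Ym Z)) / 2" for Z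
  proof (cases "0 < snd Z")
    case True
    have eP: "P - ?Yp Z = (- fst Z, snd Z)" "P - ?Ym Z = (fst Z, snd Z)" by (auto simp: prod_eq_iff)
    have kk: "frac_kernel s (P - ?Yp Z) = frac_kernel s Z" "frac_kernel s (P - ?Ym Z) = frac_kernel s Z"
      unfolding eP by simp_all
    have "sdiff u P Z \<le> \<theta> * (q P - (\<phi> (?Yp Z) + \<phi> (?Ym Z)) / 2) - (past_part (- 1 / 2) (?Yp Z) + past_part (- 1 / 2) (?Ym Z)) / 2"
      using mid[OF key[of "?Yp Z"] key[of "?Ym Z"]] True P' unfolding sdiff_def by simp
    \<comment> \<open>The number 15 is the larger coefficient of the quadratic difference 2 |z|^2 +
      15 t, and it also exceeds the maximum 27 / 4 of q on \<open>S\<close>, which bounds the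
      difference for long jumps.\<close>
    moreover have "q P - (\<phi> (?Yp Z) + \<phi> (?Ym Z)) / 2 \<le> 15 * min 1 ((norm (fst Z))\<^sup>2 + \<bar>snd Z\<bar>)"
    proof -
      have "q P - (q (?Yp Z) + q (?Ym Z)) / 2 = 2 * (norm (fst Z))\<^sup>2 + 15 * snd Z"
        using parallelogram_identity[of "fst P" "fst Z"] unfolding q_def fst_conv snd_conv by argo
      moreover have "q (?Yp Z) \<le> \<phi> (?Yp Z)" "q (?Ym Z) \<le> \<phi> (?Ym Z)" "0 \<le> \<phi> (?Yp Z)" "0 \<le> \<phi> (?Ym Z)"
        by (auto simp: \<phi>_def)
      ultimately have "q P - (\<phi> (?Yp Z) + \<phi> (?Ym Z)) / 2 \<le> 2 * (norm (fst Z))\<^sup>2 + 15 * snd Z"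
        "q P - (\<phi> (?Yp Z) + \<phi> (?Ym Z)) / 2 \<le> 15"
        using qP_le by argo+
      moreover have "2 * (norm (fst Z))\<^sup>2 + 15 * snd Z \<le> 15 * ((norm (fst Z))\<^sup>2 + \<bar>snd Z\<bar>)"
        using True by simp
      ultimately show ?thesis by (rule minle)
    qed
    then have "\<theta> * (q P - (\<phi> (?Yp Z) + \<phi> (?Ym Z)) / 2) \<le> \<theta> * (15 * min 1 ((norm (fst Z))\<^sup>2 + \<bar>snd Z\<bar>))"
      using \<theta> by (intro mult_left_mono) auto
    ultimately have "sdiff u P Z \<le> 15 * \<theta> * min 1 ((norm (fst Z))\<^sup>2 + \<bar>snd Z\<bar>)
        - (past_part (- 1 / 2) (?Yp Z) + past_part (- 1 / 2) (?Ym Z)) / 2"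
      by linarith
    then have "sdiff u P Z * frac_kernel s Z \<le> (15 * \<theta> * min 1 ((norm (fst Z))\<^sup>2 + \<bar>snd Z\<bar>)
        - (past_part (- 1 / 2) (?Yp Z) + past_part (- 1 / 2) (?Ym Z)) / 2) * frac_kernel s Z"
      by (rule mult_right_mono) simp
    then show ?thesis by (simp add: kk algebra_simps)
  next
    case False
    then have "frac_kernel s Z = 0" "frac_kernel s (P - ?Yp Z) = 0" "frac_kernel s (P - ?Ym Z) = 0"
      by (auto simp: frac_kernel_def)
    then show ?thesis by simp
  qed
  have "frac_heat s u P \<le> (\<integral>Z. 15 * \<theta> * ?m Z - (?G (?Yp Z) + ?G (?Ym Z)) / 2 \<partial>lborel)"
    unfolding frac_heat_def using bound intG
    by (intro integral_mono integrable_sdiff Bochner_Integration.integrable_diff integrable_mult_right integrable_min_frac_kernel s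
        integrable_divide_zero Bochner_Integration.integrable_add) (auto simp only: integral_reflect_shift[OF G])
  also have "\<dots> = 15 * \<theta> * (\<integral>Z. ?m Z \<partial>lborel) - past_potential s u (- 1 / 2) P"
  proof -
    have i: "integrable lborel (\<lambda>Z. ?G (?Yp Z))" "integrable lborel (\<lambda>Z. ?G (?Ym Z))"
      using intG by (simp_all only: integral_reflect_shift[OF G])
    have "(\<integral>Z. 15 * \<theta> * ?m Z - (?G (?Yp Z) + ?G (?Ym Z)) / 2 \<partial>lborel)
      = (\<integral>Z. 15 * \<theta> * ?m Z \<partial>lborel) - (\<integral>Z. (?G (?Yp Z) + ?G (?Ym Z)) / 2 \<partial>lborel)"
      using i by (intro Bochner_Integration.integral_diff integrable_mult_right integrable_min_frac_kernel s
        integrable_divide_zero Bochner_Integration.integrable_add)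
    also have "(\<integral>Z. (?G (?Yp Z) + ?G (?Ym Z)) / 2 \<partial>lborel) = ((\<integral>Z. ?G (?Yp Z) \<partial>lborel) + (\<integral>Z. ?G (?Ym Z) \<partial>lborel)) / 2"
      using i by (simp only: integral_divide_zero Bochner_Integration.integral_add)
    also have "\<dots> = past_potential s u (- 1 / 2) P"
      unfolding integral_reflect_shift(3,4)[OF G] past_potential_eq by simp
    finally show ?thesis by (simp only: integral_mult_right_zero)
  qed
  also have "15 * \<theta> * (\<integral>Z. ?m Z \<partial>lborel) \<le> 15 * \<theta> * kernel_const TYPE('a) s"
    using \<theta> integrable_min_frac_kernel(2)[OF s, where 'a='a] by (intro mult_left_mono) auto
  finally have up: "frac_heat s u P \<le> 15 * \<theta> * kernel_const TYPE('a) s - past_potential s u (- 1 / 2) P"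
    by simp
  have "K * u P \<le> K * (\<theta> * (27 / 4))"
    using uP qP_le \<theta> K by (intro mult_left_mono order_trans[OF less_imp_le[OF uP]]) auto
  moreover have "- (K * u P + \<Psi>) \<le> frac_heat s u P"
    using eq[of P] P' by (simp add: abs_le_iff)
  ultimately have "past_potential s u (- 1 / 2) P \<le> \<theta> * (15 * kernel_const TYPE('a) s + 27 / 4 * K) + \<Psi>"
    using up by (simp add: algebra_simps)
  then show ?thesis using that P' by (simp add: \<theta>_def)
qed

end

context bounded_heat_function
begin

text \<open>
  At a maximum point \<open>P0\<close> of \<open>u p\<^sup>N\<close> the function \<open>u\<close> is bounded near \<open>P0\<close> by a multiple of the smooth
  function \<open>p\<^sup>-\<^sup>N\<close>; the singular part of the operator is then small against the gain from
  jumps of length at least \<open>\<theta> p(P0)\<close>.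
\<close>

lemma le_past_potential:
  fixes C1 C2 \<theta> K \<Psi> :: real and N :: nat
  defines "N \<equiv> DIM('a) + 2"
  assumes C1: "0 < C1" and compare: "\<And>z z' :: 'a. \<And>t g R. \<lbrakk>0 < R; R \<le> 1; 0 < t; 1 / 20 \<le> g; g \<le> 2; norm (z' - z) \<le> 4;
       R < t \<or> R < (norm z)\<^sup>2\<rbrakk> \<Longrightarrow>
       frac_kernel s (z, t) \<le> C1 * R powr (- kernel_order TYPE('a) s) * frac_kernel s (z', t + g)"
    and C2: "0 \<le> C2" and pw: "\<And>e::real. \<bar>e\<bar> \<le> 1 / 2 \<Longrightarrow> inverse (1 + e) ^ N \<le> 1 - N * e + C2 * e\<^sup>2"
    and \<theta>: "0 < \<theta>" "\<theta> \<le> 1 / 20"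
    and small1: "(9 * N + 40 * C2) * (moment_const TYPE('a) / (1 - s)) * \<theta>\<^sup>2 \<le> 1 / (4 * s)"
    and small2: "4 * s * K \<le> (11 * \<theta>\<^sup>2) powr (- s)"
    and \<Psi>: "0 \<le> \<Psi>"
    and P1: "norm (fst P1) \<le> 1" "- 1 \<le> snd P1" "snd P1 \<le> - 1 / 2"
    and P: "norm (fst P) \<le> 19 / 10" "- 9 / 20 \<le> snd P" "snd P \<le> 0"
    and eq: "\<And>P. norm (fst P) \<le> 19 / 10 \<Longrightarrow> - 19 / 10 \<le> snd P \<Longrightarrow> snd P \<le> - 1 / 2 \<Longrightarrow>
      \<bar>frac_heat s u P\<bar> \<le> K * u P + \<Psi>"
  shows "u P1 \<le> 2 * s * (C1 + 1) * inverse \<theta> ^ N * (past_potential s u (- 1 / 2) P + \<Psi>)"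
proof (cases "u P1 = 0")
  case True
  then show ?thesis using s C1 \<theta> \<Psi> past_potential_nonneg[of "- 1 / 2" P] by simp
next
  case False
  define T where "T = past_potential s u (- 1 / 2) P"
  have T: "0 \<le> T" unfolding T_def by (rule past_potential_nonneg)
  \<comment> \<open>The coefficients give p \<ge> 1 at P1. For t \<le> - 1 / 2 the condition p > 0
    forces |x|^2 < 13 / 4 < (19 / 10)^2 and t > - 9 / 5, hence membership in \<open>S\<close>, and p
    is at most 13 / 4 there.\<close>
  define p where "p Y = 9 / 2 - (norm (fst Y))\<^sup>2 + 5 / 2 * snd Y" for Y :: "'a \<times> real"
  define F where "F Y = u Y * max 0 (p Y) ^ N" for Y
  define S where "S = cball (0::'a) (19 / 10) \<times> {- 19 / 10..- 1 / 2 :: real}"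
  have N: "0 < N" by (simp add: N_def)
  have p_out: "p Y \<le> 0" if "Y \<notin> S" "snd Y \<le> - 1 / 2" for Y
  proof (cases "norm (fst Y) \<le> 19 / 10")
    case True
    with that have "snd Y < - 19 / 10" by (auto simp: S_def mem_Times_iff)
    then show ?thesis using zero_le_power2[of "norm (fst Y)"] unfolding p_def by linarith
  next
    case False
    then have "(19 / 10)\<^sup>2 \<le> (norm (fst Y))\<^sup>2" by (intro power_mono) auto
    then have "361 / 100 \<le> (norm (fst Y))\<^sup>2" by (simp add: power2_eq_square)
    then show ?thesis using that(2) unfolding p_def by linarith
  qed
  have "compact S" unfolding S_def by (intro compact_Times) auto
  moreover have P1S: "P1 \<in> S" using P1 by (auto simp: S_def mem_Times_iff)
  moreover have "continuous_on S F"
    unfolding F_def p_def by (intro continuous_intros continuous_on_subset[OF cont]) auto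
  ultimately obtain P0 where P0: "P0 \<in> S" and P0max: "\<And>Y. Y \<in> S \<Longrightarrow> F Y \<le> F P0"
    using continuous_attains_sup[of S F] by blast
  have "(norm (fst P1))\<^sup>2 \<le> 1" using P1(1) power_mono[of "norm (fst P1)" 1 2] by simp
  then have pP1: "1 \<le> p P1" unfolding p_def using P1(2) by linarith
  then have "1 \<le> max 0 (p P1) ^ N" by (intro one_le_power) simp
  then have F1: "u P1 \<le> F P1" unfolding F_def using mult_left_mono[of 1 _ "u P1"] nonneg[of P1] by fastforce
  then have F0: "0 < F P0" using P0max[OF P1S] nonneg[of P1] False by linarith
  define p0 where "p0 = p P0"
  define u0 where "u0 = u P0"
  have p0: "0 < p0"
    using F0 N by (cases "0 < p P0") (auto simp: F_def p0_def max_def zero_power split: if_splits)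
  have u0: "0 < u0" using F0 nonneg[of P0] p0 by (cases "u P0 = 0") (auto simp: F_def u0_def)
  have FP0: "F P0 = u0 * p0 ^ N" using p0 by (simp add: F_def u0_def p0_def)
  have P0': "norm (fst P0) \<le> 19 / 10" "- 19 / 10 \<le> snd P0" "snd P0 \<le> - 1 / 2"
    using P0 by (auto simp: S_def mem_Times_iff)
  have p0_le: "p0 \<le> 13 / 4"
    using P0'(3) zero_le_power2[of "norm (fst P0)"] unfolding p0_def p_def by linarith
  have Fmax: "u Y * max 0 (p Y) ^ N \<le> u0 * p0 ^ N" if "snd Y \<le> - 1 / 2" for Y
  proof (cases "Y \<in> S")
    case True
    then show ?thesis using P0max[of Y] unfolding FP0 by (simp add: F_def)
  next
    case False
    then have "max 0 (p Y) = 0" using p_out[of Y] that by simp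
    then show ?thesis using N u0 p0 by (simp add: zero_power)
  qed
  \<comment> \<open>The threshold for short jumps is proportional to p0, so that a short jump
    changes p by at most p0 / 2 and the Taylor bound applies with e the relative change of
    p.\<close>
  define \<rho> where "\<rho> = \<theta> * p0"
  have \<rho>: "0 < \<rho>" "\<rho> \<le> 13 / 80"
    using \<theta> p0 p0_le mult_mono[of \<theta> "1/20" p0 "13/4"] by (auto simp: \<rho>_def)
  define R where "R = \<rho>\<^sup>2"
  have R: "0 < R" using \<rho> by (simp add: R_def)
  have R\<rho>: "R \<le> 13 / 80 * \<rho>"
    unfolding R_def power2_eq_square using \<rho> by (intro mult_right_mono) auto
  have R1: "R \<le> 1 / 4" using R\<rho> \<rho> by linarith
  have \<rho>p: "\<rho> \<le> p0 / 20" using \<theta> p0 mult_right_mono[of \<theta> "1/20" p0] by (simp add: \<rho>_def)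
  \<comment> \<open>With X = |z|^2 + t, the 9 bounds the linear part through (5 / 2) (13 / 4) \<le>
    9, and the 40 bounds the squares through 2 * 4 * (361 / 100) + 5 \<le> 40.\<close>
  define C3 where "C3 = 9 * N + 40 * C2"
  have C3: "0 \<le> C3" using C2 by (simp add: C3_def)
  have near: "- (u0 * C3 / p0\<^sup>2) * ((norm (fst Z))\<^sup>2 + \<bar>snd Z\<bar>) \<le> sdiff u P0 Z"
    if Z: "0 < snd Z" "snd Z \<le> R" "(norm (fst Z))\<^sup>2 \<le> R" for Z
  proof -
    define X where "X = (norm (fst Z))\<^sup>2 + snd Z"
    define w where "w = (norm (fst Z))\<^sup>2 + 5 / 2 * snd Z"
    define b where "b = fst P0 \<bullet> fst Z"
    have z: "norm (fst Z) \<le> \<rho>"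
      using Z(3) \<rho> unfolding R_def by (simp add: power2_le_iff_abs_le)
    have X: "0 \<le> X" using Z by (simp add: X_def)
    have w: "0 \<le> w" "w \<le> 5 / 2 * X" "w \<le> 7 / 2 * R" using Z by (auto simp: w_def X_def)
    have b1: "\<bar>b\<bar> \<le> 19 / 10 * norm (fst Z)"
      using Cauchy_Schwarz_ineq2[of "fst P0" "fst Z"] P0'(1)
        mult_right_mono[OF P0'(1) norm_ge_zero[of "fst Z"]] unfolding b_def by linarith
    have b2: "b\<^sup>2 \<le> 361 / 100 * X"
    proof -
      have "b\<^sup>2 \<le> (19 / 10 * norm (fst Z))\<^sup>2"
        using b1 by (simp add: power2_le_iff_abs_le)
      also have "\<dots> = 361 / 100 * (norm (fst Z))\<^sup>2" by (simp add: power_mult_distrib power2_eq_square)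
      also have "\<dots> \<le> 361 / 100 * X" using Z by (simp add: X_def)
      finally show ?thesis .
    qed
    \<comment> \<open>The signs \<sigma> = 1 and \<sigma> = - 1 are the two points of a symmetrised
      jump; 2 b is the change of |x|^2 to first order, and w collects what is even in z. Maximality
      of u p^N gives u Y \<le> u0 (1 + e)^(-N).\<close>
    have one: "u Y \<le> u0 * (1 - N * e + C2 * e\<^sup>2)" "e\<^sup>2 \<le> 40 * X / p0\<^sup>2"
      if Y: "p Y = p0 + (\<sigma> * (2 * b) - w)" "snd Y \<le> - 1 / 2" and e: "e = (\<sigma> * (2 * b) - w) / p0"
        and \<sigma>: "\<sigma> = 1 \<or> \<sigma> = - 1" for Y and \<sigma> e :: real
    proof -
      have ep: "p Y = p0 * (1 + e)" using Y p0 e by (simp add: distrib_left)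
      have "\<bar>\<sigma> * (2 * b) - w\<bar> \<le> 2 * \<bar>b\<bar> + w" using \<sigma> w by auto
      also have "\<dots> \<le> p0 / 2" using b1 z w(3) R\<rho> \<rho>p by linarith
      finally have e1: "\<bar>e\<bar> \<le> 1 / 2" unfolding e using p0 by (simp add: field_simps)
      have e2: "0 < 1 + e" using e1 by linarith
      have "u Y * (p0 * (1 + e)) ^ N \<le> u0 * p0 ^ N"
        using Fmax[OF Y(2)] ep e2 p0 by simp
      then have "u Y * (1 + e) ^ N \<le> u0"
        using p0 by (simp add: power_mult_distrib)
      then have "u Y \<le> u0 * inverse (1 + e) ^ N"
        using e2 by (simp add: power_inverse field_simps)
      also have "\<dots> \<le> u0 * (1 - N * e + C2 * e\<^sup>2)"
        using pw[OF e1] u0 by (intro mult_left_mono) auto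
      finally show "u Y \<le> u0 * (1 - N * e + C2 * e\<^sup>2)" .
      have "(\<sigma> * (2 * b) - w)\<^sup>2 \<le> 2 * (\<sigma> * (2 * b))\<^sup>2 + 2 * w\<^sup>2"
        using zero_le_power2[of "\<sigma> * (2 * b) + w"] by (simp add: power2_eq_square algebra_simps)
      also have "(\<sigma> * (2 * b))\<^sup>2 = 4 * b\<^sup>2" using \<sigma> by (auto simp: power2_eq_square)
      also have "w\<^sup>2 \<le> w"
        using w R1 mult_right_mono[of w 1 w] by (simp add: power2_eq_square)
      finally have "(\<sigma> * (2 * b) - w)\<^sup>2 \<le> 40 * X" using b2 w(2) X by linarith
      then show "e\<^sup>2 \<le> 40 * X / p0\<^sup>2"
        unfolding e power_divide by (rule divide_right_mono) simp
    qed
    have pp: "p (fst P0 + fst Z, snd P0 - snd Z) = p0 + ((- 1) * (2 * b) - w)"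
      "p (fst P0 - fst Z, snd P0 - snd Z) = p0 + (1 * (2 * b) - w)"
      unfolding p0_def p_def w_def b_def fst_conv snd_conv power2_norm_eq_inner
      by (simp_all add: inner_simps inner_commute)
    define e1 where "e1 = ((- 1) * (2 * b) - w) / p0"
    define e2 where "e2 = (1 * (2 * b) - w) / p0"
    have sn: "snd P0 - snd Z \<le> - 1 / 2" using P0' Z by linarith
    have o1: "u (fst P0 + fst Z, snd P0 - snd Z) \<le> u0 * (1 - N * e1 + C2 * e1\<^sup>2)" "e1\<^sup>2 \<le> 40 * X / p0\<^sup>2"
      using one[OF pp(1) _ e1_def] sn by auto
    have o2: "u (fst P0 - fst Z, snd P0 - snd Z) \<le> u0 * (1 - N * e2 + C2 * e2\<^sup>2)" "e2\<^sup>2 \<le> 40 * X / p0\<^sup>2"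
      using one[OF pp(2) _ e2_def] sn by auto
    \<comment> \<open>Here the first-order terms cancel; only the even part w survives.\<close>
    have e12: "(e1 + e2) / 2 = - (w / p0)"
      using p0 by (simp add: e1_def e2_def field_simps)
    have wp: "w / p0 \<le> 9 * (X / p0\<^sup>2)"
    proof -
      have "w * p0 \<le> 5 / 2 * X * (13 / 4)" using w p0 p0_le X by (intro mult_mono) auto
      also have "\<dots> \<le> 9 * X" using X by simp
      finally show ?thesis using p0 by (simp add: field_simps power2_eq_square)
    qed
    have sum: "(N * e1 + N * e2) / 2 - C2 * ((e1\<^sup>2 + e2\<^sup>2) / 2) \<ge> - (C3 * (X / p0\<^sup>2))"
    proof -
      have "(N * e1 + N * e2) / 2 = - (N * (w / p0))"
        using e12 by (simp add: distrib_left[symmetric])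
      moreover have "N * (w / p0) \<le> N * (9 * (X / p0\<^sup>2))"
        using wp by (intro mult_left_mono) auto
      moreover have "C2 * ((e1\<^sup>2 + e2\<^sup>2) / 2) \<le> C2 * (40 * (X / p0\<^sup>2))"
        using o1(2) o2(2) C2 by (intro mult_left_mono) auto
      moreover have "C3 * (X / p0\<^sup>2) = N * (9 * (X / p0\<^sup>2)) + C2 * (40 * (X / p0\<^sup>2))"
        using p0 by (simp add: C3_def field_simps)
      ultimately show ?thesis by argo
    qed
    have "u0 * (- (C3 * (X / p0\<^sup>2))) \<le> u0 * ((N * e1 + N * e2) / 2 - C2 * ((e1\<^sup>2 + e2\<^sup>2) / 2))"
      using sum u0 by (intro mult_left_mono) auto
    also have "\<dots> = u0 - (u0 * (1 - N * e1 + C2 * e1\<^sup>2) + u0 * (1 - N * e2 + C2 * e2\<^sup>2)) / 2"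
      by (simp add: field_simps)
    also have "\<dots> \<le> sdiff u P0 Z"
      unfolding sdiff_def u0_def[symmetric] using o1(1) o2(1) by simp
    finally show ?thesis using Z by (simp add: X_def)
  qed
  let ?m = "\<lambda>Z :: 'a \<times> real. (indicator {Z. snd Z \<le> R} Z * ((norm (fst Z))\<^sup>2 + \<bar>snd Z\<bar>)) * frac_kernel s Z"
  let ?f = "\<lambda>Z :: 'a \<times> real. indicator {Z. R < snd Z} Z * frac_kernel s Z"
  let ?G = "\<lambda>Y. past_part (- 1 / 2) Y * frac_kernel s (P - Y)"
  let ?Yp = "\<lambda>Z. (fst P0 + fst Z, snd P0 - snd Z)" and ?Ym = "\<lambda>Z. (fst P0 - fst Z, snd P0 - snd Z)"
  define D where "D = C1 * R powr (- kernel_order TYPE('a) s)"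
  have D: "0 < D" using C1 R by (simp add: D_def)
  have G[measurable]: "?G \<in> borel_measurable borel" by measurable
  have intG: "integrable lborel ?G" using P by (intro integrable_past) simp
  have G0: "0 \<le> ?G Y" for Y by simp
  \<comment> \<open>A target reached by a long jump from P0 lies in the half space, because P0 is
    not later than - 1 / 2. Seen from the later point P it has at least 1 / D times the weight it
    has from P0.\<close>
  have far: "u (?Yp Z) * frac_kernel s Z \<le> D * ?G (?Yp Z)" "u (?Ym Z) * frac_kernel s Z \<le> D * ?G (?Ym Z)"
    if Z: "0 < snd Z" "R < snd Z \<or> R < (norm (fst Z))\<^sup>2" for Z
  proof -
    let ?g = "snd P - snd P0"
    have g: "1 / 20 \<le> ?g" "?g \<le> 2" using P P0' by auto
    have n: "norm (fst P - fst P0) \<le> 4"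
      using norm_triangle_ineq4[of "fst P" "fst P0"] P P0' by linarith
    have eP: "P - ?Yp Z = (fst P - fst P0 - fst Z, snd Z + ?g)" "P - ?Ym Z = (fst P - fst P0 + fst Z, snd Z + ?g)"
      by (auto simp: prod_eq_iff)
    have pst: "past_part (- 1 / 2) (?Yp Z) = u (?Yp Z)" "past_part (- 1 / 2) (?Ym Z) = u (?Ym Z)"
      using Z P0' by (auto simp: past_part_def)
    have "frac_kernel s (- fst Z, snd Z) \<le> D * frac_kernel s (P - ?Yp Z)"
      unfolding eP D_def using Z g n R R1 by (intro compare) auto
    moreover have "frac_kernel s (fst Z, snd Z) \<le> D * frac_kernel s (P - ?Ym Z)"
      unfolding eP D_def using Z g n R R1 by (intro compare) auto
    ultimately have k: "frac_kernel s Z \<le> D * frac_kernel s (P - ?Yp Z)" "frac_kernel s Z \<le> D * frac_kernel s (P - ?Ym Z)"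
      by simp_all
    show "u (?Yp Z) * frac_kernel s Z \<le> D * ?G (?Yp Z)" "u (?Ym Z) * frac_kernel s Z \<le> D * ?G (?Ym Z)"
      using mult_left_mono[OF k(1) nonneg[of "?Yp Z"]] mult_left_mono[OF k(2) nonneg[of "?Ym Z"]]
      unfolding pst by (simp_all add: mult_ac)
  qed
  \<comment> \<open>Of the gain u0 from long jumps only those lasting longer than R are kept, since
    their mass is explicit; jumps that are long in space alone have their gain discarded. The loss
    is spread over all jumps with t \<le> R, where the weight is nonnegative.\<close>
  have bound: "- (u0 * C3 / p0\<^sup>2) * ?m Z + u0 * ?f Z - D * ((?G (?Yp Z) + ?G (?Ym Z)) / 2) \<le> sdiff u P0 Z * frac_kernel s Z" for Z
  proof (cases "0 < snd Z")
    case pos: True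
    have DG: "0 \<le> D * ((?G (?Yp Z) + ?G (?Ym Z)) / 2)" using D G0 by (intro mult_nonneg_nonneg) auto
    have m0: "0 \<le> (u0 * C3 / p0\<^sup>2) * ?m Z" using u0 C3 by simp
    show ?thesis
    proof (cases "R < snd Z \<or> R < (norm (fst Z))\<^sup>2")
      case True
      have "u0 * ?f Z \<le> u0 * frac_kernel s Z" using u0 by (intro mult_left_mono) (auto simp: indicator_def)
      moreover have "sdiff u P0 Z * frac_kernel s Z = u0 * frac_kernel s Z - (u (?Yp Z) * frac_kernel s Z + u (?Ym Z) * frac_kernel s Z) / 2"
        unfolding sdiff_def u0_def by (simp add: field_simps)
      moreover have "D * ((?G (?Yp Z) + ?G (?Ym Z)) / 2) = (D * ?G (?Yp Z) + D * ?G (?Ym Z)) / 2"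
        by (simp add: distrib_left)
      ultimately show ?thesis using far[OF pos True] m0 unfolding mult_minus_left by argo
    next
      case False
      then have Z: "snd Z \<le> R" "(norm (fst Z))\<^sup>2 \<le> R" by auto
      have "- (u0 * C3 / p0\<^sup>2) * ((norm (fst Z))\<^sup>2 + \<bar>snd Z\<bar>) * frac_kernel s Z \<le> sdiff u P0 Z * frac_kernel s Z"
        using near[OF pos Z] by (rule mult_right_mono) simp
      then show ?thesis using Z DG by simp
    qed
  next
    case False
    then have "frac_kernel s Z = 0" by (auto simp: frac_kernel_def)
    moreover have "0 \<le> D * ((?G (?Yp Z) + ?G (?Ym Z)) / 2)" using D G0 by (intro mult_nonneg_nonneg) auto
    ultimately show ?thesis by simp
  qed
  have nn_m: "(\<integral>\<^sup>+ Z. ennreal (?m Z) \<partial>lborel) \<le> ennreal (moment_const TYPE('a) * (R powr (1 - s) / (1 - s)))"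
    using s R by (intro frac_kernel_near) auto
  have nn_f: "(\<integral>\<^sup>+ Z. ennreal (?f Z) \<partial>lborel) = ennreal (R powr (- s) / s)"
    using s R by (intro frac_kernel_far) auto
  have [measurable]: "{Z :: 'a \<times> real. snd Z \<le> R} \<in> sets borel" "{Z :: 'a \<times> real. R < snd Z} \<in> sets borel"
    by measurable
  have int_m: "integrable lborel ?m"
    by (rule integrableI_nonneg) (use le_less_trans[OF nn_m ennreal_less_top] in simp_all)
  have int_f: "integrable lborel ?f"
    by (rule integrableI_nonneg) (use nn_f in simp_all)
  have I_m: "(\<integral>Z. ?m Z \<partial>lborel) \<le> moment_const TYPE('a) * (R powr (1 - s) / (1 - s))"
    using nn_m s moment_const_ge[where 'a='a] by (intro integral_real_bounded) auto
  have I_f: "(\<integral>Z. ?f Z \<partial>lborel) = R powr (- s) / s"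
    by (rule integral_eq_nn_integral[THEN trans]) (use nn_f s in simp_all)
  have iY: "integrable lborel (\<lambda>Z. ?G (?Yp Z))" "integrable lborel (\<lambda>Z. ?G (?Ym Z))"
    using intG by (simp_all only: integral_reflect_shift[OF G])
  have "(\<integral>Z. - (u0 * C3 / p0\<^sup>2) * ?m Z + u0 * ?f Z - D * ((?G (?Yp Z) + ?G (?Ym Z)) / 2) \<partial>lborel) \<le> frac_heat s u P0"
    unfolding frac_heat_def using bound iY
    by (intro integral_mono integrable_sdiff Bochner_Integration.integrable_diff integrable_mult_right int_m int_f
        integrable_divide_zero Bochner_Integration.integrable_add)
  also have "(\<integral>Z. - (u0 * C3 / p0\<^sup>2) * ?m Z + u0 * ?f Z - D * ((?G (?Yp Z) + ?G (?Ym Z)) / 2) \<partial>lborel)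
      = - (u0 * C3 / p0\<^sup>2) * (\<integral>Z. ?m Z \<partial>lborel) + u0 * (\<integral>Z. ?f Z \<partial>lborel)
        - D * (((\<integral>Z. ?G (?Yp Z) \<partial>lborel) + (\<integral>Z. ?G (?Ym Z) \<partial>lborel)) / 2)"
    using iY int_m int_f by (simp only: Bochner_Integration.integral_diff Bochner_Integration.integral_add integral_mult_right_zero
        integral_divide_zero Bochner_Integration.integrable_diff integrable_mult_right integrable_divide_zero Bochner_Integration.integrable_add)
  also have "((\<integral>Z. ?G (?Yp Z) \<partial>lborel) + (\<integral>Z. ?G (?Ym Z) \<partial>lborel)) / 2 = T"
    unfolding integral_reflect_shift(3,4)[OF G] T_def past_potential_eq by simp
  finally have L: "- (u0 * C3 / p0\<^sup>2) * (\<integral>Z. ?m Z \<partial>lborel) + u0 * (R powr (- s) / s) - D * T \<le> frac_heat s u P0"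
    unfolding I_f .
  define W where "W = R powr (- s) / s"
  have W: "0 < W" using s R by (simp add: W_def)
  \<comment> \<open>Writing R^(1 - s) as R * R^(-s) with R = \<theta>^2 p0^2 cancels the p0^2 in the
    denominator. What is left is a multiple of \<theta>^2 times the gain, and \<open>small1\<close>
    makes it a quarter of the gain.\<close>
  have Lm: "(u0 * C3 / p0\<^sup>2) * (\<integral>Z. ?m Z \<partial>lborel) \<le> u0 * W / 4"
  proof -
    have "(u0 * C3 / p0\<^sup>2) * (\<integral>Z. ?m Z \<partial>lborel) \<le> (u0 * C3 / p0\<^sup>2) * (moment_const TYPE('a) * (R powr (1 - s) / (1 - s)))"
      using u0 C3 by (intro mult_left_mono I_m) auto
    also have "R powr (1 - s) = (\<theta>\<^sup>2 * p0\<^sup>2) * R powr (- s)"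
      using R powr_mult_base[of R "- s"] by (simp add: R_def \<rho>_def power_mult_distrib)
    also have "(u0 * C3 / p0\<^sup>2) * (moment_const TYPE('a) * ((\<theta>\<^sup>2 * p0\<^sup>2) * R powr (- s) / (1 - s)))
        = (C3 * (moment_const TYPE('a) / (1 - s)) * \<theta>\<^sup>2) * (u0 * R powr (- s))"
      using p0 by (simp add: field_simps)
    also have "\<dots> \<le> 1 / (4 * s) * (u0 * R powr (- s))"
      using small1 u0 by (intro mult_right_mono) (auto simp: C3_def)
    also have "\<dots> = u0 * W / 4" by (simp add: W_def)
    finally show ?thesis .
  qed
  \<comment> \<open>The zero-order term takes another quarter of the gain, so one half remains. The
    11 exceeds (13 / 4)^2, the bound for p0^2.\<close>
  have KW: "K * u0 \<le> u0 * W / 4"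
  proof -
    have "R \<le> 11 * \<theta>\<^sup>2"
    proof -
      have "p0\<^sup>2 \<le> (13 / 4)\<^sup>2" using p0 p0_le by (intro power_mono) auto
      then have "p0\<^sup>2 \<le> 11" by (simp add: power2_eq_square)
      then show ?thesis using mult_right_mono[of "p0\<^sup>2" 11 "\<theta>\<^sup>2"]
        by (simp add: R_def \<rho>_def power_mult_distrib mult.commute)
    qed
    then have "(11 * \<theta>\<^sup>2) powr (- s) \<le> R powr (- s)"
      using R s by (intro powr_mono2') auto
    then have "4 * s * K \<le> R powr (- s)" using small2 by linarith
    then have "K \<le> W / 4" using s by (simp add: W_def field_simps)
    then show ?thesis using mult_right_mono[of K "W / 4" u0] u0 by (simp add: mult.commute)
  qed
  have "frac_heat s u P0 \<le> K * u0 + \<Psi>"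
    using eq[of P0] P0' by (simp add: u0_def abs_le_iff)
  then have main: "u0 * W / 2 \<le> D * T + \<Psi>"
    using L Lm KW unfolding W_def[symmetric] by simp
  \<comment> \<open>Dividing D by the gain W removes the power -s of R and leaves the power -(1 + n
    / 2).\<close>
  define V where "V = R powr (- (1 + DIM('a) / 2))"
  have V1: "1 \<le> V" unfolding V_def using R R1 powr_mono2'[of "- (1 + DIM('a) / 2)" R 1] by auto
  have Rs: "R powr s \<le> 1" using R R1 s by (intro powr_le1) auto
  have "u0 = u0 * W / 2 * (2 * s * R powr s)"
    using s R by (simp add: W_def powr_minus)
  also have "\<dots> \<le> (D * T + \<Psi>) * (2 * s * R powr s)"
    using s by (intro mult_right_mono[OF main]) simp
  also have "\<dots> = 2 * s * (C1 * (R powr (- kernel_order TYPE('a) s) * R powr s) * T + R powr s * \<Psi>)"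
    by (simp add: D_def algebra_simps)
  also have "R powr (- kernel_order TYPE('a) s) * R powr s = V"
    by (simp add: V_def powr_add[symmetric])
  also have "2 * s * (C1 * V * T + R powr s * \<Psi>) \<le> 2 * s * (((C1 + 1) * V) * T + ((C1 + 1) * V) * \<Psi>)"
  proof -
    have "R powr s \<le> (C1 + 1) * V" using Rs V1 C1 mult_mono[of 1 "C1 + 1" 1 V] by simp
    moreover have "C1 * V \<le> (C1 + 1) * V" using V1 by simp
    ultimately show ?thesis using s T \<Psi> V1 by (intro mult_left_mono add_mono mult_right_mono) auto
  qed
  finally have u0_le: "u0 \<le> 2 * s * (C1 + 1) * (T + \<Psi>) * V" by (simp add: algebra_simps)
  \<comment> \<open>V equals \<rho> to the power -(n + 2), and \<rho> = \<theta> p0. With N = n + 2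
    the unknown p0, which may be arbitrarily small, drops out.\<close>
  have Vp: "V * p0 ^ N = inverse \<theta> ^ N"
  proof -
    have "V = \<rho> powr (- real N)"
      using \<rho> by (simp add: V_def R_def N_def powr_powr flip: powr_numeral)
    also have "\<dots> = inverse \<rho> ^ N"
      using \<rho> by (simp add: powr_minus powr_realpow power_inverse)
    finally show ?thesis using p0 by (simp add: \<rho>_def power_mult_distrib power_inverse)
  qed
  have "u P1 \<le> u0 * p0 ^ N"
    using F1 P0max[OF P1S] unfolding FP0 by linarith
  also have "\<dots> \<le> 2 * s * (C1 + 1) * (T + \<Psi>) * V * p0 ^ N"
    using u0_le p0 by (intro mult_right_mono) auto
  also have "\<dots> = 2 * s * (C1 + 1) * inverse \<theta> ^ N * (T + \<Psi>)"
    by (simp only: Vp[symmetric] mult_ac)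
  finally show ?thesis unfolding T_def .
qed

end

section \<open>The inequality at unit scale\<close>

text \<open>Both conditions persist when \<theta> decreases, so \<theta>^2 can be the minimum of
  three thresholds; the third one solves (11 x)^(-s) = c. The summand 1 in c keeps its negative
  power meaningful for K = 0.\<close>

lemma small_step_exists:
  fixes s A K :: real
  assumes "0 < s" "0 \<le> A" "0 \<le> K"
  obtains \<theta> where "0 < \<theta>" "\<theta> \<le> 1 / 20" "A * \<theta>\<^sup>2 \<le> 1 / (4 * s)" "4 * s * K \<le> (11 * \<theta>\<^sup>2) powr (- s)"
proof -
  define c where "c = 4 * s * K + 1"
  define x where "x = min (1 / 400) (min (1 / (4 * s * (A + 1))) (c powr (- 1 / s) / 11))"
  have c: "1 \<le> c" using assms by (simp add: c_def)
  have x: "0 < x" "x \<le> 1 / 400" "x \<le> 1 / (4 * s * (A + 1))" "11 * x \<le> c powr (- 1 / s)"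
    using assms c by (auto simp: x_def)
  show ?thesis
  proof
    show "0 < sqrt x" using x by simp
    show "sqrt x \<le> 1 / 20"
      using x by (intro real_le_lsqrt) (auto simp: power2_eq_square)
    have "A * x \<le> (A + 1) * (1 / (4 * s * (A + 1)))"
      using x assms by (intro mult_mono) auto
    also have "\<dots> = 1 / (4 * s)" using assms by simp
    finally show "A * (sqrt x)\<^sup>2 \<le> 1 / (4 * s)" using x by simp
    have "c = (c powr (- 1 / s)) powr (- s)" using assms c by (simp add: powr_powr)
    also have "\<dots> \<le> (11 * x) powr (- s)"
      using x assms by (intro powr_mono2') auto
    finally show "4 * s * K \<le> (11 * (sqrt x)\<^sup>2) powr (- s)" using x by (simp add: c_def)
  qed
qed

text \<open>The point P produced by the sliding argument depends on u, but both bounds hold with the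
  potential at this same P, which can therefore be eliminated. \<open>C\<close> is fixed before u,
  \<open>B\<close> and t2, so it survives the passage to unaveraged u.\<close>

lemma harnack_bounded_unit:
  fixes s K :: real
  assumes s: "0 < s" "s < 1" and K: "0 \<le> K"
  obtains C where "0 < C"
    "\<And>(u :: 'a::euclidean_space \<times> real \<Rightarrow> real) B \<Psi> t2 P1 P2. \<lbrakk>bounded_heat_function s u B; 0 \<le> \<Psi>; t2 \<le> 0;
       norm (fst P1) \<le> 1; - 1 \<le> snd P1; snd P1 \<le> - 1 / 2; norm (fst P2) \<le> 1; - 1 / 4 \<le> snd P2; snd P2 \<le> t2;
       \<And>P. norm (fst P) \<le> 19 / 10 \<Longrightarrow> - 19 / 10 \<le> snd P \<Longrightarrow> snd P \<le> t2 \<Longrightarrow> \<bar>frac_heat s u P\<bar> \<le> K * u P + \<Psi>\<rbrakk> \<Longrightarrow>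
       u P1 \<le> C * (u P2 + \<Psi>)"
proof -
  let ?N = "DIM('a) + 2"
  obtain C1 where C1: "0 < C1" and compare:
    "\<And>z z' :: 'a. \<And>t g R. \<lbrakk>0 < R; R \<le> 1; 0 < t; 1 / 20 \<le> g; g \<le> 2; norm (z' - z) \<le> 4;
       R < t \<or> R < (norm z)\<^sup>2\<rbrakk> \<Longrightarrow>
       frac_kernel s (z, t) \<le> C1 * R powr (- kernel_order TYPE('a) s) * frac_kernel s (z', t + g)"
    using frac_kernel_compare[OF s(1), where 'a='a] by metis
  obtain C2 :: real where C2: "0 \<le> C2" and pw:
    "\<And>e::real. \<bar>e\<bar> \<le> 1 / 2 \<Longrightarrow> inverse (1 + e) ^ ?N \<le> 1 - ?N * e + C2 * e\<^sup>2"
    using inverse_power_bound[where N="?N"] by metis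
  have A: "0 \<le> (9 * ?N + 40 * C2) * (moment_const TYPE('a) / (1 - s))"
    using C2 s moment_const_ge[where 'a='a] by simp
  obtain \<theta> where \<theta>: "0 < \<theta>" "\<theta> \<le> 1 / 20"
    and small: "(9 * ?N + 40 * C2) * (moment_const TYPE('a) / (1 - s)) * \<theta>\<^sup>2 \<le> 1 / (4 * s)" "4 * s * K \<le> (11 * \<theta>\<^sup>2) powr (- s)"
    using small_step_exists[OF s(1) A K] by metis
  define E where "E = 2 * s * (C1 + 1) * inverse \<theta> ^ ?N"
  \<comment> \<open>The summand 2 is there because \<Psi> enters once through each of the two
    bounds.\<close>
  define M where "M = 15 * kernel_const TYPE('a) s + 27 / 4 * K + 2"
  have E: "0 < E" using s C1 \<theta> by (simp add: E_def)
  have M: "2 \<le> M" using kernel_const_pos[OF s, where 'a='a] K by (simp add: M_def)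
  show ?thesis
  proof
    show "0 < E * M" using E M by simp
    fix u :: "'a \<times> real \<Rightarrow> real" and B \<Psi> t2 and P1 P2 :: "'a \<times> real"
    assume "bounded_heat_function s u B" and \<Psi>: "0 \<le> \<Psi>" and t2: "t2 \<le> 0"
      and P1: "norm (fst P1) \<le> 1" "- 1 \<le> snd P1" "snd P1 \<le> - 1 / 2"
      and P2: "norm (fst P2) \<le> 1" "- 1 / 4 \<le> snd P2" "snd P2 \<le> t2"
      and eq: "\<And>P. norm (fst P) \<le> 19 / 10 \<Longrightarrow> - 19 / 10 \<le> snd P \<Longrightarrow> snd P \<le> t2 \<Longrightarrow> \<bar>frac_heat s u P\<bar> \<le> K * u P + \<Psi>"
    then interpret bounded_heat_function s u B by simp
    \<comment> \<open>The excess \<eta> of the sliding argument costs E * M * \<eta> = \<epsilon>,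
      and \<epsilon> is arbitrary.\<close>
    have step: "u P1 \<le> E * M * (u P2 + \<Psi>) + \<epsilon>" if \<epsilon>: "0 < \<epsilon>" for \<epsilon>
    proof -
      define \<eta> where "\<eta> = \<epsilon> / (E * M)"
      have \<eta>: "0 < \<eta>" using \<epsilon> E M by (simp add: \<eta>_def)
      obtain P where P: "norm (fst P) \<le> 19 / 10" "- 9 / 20 \<le> snd P" "snd P \<le> t2"
        and pot: "past_potential s u (- 1 / 2) P \<le> (u P2 + \<eta>) * (15 * kernel_const TYPE('a) s + 27 / 4 * K) + \<Psi>"
        by (rule past_potential_le[OF t2 P2 K \<eta> eq])
      have "u P1 \<le> E * (past_potential s u (- 1 / 2) P + \<Psi>)"
        unfolding E_def
      proof (rule le_past_potential[OF C1 compare C2 pw \<theta> small \<Psi> P1 P(1,2)])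
        show "snd P \<le> 0" using P t2 by simp
        fix Y :: "'a \<times> real"
        assume "norm (fst Y) \<le> 19 / 10" "- 19 / 10 \<le> snd Y" "snd Y \<le> - 1 / 2"
        then show "\<bar>frac_heat s u Y\<bar> \<le> K * u Y + \<Psi>" using P2 by (intro eq) auto
      qed
      also have "\<dots> \<le> E * ((u P2 + \<eta>) * M + \<Psi> * M)"
      proof (rule mult_left_mono)
        have "(u P2 + \<eta>) * (15 * kernel_const TYPE('a) s + 27 / 4 * K) \<le> (u P2 + \<eta>) * M"
          using nonneg[of P2] \<eta> by (intro mult_left_mono) (auto simp: M_def)
        moreover have "\<Psi> * 2 \<le> \<Psi> * M" using M \<Psi> by (intro mult_left_mono) auto
        ultimately show "past_potential s u (- 1 / 2) P + \<Psi> \<le> (u P2 + \<eta>) * M + \<Psi> * M"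
          using pot by linarith
      qed (use E in simp)
      also have "\<dots> = E * M * (u P2 + \<Psi>) + \<epsilon>"
        using E M by (simp add: \<eta>_def algebra_simps)
      finally show ?thesis .
    qed
    then show "u P1 \<le> E * M * (u P2 + \<Psi>)"
      by (rule field_le_epsilon)
  qed
qed

section \<open>Parabolic scaling to radius r\<close>

text \<open>The kernel is homogeneous of degree -(n + 2 + 2 s) under (z, t) -> (r z, r^2 t). The
  factor r^(n + 2) is the Jacobian of the dilation, and r^(2 s) reflects the order of the
  operator.\<close>

lemma frac_kernel_scale:
  fixes z :: "'a::euclidean_space"
  assumes r: "0 < r"
  shows "frac_kernel s (z, t) = r powr (2 * s) * (r ^ DIM('a) * r\<^sup>2) * frac_kernel s (r *\<^sub>R z, r\<^sup>2 * t)"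
proof (cases "0 < t")
  case True
  have rt: "0 < r\<^sup>2 * t" using True r by simp
  let ?D = "r powr (2 * s) * (r ^ DIM('a) * r\<^sup>2)"
  have D: "?D \<noteq> 0" using r by simp
  have "(r\<^sup>2 * t) powr (- kernel_order TYPE('a) s) = (r powr 2) powr (- kernel_order TYPE('a) s) * t powr (- kernel_order TYPE('a) s)"
    using r by (simp add: powr_mult)
  also have "(r powr 2) powr (- kernel_order TYPE('a) s) = r powr (- (2 * s + (DIM('a) + 2)))"
  proof -
    have "2 * (- kernel_order TYPE('a) s) = - (2 * s + (DIM('a) + 2))" by simp
    then show ?thesis by (simp only: powr_powr)
  qed
  also have "\<dots> = inverse ?D"
  proof -
    have "r powr (real DIM('a) + 2) = r ^ DIM('a) * r\<^sup>2"
      using r by (simp add: powr_add powr_realpow)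
    then show ?thesis by (simp only: powr_minus powr_add[of r "2 * s"] of_nat_add of_nat_numeral)
  qed
  finally have "?D * (r\<^sup>2 * t) powr (- kernel_order TYPE('a) s) = (?D * inverse ?D) * t powr (- kernel_order TYPE('a) s)"
    by (simp only: mult.assoc)
  then have e: "?D * (r\<^sup>2 * t) powr (- kernel_order TYPE('a) s) = t powr (- kernel_order TYPE('a) s)"
    by (simp only: right_inverse[OF D] mult_1_left)
  have "(norm (r *\<^sub>R z))\<^sup>2 / (4 * (r\<^sup>2 * t)) = (norm z)\<^sup>2 / (4 * t)"
    using r by (simp add: power_mult_distrib)
  then show ?thesis
    unfolding frac_kernel_alt[OF True] frac_kernel_alt[OF rt] e[symmetric]
    by (simp add: mult_ac)
next
  case False
  then have "r\<^sup>2 * t \<le> 0" by (simp add: mult_nonneg_nonpos)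
  then show ?thesis using False by (simp add: frac_kernel_def)
qed

definition dilate :: "real \<Rightarrow> 'a::euclidean_space \<times> real \<Rightarrow> 'a \<times> real" where
  "dilate r Z = (r *\<^sub>R fst Z, r\<^sup>2 * snd Z)"

lemma sdiff_dilate: "sdiff (u \<circ> dilate r) P Z = sdiff u (dilate r P) (dilate r Z)"
  by (simp add: sdiff_def dilate_def algebra_simps)

lemma frac_heat_dilate:
  fixes u :: "'a::euclidean_space \<times> real \<Rightarrow> real"
  assumes r: "0 < r" and [measurable]: "u \<in> borel_measurable borel"
    and int: "integrable lborel (\<lambda>Z. sdiff u (dilate r P) Z * frac_kernel s Z)"
  shows "integrable lborel (\<lambda>Z. sdiff (u \<circ> dilate r) P Z * frac_kernel s Z)"
    and "frac_heat s (u \<circ> dilate r) P = r powr (2 * s) * frac_heat s u (dilate r P)"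
proof -
  let ?f = "\<lambda>Z. sdiff u (dilate r P) Z * frac_kernel s Z"
  let ?c = "r powr (2 * s) * (r ^ DIM('a) * r\<^sup>2)"
  have f[measurable]: "?f \<in> borel_measurable borel"
    using int by (simp add: borel_measurable_integrable)
  have r2: "r \<noteq> 0" "r\<^sup>2 \<noteq> 0" using r by auto
  have e: "sdiff (u \<circ> dilate r) P Z * frac_kernel s Z = ?c * ?f (fst (0 :: 'a \<times> real) + r *\<^sub>R fst Z, snd (0 :: 'a \<times> real) + r\<^sup>2 * snd Z)" for Z
    using frac_kernel_scale[OF r, of s "fst Z" "snd Z"] unfolding sdiff_dilate by (simp add: dilate_def)
  note aff = lborel_affine_prod_integral[OF r2 f, of "0 :: 'a \<times> real"]
  show "integrable lborel (\<lambda>Z. sdiff (u \<circ> dilate r) P Z * frac_kernel s Z)"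
    unfolding e using aff(1) int by (intro integrable_mult_right) blast
  show "frac_heat s (u \<circ> dilate r) P = r powr (2 * s) * frac_heat s u (dilate r P)"
    unfolding frac_heat_def e aff(2) using r by simp
qed

text \<open>\<open>C\<close> stands outside the quantifiers over r and K', which enter only through
  the bound \<open>K\<close> for r^(2 s) K'. This is the dependence of the constant that the final
  statement requires.\<close>

definition harnack_bound :: "'a::euclidean_space itself \<Rightarrow> real \<Rightarrow> real \<Rightarrow> real \<Rightarrow> bool" where
  "harnack_bound _ s K C \<longleftrightarrow> (\<forall>(u :: 'a \<times> real \<Rightarrow> real) B \<Psi> r K' t2 P1 P2.
     bounded_heat_function s u B \<longrightarrow> 0 < r \<longrightarrow> 0 \<le> \<Psi> \<longrightarrow> t2 \<le> 0 \<longrightarrow> r powr (2 * s) * K' \<le> K \<longrightarrow>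
     norm (fst P1) \<le> r \<longrightarrow> - r\<^sup>2 \<le> snd P1 \<longrightarrow> snd P1 \<le> - r\<^sup>2 / 2 \<longrightarrow>
     norm (fst P2) \<le> r \<longrightarrow> - r\<^sup>2 / 4 \<le> snd P2 \<longrightarrow> snd P2 \<le> t2 \<longrightarrow>
     (\<forall>P. norm (fst P) \<le> 19 / 10 * r \<longrightarrow> - 19 / 10 * r\<^sup>2 \<le> snd P \<longrightarrow> snd P \<le> t2 \<longrightarrow>
       \<bar>frac_heat s u P\<bar> \<le> K' * u P + \<Psi>) \<longrightarrow>
     u P1 \<le> C * (u P2 + r powr (2 * s) * \<Psi>))"

lemma harnack_bounded:
  fixes s K :: real
  assumes s: "0 < s" "s < 1" and K: "0 \<le> K"
  shows "\<exists>C>0. harnack_bound TYPE('a::euclidean_space) s K C"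
proof -
  obtain C where C: "0 < C" and harnack:
    "\<And>(u :: 'a \<times> real \<Rightarrow> real) B \<Psi> t2 P1 P2. \<lbrakk>bounded_heat_function s u B; 0 \<le> \<Psi>; t2 \<le> 0;
       norm (fst P1) \<le> 1; - 1 \<le> snd P1; snd P1 \<le> - 1 / 2; norm (fst P2) \<le> 1; - 1 / 4 \<le> snd P2; snd P2 \<le> t2;
       \<And>P. norm (fst P) \<le> 19 / 10 \<Longrightarrow> - 19 / 10 \<le> snd P \<Longrightarrow> snd P \<le> t2 \<Longrightarrow> \<bar>frac_heat s u P\<bar> \<le> K * u P + \<Psi>\<rbrakk> \<Longrightarrow>
       u P1 \<le> C * (u P2 + \<Psi>)"
    using harnack_bounded_unit[OF s K, where 'a='a] by blast
  have "harnack_bound TYPE('a) s K C"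
    unfolding harnack_bound_def
  proof (intro allI impI)
    fix u :: "'a \<times> real \<Rightarrow> real" and B \<Psi> r K' t2 and P1 P2 :: "'a \<times> real"
    assume u: "bounded_heat_function s u B" and r: "0 < r" and \<Psi>: "0 \<le> \<Psi>" and t2: "t2 \<le> 0"
      and K': "r powr (2 * s) * K' \<le> K"
      and P1: "norm (fst P1) \<le> r" "- r\<^sup>2 \<le> snd P1" "snd P1 \<le> - r\<^sup>2 / 2"
      and P2: "norm (fst P2) \<le> r" "- r\<^sup>2 / 4 \<le> snd P2" "snd P2 \<le> t2"
      and eq: "\<forall>P. norm (fst P) \<le> 19 / 10 * r \<longrightarrow> - 19 / 10 * r\<^sup>2 \<le> snd P \<longrightarrow> snd P \<le> t2 \<longrightarrow> \<bar>frac_heat s u P\<bar> \<le> K' * u P + \<Psi>"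
    interpret bounded_heat_function s u B by fact
    let ?v = "u \<circ> dilate r"
    define Q where "Q P = (fst P /\<^sub>R r, snd P / r\<^sup>2)" for P :: "'a \<times> real"
    have Q: "dilate r (Q P) = P" for P using r by (simp add: Q_def dilate_def)
    have r2: "0 < r\<^sup>2" using r by simp
    have vb: "bounded_heat_function s ?v B"
    proof
      show "continuous_on UNIV ?v"
        unfolding dilate_def by (intro continuous_on_compose continuous_intros continuous_on_subset[OF cont]) auto
      show "integrable lborel (\<lambda>Z. sdiff ?v P Z * frac_kernel s Z)" for P
        by (intro frac_heat_dilate r u_measurable integrable_sdiff)
    qed (use s nonneg bdd in auto)
    have ve: "\<bar>frac_heat s ?v P\<bar> \<le> K * ?v P + r powr (2 * s) * \<Psi>"
      if P: "norm (fst P) \<le> 19 / 10" "- 19 / 10 \<le> snd P" "snd P \<le> t2 / r\<^sup>2" for P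
    proof -
      have "\<bar>frac_heat s u (dilate r P)\<bar> \<le> K' * u (dilate r P) + \<Psi>"
      proof (rule eq[rule_format])
        show "norm (fst (dilate r P)) \<le> 19 / 10 * r" using P r by (simp add: dilate_def)
        show "- 19 / 10 * r\<^sup>2 \<le> snd (dilate r P)"
          using mult_left_mono[OF P(2), of "r\<^sup>2"] by (simp add: dilate_def)
        show "snd (dilate r P) \<le> t2"
          using P(3) r2 by (simp add: dilate_def pos_le_divide_eq mult.commute)
      qed
      then have "r powr (2 * s) * \<bar>frac_heat s u (dilate r P)\<bar> \<le> r powr (2 * s) * (K' * u (dilate r P) + \<Psi>)"
        by (intro mult_left_mono) auto
      also have "\<dots> = (r powr (2 * s) * K') * u (dilate r P) + r powr (2 * s) * \<Psi>"
        by (simp add: algebra_simps)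
      also have "\<dots> \<le> K * u (dilate r P) + r powr (2 * s) * \<Psi>"
        using K' nonneg \<Psi> by (intro add_mono mult_right_mono) auto
      finally show ?thesis
        using frac_heat_dilate(2)[OF r u_measurable integrable_sdiff] by (simp add: abs_mult)
    qed
    have "?v (Q P1) \<le> C * (?v (Q P2) + r powr (2 * s) * \<Psi>)"
    proof (rule harnack[OF vb _ _ _ _ _ _ _ _ ve])
      show "norm (fst (Q P1)) \<le> 1" "norm (fst (Q P2)) \<le> 1"
        using P1 P2 r by (auto simp: Q_def field_simps)
      show "- 1 \<le> snd (Q P1)" "snd (Q P1) \<le> - 1 / 2" "- 1 / 4 \<le> snd (Q P2)" "snd (Q P2) \<le> t2 / r\<^sup>2"
        using P1 P2 r2 by (auto simp: Q_def field_simps)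
      show "t2 / r\<^sup>2 \<le> 0" using t2 by (simp add: divide_nonpos_nonneg)
    qed (use \<Psi> in auto)
    then show "u P1 \<le> C * (u P2 + r powr (2 * s) * \<Psi>)" by (simp add: Q)
  qed
  with C show ?thesis by blast
qed


section \<open>The symbol as an average of exponentials\<close>

text \<open>The Levy density of the one-sided s-stable subordinator, up to normalisation.\<close>

definition stable_density :: "real \<Rightarrow> real \<Rightarrow> real" where
  "stable_density s t = indicator {0<..} t * t powr (- 1 - s)"

lemma stable_density_nonneg [simp]: "0 \<le> stable_density s t"
  by (simp add: stable_density_def)

lemma stable_density_measurable [measurable]: "stable_density s \<in> borel_measurable borel"
  unfolding stable_density_def by measurable

lemma integrable_stable_density_min:
  assumes s: "0 < s" "s < 1"
  shows "integrable lborel (\<lambda>t. stable_density s t * min 1 t)"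
proof (rule Bochner_Integration.integrable_bound)
  have "integrable lborel (\<lambda>t. indicator {0<..1} t * t powr (- s))"
    by (rule integrableI_nonneg) (use s in \<open>simp_all add: nn_integral_powr_from_0\<close>)
  moreover have "integrable lborel (\<lambda>t. indicator {1<..} t * t powr (- 1 - s))"
    by (rule integrableI_nonneg) (use s in \<open>simp_all add: nn_integral_powr_to_inf\<close>)
  ultimately show "integrable lborel (\<lambda>t. indicator {0<..1} t * t powr (- s) + indicator {1<..} t * t powr (- 1 - s))"
    by simp
  show "AE t in lborel. norm (stable_density s t * min 1 t) \<le> norm (indicator {0<..1} t * t powr (- s) + indicator {1<..} t * t powr (- 1 - s))"
  proof (rule AE_I2)
    fix t :: real
    have "0 < t \<Longrightarrow> t powr (- 1 - s) * t = t powr (- s)"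
      using powr_mult_base[of t "- 1 - s"] by (simp add: mult.commute)
    then show "norm (stable_density s t * min 1 t) \<le> norm (indicator {0<..1} t * t powr (- s) + indicator {1<..} t * t powr (- 1 - s))"
      by (auto simp: stable_density_def indicator_def min_def)
  qed
qed simp

lemma norm_exp_diff_le:
  fixes x y :: complex
  assumes t: "0 \<le> t" and x: "a \<le> Re x" and y: "a \<le> Re y"
  shows "norm (exp (- (of_real t * x)) - exp (- (of_real t * y))) \<le> t * exp (- (a * t)) * norm (x - y)"
proof (rule field_differentiable_bound[where S="{z. a \<le> Re z}" and f="\<lambda>z. exp (- (of_real t * z))"
      and f'="\<lambda>z. - of_real t * exp (- (of_real t * z))"])
  show "convex {z. a \<le> Re z}" by (rule convex_halfspace_Re_ge)
  fix z assume z: "z \<in> {z. a \<le> Re z}"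
  show "((\<lambda>z. exp (- (of_real t * z))) has_field_derivative - of_real t * exp (- (of_real t * z))) (at z within {z. a \<le> Re z})"
    by (auto intro!: derivative_eq_intros)
  have "norm (- of_real t * exp (- (of_real t * z))) = t * exp (- (t * Re z))"
    using t by (simp add: norm_mult)
  also have "\<dots> \<le> t * exp (- (a * t))"
    using z t mult_right_mono[of a "Re z" t] by (intro mult_left_mono) (auto simp: mult.commute)
  finally show "norm (- of_real t * exp (- (of_real t * z))) \<le> t * exp (- (a * t))" .
qed (use x y in auto)

lemma norm_one_minus_exp_le:
  fixes x :: complex
  assumes "0 \<le> t" "0 \<le> Re x"
  shows "norm (1 - exp (- (of_real t * x))) \<le> 2 * (1 + norm x) * min 1 t"
proof -
  have "norm (1 - exp (- (of_real t * x))) \<le> t * norm x"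
    using norm_exp_diff_le[OF assms(1), of 0 0 x] assms by simp
  also have "\<dots> \<le> 2 * (1 + norm x) * t"
    using assms by (simp add: algebra_simps)
  finally have 1: "norm (1 - exp (- (of_real t * x))) \<le> 2 * (1 + norm x) * t" .
  have "norm (1 - exp (- (of_real t * x))) \<le> 1 + norm (exp (- (of_real t * x)))"
    using norm_triangle_ineq4[of 1 "exp (- (of_real t * x))"] by simp
  also have "\<dots> \<le> 2" using assms by simp
  also have "\<dots> \<le> 2 * (1 + norm x)" by simp
  finally show ?thesis using 1 by (auto simp: min_def)
qed

text \<open>Bochner's subordination formula: up to a constant this will be x^s. With x the symbol of
  the heat operator, exp(-t x) is the symbol of the heat flow combined with a shift by t in
  time.\<close>

definition subordinate :: "real \<Rightarrow> complex \<Rightarrow> complex" where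
  "subordinate s x = (\<integral>t. stable_density s t *\<^sub>R (1 - exp (- (of_real t * x))) \<partial>lborel)"

lemma integrable_subordinate:
  assumes s: "0 < s" "s < 1" and x: "0 \<le> Re x"
  shows "integrable lborel (\<lambda>t. stable_density s t *\<^sub>R (1 - exp (- (of_real t * x))))"
proof (rule Bochner_Integration.integrable_bound)
  show "integrable lborel (\<lambda>t. (2 * (1 + norm x)) * (stable_density s t * min 1 t))"
    by (intro integrable_mult_right integrable_stable_density_min s)
  show "AE t in lborel. norm (stable_density s t *\<^sub>R (1 - exp (- (of_real t * x))))
      \<le> norm ((2 * (1 + norm x)) * (stable_density s t * min 1 t))"
  proof (rule AE_I2)
    fix t :: real
    show "norm (stable_density s t *\<^sub>R (1 - exp (- (of_real t * x)))) \<le> norm ((2 * (1 + norm x)) * (stable_density s t * min 1 t))"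
    proof (cases "0 < t")
      case True
      have "stable_density s t * norm (1 - exp (- (of_real t * x))) \<le> stable_density s t * (2 * (1 + norm x) * min 1 t)"
        using True x by (intro mult_left_mono norm_one_minus_exp_le) auto
      then show ?thesis using True by (simp add: abs_mult mult_ac)
    qed (simp add: stable_density_def)
  qed
  show "(\<lambda>t. stable_density s t *\<^sub>R (1 - exp (- (of_real t * x)))) \<in> borel_measurable lborel"
    by measurable
qed

text \<open>Differentiation under the integral sign, by dominated convergence of the difference
  quotients along sequences.\<close>

lemma subordinate_holomorphic:
  assumes s: "0 < s" "s < 1"
  shows "subordinate s holomorphic_on {x. 0 < Re x}"
proof -
  have "\<exists>D. (subordinate s has_field_derivative D) (at x)" if x: "0 < Re x" for x
  proof -
    \<comment> \<open>Near x the real parts stay above a, so the difference quotients are bounded by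
      t * exp (- a t). This is at most t and at most 1 / a, hence integrable against the density at
      both ends.\<close>
    define a where "a = Re x / 2"
    have a: "0 < a" using x by (simp add: a_def)
    define D where "D = (\<integral>t. stable_density s t *\<^sub>R (of_real t * exp (- (of_real t * x))) \<partial>lborel)"
    have "((\<lambda>y. (subordinate s y - subordinate s x) / (y - x)) \<longlongrightarrow> D) (at x)"
      unfolding tendsto_at_iff_sequentially comp_def
    proof (intro allI impI)
      fix X :: "nat \<Rightarrow> complex"
      assume X: "\<forall>i. X i \<in> UNIV - {x}" "X \<longlonglongrightarrow> x"
      have "eventually (\<lambda>y. y \<in> {y. a < Re y}) (nhds x)"
        using x by (intro eventually_nhds_in_open open_halfspace_Re_gt) (auto simp: a_def)
      then have "eventually (\<lambda>n. a < Re (X n)) sequentially"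
        using X(2) unfolding tendsto_def by (auto dest: filterlim_iff[THEN iffD1, OF X(2), rule_format])
      then obtain n0 where n0: "\<And>n. n0 \<le> n \<Longrightarrow> a < Re (X n)"
        by (auto simp: eventually_sequentially)
      \<comment> \<open>The dominating function must work for every index, so the finitely many
        terms possibly outside the half plane are dropped.\<close>
      define Y where "Y n = X (n + n0)" for n
      have Y: "Y n \<noteq> x" "a < Re (Y n)" for n using X(1) n0 by (auto simp: Y_def)
      have Ylim: "Y \<longlonglongrightarrow> x" unfolding Y_def using X(2) by (rule LIMSEQ_ignore_initial_segment)
      define q where "q n t = stable_density s t *\<^sub>R ((exp (- (of_real t * x)) - exp (- (of_real t * Y n))) / (Y n - x))" for n t
      have q: "(subordinate s (Y n) - subordinate s x) / (Y n - x) = (\<integral>t. q n t \<partial>lborel)" for n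
      proof -
        have "subordinate s (Y n) - subordinate s x = (\<integral>t. stable_density s t *\<^sub>R (1 - exp (- (of_real t * Y n)))
            - stable_density s t *\<^sub>R (1 - exp (- (of_real t * x))) \<partial>lborel)"
          unfolding subordinate_def using s x a Y(2)[of n]
          by (intro Bochner_Integration.integral_diff[symmetric] integrable_subordinate) auto
        then have "(subordinate s (Y n) - subordinate s x) / (Y n - x) = (\<integral>t. (stable_density s t *\<^sub>R (1 - exp (- (of_real t * Y n)))
            - stable_density s t *\<^sub>R (1 - exp (- (of_real t * x)))) / (Y n - x) \<partial>lborel)"
          by simp
        also have "\<dots> = (\<integral>t. q n t \<partial>lborel)"
          by (intro Bochner_Integration.integral_cong refl) (simp add: q_def scaleR_conv_of_real right_diff_distrib diff_divide_distrib)
        finally show ?thesis .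
      qed
      have "(\<lambda>n. \<integral>t. q n t \<partial>lborel) \<longlonglongrightarrow> D"
        unfolding D_def
      proof (rule integral_dominated_convergence)
        show "integrable lborel (\<lambda>t. (1 + 1 / a) * (stable_density s t * min 1 t))"
          by (intro integrable_mult_right integrable_stable_density_min s)
        show "AE t in lborel. norm (q n t) \<le> (1 + 1 / a) * (stable_density s t * min 1 t)" for n
        proof (rule AE_I2)
          fix t :: real
          show "norm (q n t) \<le> (1 + 1 / a) * (stable_density s t * min 1 t)"
          proof (cases "0 < t")
            case True
            have "norm (exp (- (of_real t * x)) - exp (- (of_real t * Y n))) \<le> t * exp (- (a * t)) * norm (x - Y n)"
              using True x Y(2)[of n] by (intro norm_exp_diff_le) (auto simp: a_def)
            then have "norm ((exp (- (of_real t * x)) - exp (- (of_real t * Y n))) / (Y n - x)) \<le> t * exp (- (a * t))"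
              using Y(1)[of n] by (simp add: norm_divide pos_divide_le_eq norm_minus_commute)
            also have "\<dots> \<le> (1 + 1 / a) * min 1 t"
            proof -
              have "a * t \<le> exp (a * t)" using exp_ge_add_one_self[of "a * t"] by linarith
              then have "t * exp (- (a * t)) \<le> 1 / a" using a by (simp add: exp_minus field_simps)
              moreover have "t * exp (- (a * t)) \<le> t * 1" using True a by (intro mult_left_mono) auto
              moreover have "0 \<le> 1 / a * t" "0 < 1 / a" using True a by auto
              ultimately show ?thesis by (simp add: min_def distrib_right)
            qed
            finally have "stable_density s t * norm ((exp (- (of_real t * x)) - exp (- (of_real t * Y n))) / (Y n - x))
                \<le> stable_density s t * ((1 + 1 / a) * min 1 t)"
              by (intro mult_left_mono) auto
            then show ?thesis by (simp add: q_def mult_ac)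
          qed (simp add: q_def stable_density_def)
        qed
        show "AE t in lborel. (\<lambda>n. q n t) \<longlonglongrightarrow> stable_density s t *\<^sub>R (of_real t * exp (- (of_real t * x)))"
        proof (rule AE_I2)
          fix t :: real
          have "((\<lambda>z. - exp (- (of_real t * z))) has_field_derivative of_real t * exp (- (of_real t * x))) (at x)"
            by (auto intro!: derivative_eq_intros)
          then have "((\<lambda>z. (- exp (- (of_real t * z)) - - exp (- (of_real t * x))) / (z - x)) \<longlongrightarrow> of_real t * exp (- (of_real t * x))) (at x)"
            by (simp only: has_field_derivative_iff)
          then have "(\<lambda>n. (- exp (- (of_real t * Y n)) - - exp (- (of_real t * x))) / (Y n - x)) \<longlonglongrightarrow> of_real t * exp (- (of_real t * x))"
            using Ylim Y(1) unfolding tendsto_at_iff_sequentially comp_def by auto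
          then show "(\<lambda>n. q n t) \<longlonglongrightarrow> stable_density s t *\<^sub>R (of_real t * exp (- (of_real t * x)))"
            unfolding q_def by (intro tendsto_scaleR tendsto_const) simp
        qed
        show "(\<lambda>t. stable_density s t *\<^sub>R (of_real t * exp (- (of_real t * x)))) \<in> borel_measurable lborel"
          by measurable
        show "(\<lambda>t. q n t) \<in> borel_measurable lborel" for n
          unfolding q_def by measurable
      qed
      then have "(\<lambda>n. (subordinate s (Y n) - subordinate s x) / (Y n - x)) \<longlonglongrightarrow> D"
        by (simp add: q)
      then show "(\<lambda>n. (subordinate s (X n) - subordinate s x) / (X n - x)) \<longlonglongrightarrow> D"
        unfolding Y_def by (rule LIMSEQ_offset)
    qed
    then show ?thesis by (auto simp: has_field_derivative_iff)
  qed
  then show ?thesis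
    by (auto simp: holomorphic_on_def field_differentiable_def intro: has_field_derivative_at_within)
qed

text \<open>The factor between \<open>frac_heat\<close> and H^s. Its value is Gamma(1 - s) / s, but
  only its sign matters.\<close>

definition stable_const :: "real \<Rightarrow> real" where
  "stable_const s = (\<integral>t. stable_density s t * (1 - exp (- t)) \<partial>lborel)"

text \<open>Substituting t / a for t, using the homogeneity of the density.\<close>

lemma subordinate_of_real:
  assumes s: "0 < s" "s < 1" and a: "0 < a"
  shows "subordinate s (of_real a) = of_real (stable_const s * a powr s)"
proof -
  have "stable_density s t *\<^sub>R (1 - exp (- (of_real t * of_real a))) = complex_of_real (stable_density s t * (1 - exp (- (t * a))))" for t
    by (simp add: scaleR_conv_of_real exp_of_real[symmetric])
  then have "subordinate s (of_real a) = of_real (\<integral>t. stable_density s t * (1 - exp (- (t * a))) \<partial>lborel)"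
    unfolding subordinate_def by (simp only: integral_complex_of_real)
  also have "(\<integral>t. stable_density s t * (1 - exp (- (t * a))) \<partial>lborel) =
      \<bar>1 / a\<bar> *\<^sub>R (\<integral>t. stable_density s (0 + 1 / a * t) * (1 - exp (- ((0 + 1 / a * t) * a))) \<partial>lborel)"
    using a by (intro lborel_integral_real_affine) simp
  also have "\<dots> = \<bar>1 / a\<bar> *\<^sub>R (\<integral>t. a powr (1 + s) * (stable_density s t * (1 - exp (- t))) \<partial>lborel)"
  proof -
    have "stable_density s (0 + 1 / a * t) = a powr (1 + s) * stable_density s t" for t
    proof (cases "0 < t")
      case True
      have "a powr (- 1 - s) = inverse (a powr (1 + s))"
        using powr_minus[of a "1 + s"] by (simp add: algebra_simps)
      then have "(t / a) powr (- 1 - s) = a powr (1 + s) * t powr (- 1 - s)"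
        using a True by (simp add: powr_divide) (simp add: divide_inverse)
      then show ?thesis using a True by (simp add: stable_density_def)
    next
      case False
      then have "\<not> 0 < t / a" using a by (simp add: zero_less_divide_iff)
      then show ?thesis using False by (simp add: stable_density_def)
    qed
    moreover have "(0 + 1 / a * t) * a = t" for t using a by simp
    ultimately show ?thesis by (simp only: mult.assoc)
  qed
  also have "\<dots> = stable_const s * a powr s"
    using a by (simp add: stable_const_def powr_add)
  finally show ?thesis .
qed

lemma stable_const_pos:
  assumes s: "0 < s" "s < 1"
  shows "0 < stable_const s"
proof -
  define c :: real where "c = 1 - exp (- 1)"
  have c: "0 < c" by (simp add: c_def)
  have "(\<integral>t. c * (indicator {1<..} t * t powr (- 1 - s)) \<partial>lborel) \<le> stable_const s"
    unfolding stable_const_def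
  proof (rule integral_mono)
    show "integrable lborel (\<lambda>t. c * (indicator {1<..} t * t powr (- 1 - s)))"
      by (intro integrable_mult_right integrableI_nonneg) (use s in \<open>simp_all add: nn_integral_powr_to_inf\<close>)
    have "integrable lborel (\<lambda>t. Re (stable_density s t *\<^sub>R (1 - exp (- (of_real t * 1)))))"
      by (intro integrable_Re integrable_subordinate s) simp
    then show "integrable lborel (\<lambda>t. stable_density s t * (1 - exp (- t)))"
      by (simp add: Re_exp)
    show "c * (indicator {1<..} t * t powr (- 1 - s)) \<le> stable_density s t * (1 - exp (- t))" for t :: real
      by (auto simp: stable_density_def indicator_def c_def mult.commute intro!: mult_right_mono)
  qed
  moreover have "(\<integral>t. indicator {1<..} t * t powr (- 1 - s) \<partial>lborel) = 1 / s"
    by (rule integral_eq_nn_integral[THEN trans]) (use s nn_integral_powr_to_inf[of s 1] in simp_all)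
  ultimately have "c * (1 / s) \<le> stable_const s" by (simp only: integral_mult_right_zero)
  moreover have "0 < c * (1 / s)" using c s by simp
  ultimately show ?thesis by (rule less_le_trans[rotated])
qed

text \<open>Both sides are holomorphic in the right half plane and agree on the positive reals, so
  they agree by the identity theorem. This is where the principal branch of the power
  enters.\<close>

lemma subordinate_eq_powr:
  assumes s: "0 < s" "s < 1" and x: "0 < Re x"
  shows "subordinate s x = of_real (stable_const s) * x powr of_real s"
proof -
  let ?f = "\<lambda>x. subordinate s x - of_real (stable_const s) * x powr of_real s"
  have "?f x = 0"
  proof (rule analytic_continuation[where S="{x. 0 < Re x}" and U="of_real ` {0<..}" and \<xi>=1 and f="?f"])
    show "?f holomorphic_on {x. 0 < Re x}"
      by (intro holomorphic_intros subordinate_holomorphic s) (auto simp: complex_nonpos_Reals_iff)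
    show "open {x. 0 < Re x}" by (rule open_halfspace_Re_gt)
    show "connected {x. 0 < Re x}" by (intro convex_connected convex_halfspace_Re_gt)
    show "(1::complex) islimpt complex_of_real ` {0<..}"
    proof (rule islimptI)
      fix T :: "complex set"
      assume "1 \<in> T" "open T"
      then obtain e where e: "0 < e" "ball 1 e \<subseteq> T" by (meson openE)
      have "dist 1 (complex_of_real (1 + e / 2)) = e / 2"
        using e by (simp add: dist_norm)
      then have "complex_of_real (1 + e / 2) \<in> T"
        using e by (intro subsetD[OF e(2)]) simp
      moreover have "complex_of_real (1 + e / 2) \<noteq> 1" using e by (simp add: complex_eq_iff)
      moreover have "complex_of_real (1 + e / 2) \<in> of_real ` {0<..}" using e by (intro imageI) simp
      ultimately show "\<exists>y\<in>complex_of_real ` {0<..}. y \<in> T \<and> y \<noteq> 1" by blast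
    qed
    show "?f z = 0" if "z \<in> of_real ` {0<..}" for z
      using that s by (auto simp: subordinate_of_real powr_of_real)
  qed (use x in auto)
  then show ?thesis by simp
qed


section \<open>The Fourier transform on square integrable functions\<close>

lemma sigma_finite_lebesgue: "sigma_finite_measure (lebesgue :: 'a::euclidean_space measure)"
proof
  obtain A :: "'a set set" where A: "countable A" "A \<subseteq> sets lborel" "\<Union> A = space lborel" "\<forall>a\<in>A. emeasure lborel a \<noteq> \<infinity>"
    using lborel.sigma_finite_countable by blast
  then have "A \<subseteq> sets lebesgue" "\<forall>a\<in>A. emeasure lebesgue a \<noteq> \<infinity>"
    by (auto simp: subset_iff main_part_sets)
  with A show "\<exists>A::'a set set. countable A \<and> A \<subseteq> sets lebesgue \<and> \<Union> A = space lebesgue \<and> (\<forall>a\<in>A. emeasure lebesgue a \<noteq> \<infinity>)"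
    by (intro exI[of _ A]) simp
qed

lemma measurable_lebesgue_pair [measurable]:
  "fst \<in> borel_measurable (lebesgue \<Otimes>\<^sub>M N)"
  "snd \<in> borel_measurable (N \<Otimes>\<^sub>M lebesgue)"
  "snd \<in> borel_measurable (N \<Otimes>\<^sub>M lborel)"
proof -
  have 1: "fst \<in> lebesgue \<Otimes>\<^sub>M N \<rightarrow>\<^sub>M lebesgue" "(\<lambda>x. x) \<in> lebesgue \<rightarrow>\<^sub>M borel"
    by (auto intro: measurable_completion)
  show "fst \<in> borel_measurable (lebesgue \<Otimes>\<^sub>M N)"
    using measurable_compose[OF 1] by simp
  have 2: "snd \<in> N \<Otimes>\<^sub>M lebesgue \<rightarrow>\<^sub>M lebesgue" "(\<lambda>x. x) \<in> lebesgue \<rightarrow>\<^sub>M borel"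
    by (auto intro: measurable_completion)
  show "snd \<in> borel_measurable (N \<Otimes>\<^sub>M lebesgue)"
    using measurable_compose[OF 2] by simp
  have 3: "snd \<in> N \<Otimes>\<^sub>M lborel \<rightarrow>\<^sub>M lborel" by auto
  show "snd \<in> borel_measurable (N \<Otimes>\<^sub>M lborel)"
    using 3 by (simp only: measurable_lborel1 measurable_lborel2)
qed

lemma L2_funI:
  fixes f :: "'a::euclidean_space \<Rightarrow> complex"
  assumes f: "f \<in> borel_measurable borel" and b: "0 < b"
    and bound: "\<And>z. norm (f z) \<le> C * exp (- b * (norm z)\<^sup>2)"
  shows "L2_fun f"
  unfolding L2_fun_def
proof
  show "f \<in> borel_measurable lebesgue" using f by (simp add: measurable_completion)
  have "0 \<le> norm (f 0)" by simp
  also have "\<dots> \<le> C" using bound[of 0] by simp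
  finally have C: "0 \<le> C" .
  have "(\<integral>\<^sup>+ z. ennreal ((norm (f z))\<^sup>2) \<partial>lebesgue) \<le> (\<integral>\<^sup>+ z. ennreal (C\<^sup>2) * ennreal (exp (- (2 * b) * (norm z)\<^sup>2)) \<partial>(lborel :: 'a measure))"
    unfolding nn_integral_completion
  proof (rule nn_integral_mono)
    fix z :: 'a
    have "(norm (f z))\<^sup>2 \<le> (C * exp (- b * (norm z)\<^sup>2))\<^sup>2" using bound by (intro power_mono) auto
    also have "\<dots> = C\<^sup>2 * exp (- (2 * b) * (norm z)\<^sup>2)"
      by (simp add: power_mult_distrib power2_eq_square[of "exp _"] mult_exp_exp)
    finally show "ennreal ((norm (f z))\<^sup>2) \<le> ennreal (C\<^sup>2) * ennreal (exp (- (2 * b) * (norm z)\<^sup>2))"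
      by (simp add: ennreal_mult[symmetric] ennreal_leI)
  qed
  also have "\<dots> = ennreal (C\<^sup>2) * ennreal ((pi / (2 * b)) powr (DIM('a) / 2))"
    using gaussian_integral[of "2 * b", where 'a='a] b
    by (subst nn_integral_cmult) (auto simp: nn_integral_eq_integral has_bochner_integral_iff)
  also have "\<dots> < \<infinity>" by (simp add: ennreal_mult_less_top)
  finally show "(\<integral>\<^sup>+ z. ennreal ((norm (f z))\<^sup>2) \<partial>lebesgue) < \<infinity>" .
qed

lemma L2_fun_integrable_square:
  assumes "L2_fun f"
  shows "integrable lebesgue (\<lambda>z. (norm (f z))\<^sup>2)"
  using assms unfolding L2_fun_def by (intro integrableI_nonneg) auto

lemma L2_fun_mult_integrable:
  assumes f: "L2_fun f" and g: "L2_fun g"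
  shows "integrable lebesgue (\<lambda>z. f z * g z)"
proof (rule Bochner_Integration.integrable_bound)
  show "integrable lebesgue (\<lambda>z. (norm (f z))\<^sup>2 + (norm (g z))\<^sup>2)"
    using assms by (intro Bochner_Integration.integrable_add L2_fun_integrable_square)
  show "(\<lambda>z. f z * g z) \<in> borel_measurable lebesgue"
    using assms unfolding L2_fun_def by auto
  show "AE z in lebesgue. norm (f z * g z) \<le> norm ((norm (f z))\<^sup>2 + (norm (g z))\<^sup>2)"
  proof (rule AE_I2)
    fix z
    have "2 * (norm (f z) * norm (g z)) \<le> (norm (f z))\<^sup>2 + (norm (g z))\<^sup>2"
      using zero_le_power2[of "norm (f z) - norm (g z)"] by (simp add: power2_diff)
    moreover have "0 \<le> norm (f z) * norm (g z)" by simp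
    ultimately have "norm (f z) * norm (g z) \<le> (norm (f z))\<^sup>2 + (norm (g z))\<^sup>2" by linarith
    then show "norm (f z * g z) \<le> norm ((norm (f z))\<^sup>2 + (norm (g z))\<^sup>2)" by (simp add: norm_mult)
  qed
qed

text \<open>Cauchy-Schwarz for v k - u against g. The v k are required only to be measurable with
  integrable products, because the Fourier integrals of the approximating sequence are not known to
  be square integrable.\<close>

lemma L2_tendsto_integral:
  fixes g :: "'a::euclidean_space \<Rightarrow> complex"
  assumes lim: "L2_tendsto v u" and v: "\<And>k. v k \<in> borel_measurable lebesgue" "\<And>k. integrable lebesgue (\<lambda>z. v k z * g z)"
    and u: "L2_fun u" and g: "L2_fun g"
  shows "(\<lambda>k. \<integral>z. v k z * g z \<partial>lebesgue) \<longlonglongrightarrow> (\<integral>z. u z * g z \<partial>lebesgue)"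
proof -
  define D where "D k = (\<integral>\<^sup>+ z. ennreal ((norm (v k z - u z))\<^sup>2) \<partial>lebesgue)" for k
  define G where "G = (\<integral>\<^sup>+ z. ennreal ((norm (g z))\<^sup>2) \<partial>lebesgue)"
  have G: "G < \<infinity>" using g by (simp add: L2_fun_def G_def)
  have [measurable]: "v k \<in> borel_measurable lebesgue" "u \<in> borel_measurable lebesgue" "g \<in> borel_measurable lebesgue" for k
    using v u g by (auto simp: L2_fun_def)
  have "D \<longlonglongrightarrow> 0" using lim by (simp add: L2_tendsto_def D_def[abs_def])
  then have "(\<lambda>k. G * D k) \<longlonglongrightarrow> G * 0"
    using G by (intro ennreal_tendsto_cmult) auto
  then have DG: "(\<lambda>k. D k * G) \<longlonglongrightarrow> 0" by (simp add: mult.commute)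
  define N where "N k = norm ((\<integral>z. v k z * g z \<partial>lebesgue) - (\<integral>z. u z * g z \<partial>lebesgue))" for k
  have le: "ennreal ((N k)\<^sup>2) \<le> D k * G" for k
  proof -
    have i: "integrable lebesgue (\<lambda>z. v k z * g z)" "integrable lebesgue (\<lambda>z. u z * g z)"
      by (auto intro: L2_fun_mult_integrable v u g)
    have "N k = norm (\<integral>z. (v k z - u z) * g z \<partial>lebesgue)"
      unfolding N_def using i by (simp add: left_diff_distrib)
    also have "ennreal \<dots> \<le> (\<integral>\<^sup>+ z. ennreal (norm ((v k z - u z) * g z)) \<partial>lebesgue)"
      using i by (intro integral_norm_bound_ennreal) (simp add: left_diff_distrib)
    also have "\<dots> = (\<integral>\<^sup>+ z. ennreal (norm (v k z - u z)) * ennreal (norm (g z)) \<partial>lebesgue)"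
      by (simp add: norm_mult ennreal_mult)
    finally have "ennreal (N k) \<le> (\<integral>\<^sup>+ z. ennreal (norm (v k z - u z)) * ennreal (norm (g z)) \<partial>lebesgue)" .
    then have "(ennreal (N k))\<^sup>2 \<le> (\<integral>\<^sup>+ z. ennreal (norm (v k z - u z)) * ennreal (norm (g z)) \<partial>lebesgue)\<^sup>2"
      by (intro power_mono) auto
    also have "\<dots> \<le> (\<integral>\<^sup>+ z. ennreal (norm (v k z - u z)) ^ 2 \<partial>lebesgue) * (\<integral>\<^sup>+ z. ennreal (norm (g z)) ^ 2 \<partial>lebesgue)"
      by (intro Cauchy_Schwarz_nn_integral) measurable
    also have "\<dots> = D k * G" by (simp add: D_def G_def ennreal_power)
    finally show ?thesis by (simp add: N_def ennreal_power)
  qed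
  have "(\<lambda>k. ennreal ((N k)\<^sup>2)) \<longlonglongrightarrow> ennreal 0"
    by (rule tendsto_sandwich[OF _ _ tendsto_const, of _ _ _ "\<lambda>k. D k * G"]) (use le DG in auto)
  then have "(\<lambda>k. (N k)\<^sup>2) \<longlonglongrightarrow> 0"
    by (subst (asm) tendsto_ennreal_iff) auto
  then have "(\<lambda>k. sqrt ((N k)\<^sup>2)) \<longlonglongrightarrow> sqrt 0" by (intro tendsto_real_sqrt)
  then have "N \<longlonglongrightarrow> 0" by (simp add: N_def[abs_def])
  then show ?thesis unfolding N_def[abs_def] by (simp only: tendsto_norm_zero_iff LIM_zero_iff)
qed

section \<open>Modulated Gaussians as test functions for the Fourier transform\<close>

lemma heat_kernel_translate_integral:
  assumes t: "0 < t"
  shows "has_bochner_integral lborel (\<lambda>y::'a::euclidean_space. heat_kernel t (P - y)) 1"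
proof -
  have "has_bochner_integral lborel (heat_kernel t :: 'a \<Rightarrow> real) 1" by (rule heat_kernel_integral[OF t])
  then have "has_bochner_integral (density (distr lborel borel (\<lambda>y::'a. P + (- 1) *\<^sub>R y)) (\<lambda>_. ennreal (\<bar>- 1\<bar> ^ DIM('a)))) (heat_kernel t :: 'a \<Rightarrow> real) 1"
    by (subst (asm) lborel_affine[of "- 1" P]) simp_all
  then show ?thesis
    by (simp add: density_1 has_bochner_integral_iff integrable_distr_eq integral_distr)
qed

text \<open>A Gaussian on the frequency side whose Fourier integral at y is the heat kernel at P -
  y. Testing a transform against it evaluates the Gaussian average of the original function at
  P.\<close>

definition wave :: "real \<Rightarrow> 'a::euclidean_space \<Rightarrow> 'a \<Rightarrow> complex" where
  "wave t P \<zeta> = of_real (exp (- (4 * pi\<^sup>2 * t) * (norm \<zeta>)\<^sup>2)) * cis (2 * pi * (P \<bullet> \<zeta>))"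

lemma wave_measurable [measurable]: "wave t P \<in> borel_measurable borel"
  unfolding wave_def cis_conv_exp by measurable

lemma norm_wave: "norm (wave t P \<zeta>) = exp (- (4 * pi\<^sup>2 * t) * (norm \<zeta>)\<^sup>2)"
  by (simp add: wave_def norm_mult)

lemma powr_inverse_pos:
  fixes x :: real
  shows "0 < x \<Longrightarrow> inverse x powr a = x powr (- a)"
  by (simp add: powr_def ln_inverse)

lemma wave_fourier:
  fixes P :: "'a::euclidean_space"
  assumes t: "0 < t"
  shows "has_bochner_integral lborel (\<lambda>\<zeta>. cis (- (2 * pi * (\<zeta> \<bullet> y))) * wave t P \<zeta>) (of_real (heat_kernel t (P - y)))"
proof -
  let ?a = "4 * pi\<^sup>2 * t" and ?w = "(2 * pi) *\<^sub>R (P - y)"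
  have "has_bochner_integral lborel (\<lambda>\<zeta>. complex_of_real (exp (- ?a * (norm \<zeta>)\<^sup>2)) * cis (?w \<bullet> \<zeta>))
    (complex_of_real ((pi / ?a) powr (DIM('a) / 2) * exp (- (norm ?w)\<^sup>2 / (4 * ?a))))"
    using t by (intro gaussian_fourier) simp
  moreover have "complex_of_real (exp (- ?a * (norm \<zeta>)\<^sup>2)) * cis (?w \<bullet> \<zeta>) = cis (- (2 * pi * (\<zeta> \<bullet> y))) * wave t P \<zeta>" for \<zeta>
  proof -
    have "?w \<bullet> \<zeta> = - (2 * pi * (\<zeta> \<bullet> y)) + 2 * pi * (P \<bullet> \<zeta>)"
      by (simp add: inner_diff_left inner_diff_right right_diff_distrib inner_commute)
    then show ?thesis
      unfolding wave_def mult.left_commute[of "cis _"] cis_mult by (simp only:)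
  qed
  moreover have "(pi / ?a) powr (DIM('a) / 2) * exp (- (norm ?w)\<^sup>2 / (4 * ?a)) = heat_kernel t (P - y)"
  proof -
    have 1: "pi / ?a = inverse (4 * pi * t)" using t by (simp add: field_simps power2_eq_square)
    have 2: "inverse (4 * pi * t) powr (DIM('a) / 2) = (4 * pi * t) powr (- (DIM('a) / 2))"
      using t by (intro powr_inverse_pos) simp
    have 3: "- (norm ?w)\<^sup>2 / (4 * ?a) = - (norm (P - y))\<^sup>2 / (4 * t)"
      by (simp add: power_mult_distrib)
    show ?thesis unfolding heat_kernel_def 1 2 3 ..
  qed
  ultimately show ?thesis by (simp only:)
qed

lemma integrable_norm_wave:
  fixes P :: "'a::euclidean_space"
  assumes "0 < t"
  shows "integrable lebesgue (\<lambda>\<zeta>. norm (wave t P \<zeta>))"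
  unfolding norm_wave using gaussian_integral[of "4 * pi\<^sup>2 * t", where 'a='a] assms
  by (subst integrable_completion) (auto simp: has_bochner_integral_iff)

lemma L2_fun_wave: "0 < t \<Longrightarrow> L2_fun (wave t P)"
  by (rule L2_funI[where b="4 * pi\<^sup>2 * t" and C=1]) (auto simp: norm_wave)

text \<open>The weight absorbs the growth in \<zeta> of the multiplier of a jump. Half of the
  Gaussian decay suffices to beat it.\<close>

lemma L2_fun_weighted_wave:
  assumes t: "0 < t"
  shows "L2_fun (\<lambda>\<zeta> :: 'a::euclidean_space. of_real (1 + (norm \<zeta>)\<^sup>2) * wave t P \<zeta>)"
proof (rule L2_funI)
  let ?b = "2 * pi\<^sup>2 * t"
  have b: "0 < ?b" using t by simp
  then show "0 < ?b" .
  fix \<zeta> :: 'a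
  have "1 + (norm \<zeta>)\<^sup>2 \<le> (1 + 1 / ?b) * exp (?b * (norm \<zeta>)\<^sup>2)"
  proof -
    have e: "1 + ?b * (norm \<zeta>)\<^sup>2 \<le> exp (?b * (norm \<zeta>)\<^sup>2)" by (rule exp_ge_add_one_self)
    have "0 \<le> ?b * (norm \<zeta>)\<^sup>2" using b by simp
    then have "1 \<le> exp (?b * (norm \<zeta>)\<^sup>2)" "?b * (norm \<zeta>)\<^sup>2 \<le> exp (?b * (norm \<zeta>)\<^sup>2)" using e by linarith+
    then have "1 \<le> exp (?b * (norm \<zeta>)\<^sup>2)" "(norm \<zeta>)\<^sup>2 \<le> 1 / ?b * exp (?b * (norm \<zeta>)\<^sup>2)"
      using b by (auto simp: field_simps)
    then show ?thesis by (simp only: distrib_right mult_1_left add_mono)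
  qed
  then have "(1 + (norm \<zeta>)\<^sup>2) * exp (- (2 * ?b) * (norm \<zeta>)\<^sup>2) \<le> (1 + 1 / ?b) * exp (?b * (norm \<zeta>)\<^sup>2) * exp (- (2 * ?b) * (norm \<zeta>)\<^sup>2)"
    by (intro mult_right_mono) auto
  also have "\<dots> = (1 + 1 / ?b) * exp (- ?b * (norm \<zeta>)\<^sup>2)"
    by (simp add: mult.assoc mult_exp_exp)
  finally have "(1 + (norm \<zeta>)\<^sup>2) * exp (- (4 * pi\<^sup>2 * t) * (norm \<zeta>)\<^sup>2) \<le> (1 + 1 / ?b) * exp (- ?b * (norm \<zeta>)\<^sup>2)"
    by (simp add: mult.assoc)
  moreover have "norm (complex_of_real (1 + (norm \<zeta>)\<^sup>2)) = 1 + (norm \<zeta>)\<^sup>2"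
    by (simp only: norm_of_real abs_of_nonneg[OF add_nonneg_nonneg[OF zero_le_one zero_le_power2]])
  ultimately show "norm (of_real (1 + (norm \<zeta>)\<^sup>2) * wave t P \<zeta>) \<le> (1 + 1 / ?b) * exp (- ?b * (norm \<zeta>)\<^sup>2)"
    by (simp only: norm_mult norm_wave)
qed measurable

lemma heat_kernel_le: "0 < t \<Longrightarrow> heat_kernel t (z::'a::euclidean_space) \<le> (4 * pi * t) powr (- (DIM('a) / 2))"
  by (simp add: heat_kernel_def mult_left_le)

lemma heat_kernel_square_integrable:
  assumes t: "0 < t"
  shows "integrable lborel (\<lambda>y::'a::euclidean_space. (heat_kernel t (P - y))\<^sup>2)"
proof (rule Bochner_Integration.integrable_bound)
  let ?M = "(4 * pi * t) powr (- (DIM('a) / 2))"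
  show "integrable lborel (\<lambda>y::'a. ?M * heat_kernel t (P - y))"
    using heat_kernel_translate_integral[OF t, of P] by (intro integrable_mult_right) (simp add: has_bochner_integral_iff)
  show "AE y in lborel. norm ((heat_kernel t (P - y))\<^sup>2) \<le> norm (?M * heat_kernel t (P - y))"
    using heat_kernel_le[OF t] by (intro AE_I2) (auto simp: power2_eq_square intro!: mult_right_mono)
qed measurable

lemma L2_fun_heat_kernel:
  assumes t: "0 < t"
  shows "L2_fun (\<lambda>y::'a::euclidean_space. complex_of_real (heat_kernel t (P - y)))"
  unfolding L2_fun_def
proof
  show "(\<lambda>y::'a. complex_of_real (heat_kernel t (P - y))) \<in> borel_measurable lebesgue"
    by (intro measurable_completion) measurable
  show "(\<integral>\<^sup>+ y. ennreal ((norm (complex_of_real (heat_kernel t (P - y))))\<^sup>2) \<partial>lebesgue) < \<infinity>"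
    using heat_kernel_square_integrable[OF t, of P] unfolding nn_integral_completion
    by (simp add: nn_integral_eq_integral)
qed

lemma fourier_integral_eq:
  fixes v :: "(real^'n) \<times> real \<Rightarrow> complex"
  shows "fourier_integral v \<zeta> = (\<integral>y. cis (- (2 * pi * (\<zeta> \<bullet> y))) * v y \<partial>lebesgue)"
proof -
  obtain \<xi> \<sigma> where \<zeta>: "\<zeta> = (\<xi>, \<sigma>)" by (cases \<zeta>)
  show ?thesis
    unfolding \<zeta> fourier_integral_def prod.case
    by (intro Bochner_Integration.integral_cong refl) (auto simp: cis_conv_exp mult_ac split: prod.split)
qed

text \<open>The multiplication formula, which moves the transform from v to the wave; Fubini applies
  because both functions are integrable.\<close>

lemma fourier_multiplication:
  fixes v :: "(real^'n) \<times> real \<Rightarrow> complex"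
  assumes v: "integrable lebesgue v" and t: "0 < t"
  shows "(\<integral>\<zeta>. fourier_integral v \<zeta> * wave t P \<zeta> \<partial>lebesgue) = (\<integral>y. v y * of_real (heat_kernel t (P - y)) \<partial>lebesgue)"
proof -
  interpret L: sigma_finite_measure "lebesgue :: ((real^'n) \<times> real) measure" by (rule sigma_finite_lebesgue)
  interpret LL: pair_sigma_finite "lebesgue :: ((real^'n) \<times> real) measure" "lebesgue :: ((real^'n) \<times> real) measure" ..
  define f where "f y \<zeta> = cis (- (2 * pi * (\<zeta> \<bullet> y))) * v y * wave t P \<zeta>" for y \<zeta>
  have [measurable]: "v \<in> borel_measurable lebesgue" using v by (rule borel_measurable_integrable)
  have meas: "case_prod f \<in> borel_measurable (lebesgue \<Otimes>\<^sub>M lebesgue)"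
    unfolding f_def cis_conv_exp by measurable
  note wave_int = integrable_norm_wave[OF t, of P]
  have "integrable (lebesgue \<Otimes>\<^sub>M lebesgue) (case_prod f)"
  proof (rule LL.Fubini_integrable[OF meas])
    have "(\<integral>\<zeta>. norm (case_prod f (y, \<zeta>)) \<partial>lebesgue) = norm (v y) * (\<integral>\<zeta>. norm (wave t P \<zeta>) \<partial>lebesgue)" for y
      by (simp add: f_def norm_mult)
    then show "integrable lebesgue (\<lambda>y. \<integral>\<zeta>. norm (case_prod f (y, \<zeta>)) \<partial>lebesgue)"
      using v by simp
    show "AE y in lebesgue. integrable lebesgue (\<lambda>\<zeta>. case_prod f (y, \<zeta>))"
    proof (rule AE_I2)
      fix y
      have fm: "f y \<in> borel_measurable lebesgue"
        unfolding f_def[abs_def] cis_conv_exp by (intro measurable_completion) measurable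
      have fi: "integrable lebesgue (\<lambda>\<zeta>. norm (v y) * norm (wave t P \<zeta>))"
        by (intro integrable_mult_right wave_int)
      have "integrable lebesgue (f y)"
        by (rule Bochner_Integration.integrable_bound[OF fi fm]) (auto simp: f_def norm_mult)
      then show "integrable lebesgue (\<lambda>\<zeta>. case_prod f (y, \<zeta>))" by simp
    qed
  qed
  then have "(\<integral>\<zeta>. (\<integral>y. f y \<zeta> \<partial>lebesgue) \<partial>lebesgue) = (\<integral>y. (\<integral>\<zeta>. f y \<zeta> \<partial>lebesgue) \<partial>lebesgue)"
    by (rule LL.Fubini_integral)
  also have "(\<lambda>\<zeta>. \<integral>y. f y \<zeta> \<partial>lebesgue) = (\<lambda>\<zeta>. fourier_integral v \<zeta> * wave t P \<zeta>)"
    unfolding f_def fourier_integral_eq by simp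
  also have "(\<lambda>y. \<integral>\<zeta>. f y \<zeta> \<partial>lebesgue) = (\<lambda>y. v y * of_real (heat_kernel t (P - y)))"
  proof
    fix y
    have m: "(\<lambda>\<zeta>. cis (- (2 * pi * (\<zeta> \<bullet> y))) * wave t P \<zeta>) \<in> borel_measurable lborel"
      unfolding cis_conv_exp by measurable
    have "(\<integral>\<zeta>. f y \<zeta> \<partial>lebesgue) = v y * (\<integral>\<zeta>. cis (- (2 * pi * (\<zeta> \<bullet> y))) * wave t P \<zeta> \<partial>lebesgue)"
      unfolding f_def integral_mult_right_zero[symmetric]
      by (intro Bochner_Integration.integral_cong refl) simp
    also have "(\<integral>\<zeta>. cis (- (2 * pi * (\<zeta> \<bullet> y))) * wave t P \<zeta> \<partial>lebesgue) = of_real (heat_kernel t (P - y))"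
      unfolding integral_completion[OF m] using wave_fourier[OF t, of y P] by (simp add: has_bochner_integral_iff)
    finally show "(\<integral>\<zeta>. f y \<zeta> \<partial>lebesgue) = v y * of_real (heat_kernel t (P - y))" .
  qed
  finally show ?thesis .
qed

text \<open>Both sides are pairings with a fixed L^2 function and pass to the limit along the
  approximating sequence. Apart from square integrability, this identity is all that is used of the
  transform on L^2.\<close>

lemma L2_fourier_wave:
  fixes u :: "(real^'n) \<times> real \<Rightarrow> complex"
  assumes "has_L2_fourier u U" and t: "0 < t"
  shows "(\<integral>\<zeta>. U \<zeta> * wave t P \<zeta> \<partial>lebesgue) = (\<integral>y. u y * of_real (heat_kernel t (P - y)) \<partial>lebesgue)"
proof -
  obtain v where u: "L2_fun u" "L2_fun U" and v: "\<And>k. integrable lebesgue (v k)" "\<And>k. L2_fun (v k)"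
    and lim: "L2_tendsto v u" "L2_tendsto (\<lambda>k. fourier_integral (v k)) U"
    using assms(1) unfolding has_L2_fourier_def by blast
  interpret L: sigma_finite_measure "lebesgue :: ((real^'n) \<times> real) measure" by (rule sigma_finite_lebesgue)
  have [measurable]: "v k \<in> borel_measurable lebesgue" for k using v(2) by (simp add: L2_fun_def)
  have A: "(\<lambda>k. \<integral>y. v k y * of_real (heat_kernel t (P - y)) \<partial>lebesgue) \<longlonglongrightarrow> (\<integral>y. u y * of_real (heat_kernel t (P - y)) \<partial>lebesgue)"
    by (intro L2_tendsto_integral lim u v L2_fun_heat_kernel t L2_fun_mult_integrable) measurable
  have F: "fourier_integral (v k) \<in> borel_measurable lebesgue" for k
  proof -
    have "(\<lambda>(\<zeta>, y). cis (- (2 * pi * (\<zeta> \<bullet> y))) * v k y) \<in> borel_measurable (lebesgue \<Otimes>\<^sub>M lebesgue)"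
      unfolding cis_conv_exp by measurable
    then show ?thesis
      unfolding fourier_integral_eq[abs_def] by (rule L.borel_measurable_lebesgue_integral)
  qed
  have "integrable lebesgue (\<lambda>\<zeta>. fourier_integral (v k) \<zeta> * wave t P \<zeta>)" for k
  proof (rule Bochner_Integration.integrable_bound)
    show "integrable lebesgue (\<lambda>\<zeta>. (\<integral>y. norm (v k y) \<partial>lebesgue) * norm (wave t P \<zeta>))"
      by (intro integrable_mult_right integrable_norm_wave t)
    show "(\<lambda>\<zeta>. fourier_integral (v k) \<zeta> * wave t P \<zeta>) \<in> borel_measurable lebesgue"
      by (intro borel_measurable_times F measurable_completion) measurable
    have "norm (fourier_integral (v k) \<zeta>) \<le> (\<integral>y. norm (v k y) \<partial>lebesgue)" for \<zeta>
      using integral_norm_bound[of lebesgue "\<lambda>y. cis (- (2 * pi * (\<zeta> \<bullet> y))) * v k y"]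
      by (simp add: fourier_integral_eq norm_mult)
    then show "AE \<zeta> in lebesgue. norm (fourier_integral (v k) \<zeta> * wave t P \<zeta>) \<le> norm ((\<integral>y. norm (v k y) \<partial>lebesgue) * norm (wave t P \<zeta>))"
      by (intro AE_I2) (simp add: norm_mult mult_right_mono)
  qed
  then have "(\<lambda>k. \<integral>\<zeta>. fourier_integral (v k) \<zeta> * wave t P \<zeta> \<partial>lebesgue) \<longlonglongrightarrow> (\<integral>\<zeta>. U \<zeta> * wave t P \<zeta> \<partial>lebesgue)"
    by (intro L2_tendsto_integral lim u F L2_fun_wave t)
  then have "(\<lambda>k. \<integral>y. v k y * of_real (heat_kernel t (P - y)) \<partial>lebesgue) \<longlonglongrightarrow> (\<integral>\<zeta>. U \<zeta> * wave t P \<zeta> \<partial>lebesgue)"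
    unfolding fourier_multiplication[OF v(1) t] .
  then show ?thesis using A by (rule LIMSEQ_unique)
qed


section \<open>Gaussian averages of solutions\<close>

lemma integrable_pair_mult:
  fixes f :: "'a \<Rightarrow> real" and g :: "'b \<Rightarrow> real"
  assumes "sigma_finite_measure M1" "sigma_finite_measure M2" and f: "integrable M1 f" and g: "integrable M2 g"
  shows "integrable (M1 \<Otimes>\<^sub>M M2) (\<lambda>p. f (fst p) * g (snd p))"
proof -
  interpret M1: sigma_finite_measure M1 by fact
  interpret M2: sigma_finite_measure M2 by fact
  interpret pair_sigma_finite M1 M2 ..
  have [measurable]: "f \<in> borel_measurable M1" "g \<in> borel_measurable M2"
    using f g by (auto dest: borel_measurable_integrable)
  show ?thesis
  proof (rule Fubini_integrable)
    have "(\<integral>y. norm (f (fst (x, y)) * g (snd (x, y))) \<partial>M2) = \<bar>f x\<bar> * (\<integral>y. \<bar>g y\<bar> \<partial>M2)" for x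
      by (simp add: abs_mult)
    then show "integrable M1 (\<lambda>x. \<integral>y. norm (f (fst (x, y)) * g (snd (x, y))) \<partial>M2)"
      using f by simp
  qed (use g in auto)
qed

section \<open>The Fourier multiplier of a single jump\<close>

text \<open>The symmetrised difference of a plane wave of frequency \<zeta> is the wave times this
  factor; the cosine comes from averaging z and -z.\<close>

definition jump_factor :: "'a::euclidean_space \<times> real \<Rightarrow> 'a \<times> real \<Rightarrow> complex" where
  "jump_factor \<zeta> Z = 1 - of_real (cos ((2 * pi) *\<^sub>R fst \<zeta> \<bullet> fst Z)) * cis (- (2 * pi * (snd \<zeta> * snd Z)))"

text \<open>From 1 - cos a \<le> a^2 / 2 and |1 - cis b| \<le> |b|. The 20 covers both 2 pi^2, as
  pi^2 \<le> 10, and 2 pi.\<close>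

lemma jump_factor_bound:
  fixes \<zeta> Z :: "'a::euclidean_space \<times> real"
  shows "norm (jump_factor \<zeta> Z) \<le> 20 * (1 + (norm \<zeta>)\<^sup>2) * min 1 ((norm (fst Z))\<^sup>2 + \<bar>snd Z\<bar>)"
proof -
  define a where "a = (2 * pi) *\<^sub>R fst \<zeta> \<bullet> fst Z"
  define b where "b = - (2 * pi * (snd \<zeta> * snd Z))"
  have j: "jump_factor \<zeta> Z = 1 - of_real (cos a) * cis b"
    unfolding jump_factor_def a_def b_def ..
  have pi2: "pi\<^sup>2 \<le> 10"
    using pi_less_4 pi_approx(2) power_mono[of pi "3.15" 2] by (simp add: power2_eq_square)
  have n2: "(norm \<zeta>)\<^sup>2 = (norm (fst \<zeta>))\<^sup>2 + (snd \<zeta>)\<^sup>2"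
    by (simp add: norm_prod_def)
  have c: "\<bar>cos a\<bar> \<le> 1" by (rule abs_cos_le_one)
  have "1 - cos a = 2 * (sin (a / 2))\<^sup>2"
    using cos_double_sin[of "a / 2"] by simp
  also have "\<dots> \<le> 2 * (a / 2)\<^sup>2"
    using abs_sin_x_le_abs_x[of "a / 2"] unfolding abs_le_square_iff by (rule mult_left_mono) simp
  finally have ca: "1 - cos a \<le> a\<^sup>2 / 2" by (simp add: power2_eq_square)
  have cb: "norm (1 - cis b) \<le> \<bar>b\<bar>"
    using iexp_approx1[of b 0] by (simp add: cis_conv_exp norm_minus_commute)
  have "norm (1 - of_real (cos a) * cis b) = norm (of_real (1 - cos a) + of_real (cos a) * (1 - cis b))"
    by (simp add: algebra_simps)
  also have "\<dots> \<le> norm (complex_of_real (1 - cos a)) + norm (of_real (cos a) * (1 - cis b))"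
    by (rule norm_triangle_ineq)
  also have "norm (complex_of_real (1 - cos a)) = 1 - cos a"
    using cos_le_one[of a] by (simp only: norm_of_real)
  finally have "norm (1 - of_real (cos a) * cis b) \<le> 1 - cos a + norm (of_real (cos a) * (1 - cis b))" .
  moreover have "norm (of_real (cos a) * (1 - cis b)) \<le> 1 * \<bar>b\<bar>"
    unfolding norm_mult norm_of_real using c cb by (intro mult_mono) auto
  ultimately have 1: "norm (jump_factor \<zeta> Z) \<le> a\<^sup>2 / 2 + \<bar>b\<bar>"
    using ca unfolding j by argo
  have "a\<^sup>2 \<le> (2 * pi * (norm (fst \<zeta>) * norm (fst Z)))\<^sup>2"
    using Cauchy_Schwarz_ineq2[of "fst \<zeta>" "fst Z"] unfolding a_def inner_scaleR_left
    by (intro power2_mono) (auto simp: abs_mult)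
  also have "\<dots> = 4 * pi\<^sup>2 * ((norm (fst \<zeta>))\<^sup>2 * (norm (fst Z))\<^sup>2)"
    by (simp add: power_mult_distrib)
  also have "\<dots> \<le> 4 * 10 * ((1 + (norm \<zeta>)\<^sup>2) * (norm (fst Z))\<^sup>2)"
    using pi2 n2 by (intro mult_mono mult_nonneg_nonneg add_nonneg_nonneg) auto
  finally have "a\<^sup>2 / 2 \<le> 20 * ((1 + (norm \<zeta>)\<^sup>2) * (norm (fst Z))\<^sup>2)" by argo
  then have a2: "a\<^sup>2 / 2 \<le> 20 * (1 + (norm \<zeta>)\<^sup>2) * (norm (fst Z))\<^sup>2" by (simp only: mult.assoc)
  have "\<bar>snd \<zeta>\<bar> \<le> 1 + (snd \<zeta>)\<^sup>2"
    using zero_le_power2[of "\<bar>snd \<zeta>\<bar> - 1"] by (simp add: power2_diff)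
  then have "\<bar>snd \<zeta>\<bar> \<le> 1 + (norm \<zeta>)\<^sup>2" unfolding n2 using zero_le_power2[of "norm (fst \<zeta>)"] by linarith
  then have "2 * pi * (\<bar>snd \<zeta>\<bar> * \<bar>snd Z\<bar>) \<le> 20 * ((1 + (norm \<zeta>)\<^sup>2) * \<bar>snd Z\<bar>)"
    using pi_less_4 by (intro mult_mono) auto
  moreover have "\<bar>b\<bar> = 2 * pi * (\<bar>snd \<zeta>\<bar> * \<bar>snd Z\<bar>)" by (simp add: b_def abs_mult)
  ultimately have b2: "\<bar>b\<bar> \<le> 20 * (1 + (norm \<zeta>)\<^sup>2) * \<bar>snd Z\<bar>" by (simp only: mult.assoc)
  have "norm (jump_factor \<zeta> Z) \<le> 20 * (1 + (norm \<zeta>)\<^sup>2) * ((norm (fst Z))\<^sup>2 + \<bar>snd Z\<bar>)"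
    using 1 a2 b2 unfolding distrib_left[of "20 * (1 + (norm \<zeta>)\<^sup>2)"] by argo
  moreover have "norm (jump_factor \<zeta> Z) \<le> 20 * (1 + (norm \<zeta>)\<^sup>2)"
  proof -
    have "norm (jump_factor \<zeta> Z) \<le> 1 + norm (of_real (cos a) * cis b)"
      using norm_triangle_ineq4[of 1 "of_real (cos a) * cis b"] by (simp add: jump_factor_def a_def b_def)
    also have "\<dots> \<le> 2" using c by (simp add: norm_mult)
    also have "\<dots> \<le> 20 * (1 + (norm \<zeta>)\<^sup>2)" using zero_le_power2[of "norm \<zeta>"] by argo
    finally show ?thesis .
  qed
  ultimately show ?thesis by (simp add: min_def)
qed

lemma jump_factor_measurable [measurable]:
  fixes \<zeta> :: "'a::euclidean_space \<times> real"
  shows "jump_factor \<zeta> \<in> borel_measurable borel"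
    and "(\<lambda>p. jump_factor (fst p) (snd p)) \<in> borel_measurable (lebesgue \<Otimes>\<^sub>M lborel :: (('a \<times> real) \<times> ('a \<times> real)) measure)"
proof -
  show "jump_factor \<zeta> \<in> borel_measurable borel"
    unfolding jump_factor_def cis_conv_exp by measurable
  have [measurable]: "(\<lambda>p. fst (fst p)) \<in> borel_measurable (lebesgue \<Otimes>\<^sub>M lborel :: (('a \<times> real) \<times> ('a \<times> real)) measure)"
    "(\<lambda>p. snd (fst p)) \<in> borel_measurable (lebesgue \<Otimes>\<^sub>M lborel :: (('a \<times> real) \<times> ('a \<times> real)) measure)"
    "(\<lambda>p. fst (snd p)) \<in> borel_measurable (lebesgue \<Otimes>\<^sub>M lborel :: (('a \<times> real) \<times> ('a \<times> real)) measure)"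
    "(\<lambda>p. snd (snd p)) \<in> borel_measurable (lebesgue \<Otimes>\<^sub>M lborel :: (('a \<times> real) \<times> ('a \<times> real)) measure)"
    by (rule measurable_compose[OF measurable_lebesgue_pair(1)] measurable_compose[OF measurable_lebesgue_pair(3)], measurable)+
  show "(\<lambda>p. jump_factor (fst p) (snd p)) \<in> borel_measurable (lebesgue \<Otimes>\<^sub>M lborel :: (('a \<times> real) \<times> ('a \<times> real)) measure)"
    unfolding jump_factor_def cis_conv_exp by measurable
qed

lemma integrable_jump_factor:
  fixes \<zeta> :: "'a::euclidean_space \<times> real"
  assumes s: "0 < s" "s < 1"
  shows "integrable lborel (\<lambda>Z. jump_factor \<zeta> Z * of_real (frac_kernel s Z))"
proof (rule Bochner_Integration.integrable_bound)
  show "integrable lborel (\<lambda>Z :: 'a \<times> real. (20 * (1 + (norm \<zeta>)\<^sup>2)) * (min 1 ((norm (fst Z))\<^sup>2 + \<bar>snd Z\<bar>) * frac_kernel s Z))"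
    by (intro integrable_mult_right integrable_min_frac_kernel s)
  show "AE Z in lborel. norm (jump_factor \<zeta> Z * of_real (frac_kernel s Z)) \<le>
      norm ((20 * (1 + (norm \<zeta>)\<^sup>2)) * (min 1 ((norm (fst Z))\<^sup>2 + \<bar>snd Z\<bar>) * frac_kernel s Z))"
  proof (rule AE_I2)
    fix Z :: "'a \<times> real"
    have "norm (jump_factor \<zeta> Z) * frac_kernel s Z \<le> (20 * (1 + (norm \<zeta>)\<^sup>2) * min 1 ((norm (fst Z))\<^sup>2 + \<bar>snd Z\<bar>)) * frac_kernel s Z"
      by (intro mult_right_mono jump_factor_bound) simp
    also have "\<dots> \<le> norm ((20 * (1 + (norm \<zeta>)\<^sup>2)) * (min 1 ((norm (fst Z))\<^sup>2 + \<bar>snd Z\<bar>) * frac_kernel s Z))"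
      by (simp only: mult.assoc real_norm_def abs_ge_self)
    finally show "norm (jump_factor \<zeta> Z * of_real (frac_kernel s Z)) \<le>
      norm ((20 * (1 + (norm \<zeta>)\<^sup>2)) * (min 1 ((norm (fst Z))\<^sup>2 + \<bar>snd Z\<bar>) * frac_kernel s Z))"
      by (simp only: norm_mult norm_of_real abs_of_nonneg[OF frac_kernel_nonneg])
  qed
qed measurable

text \<open>Integrating in space first, the heat kernel turns the cosine into a Gaussian in \<xi>;
  with the time factor this is exp(-t m), where m is the symbol of the heat operator. The time
  integral is then the subordination formula, which needs Re m > 0 and hence \<xi> \<noteq>
  0.\<close>

lemma integral_jump_factor:
  fixes \<zeta> :: "(real^'n) \<times> real"
  assumes s: "0 < s" "s < 1" and \<zeta>: "fst \<zeta> \<noteq> 0"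
  shows "(\<integral>Z. jump_factor \<zeta> Z * of_real (frac_kernel s Z) \<partial>lborel) = of_real (stable_const s) * heat_symbol s \<zeta>"
proof -
  define m where "m = complex_of_real ((2 * pi * norm (fst \<zeta>))\<^sup>2) + 2 * of_real pi * \<i> * of_real (snd \<zeta>)"
  have m: "Re m = (2 * pi * norm (fst \<zeta>))\<^sup>2" "Im m = 2 * pi * snd \<zeta>" by (auto simp: m_def)
  have "integrable (lborel \<Otimes>\<^sub>M lborel) (\<lambda>(z, t). jump_factor \<zeta> (z, t) * of_real (frac_kernel s (z, t)))"
    using integrable_jump_factor[OF s, of \<zeta>] by (simp add: lborel_prod split_beta')
  from lborel_pair.integral_snd[OF this]
  have "(\<integral>Z. jump_factor \<zeta> Z * of_real (frac_kernel s Z) \<partial>lborel) =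
      (\<integral>t. (\<integral>z. jump_factor \<zeta> (z, t) * of_real (frac_kernel s (z, t)) \<partial>lborel) \<partial>lborel)"
    by (simp add: lborel_prod split_beta')
  also have "\<dots> = subordinate s m"
    unfolding subordinate_def
  proof (intro Bochner_Integration.integral_cong refl)
    fix t :: real
    show "(\<integral>z. jump_factor \<zeta> (z, t) * of_real (frac_kernel s (z, t)) \<partial>lborel) = stable_density s t *\<^sub>R (1 - exp (- (of_real t * m)))"
    proof (cases "0 < t")
      case True
      let ?w = "(2 * pi) *\<^sub>R fst \<zeta>" and ?c = "cis (- (2 * pi * (snd \<zeta> * t)))"
      have h1: "has_bochner_integral lborel (\<lambda>z. complex_of_real (heat_kernel t z)) (complex_of_real 1)"
        by (intro has_bochner_integral_of_real heat_kernel_integral True)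
      have h2: "has_bochner_integral lborel (\<lambda>z. complex_of_real (heat_kernel t z * cos (?w \<bullet> z))) (complex_of_real (exp (- t * (norm ?w)\<^sup>2)))"
        by (intro has_bochner_integral_of_real heat_kernel_fourier True)
      have "has_bochner_integral lborel (\<lambda>z. complex_of_real (t powr (- 1 - s)) * (complex_of_real (heat_kernel t z) - complex_of_real (heat_kernel t z * cos (?w \<bullet> z)) * ?c))
        (complex_of_real (t powr (- 1 - s)) * (complex_of_real 1 - complex_of_real (exp (- t * (norm ?w)\<^sup>2)) * ?c))"
        by (intro has_bochner_integral_mult_right has_bochner_integral_diff has_bochner_integral_mult_left h1 h2)
      moreover have "complex_of_real (t powr (- 1 - s)) * (complex_of_real (heat_kernel t z) - complex_of_real (heat_kernel t z * cos (?w \<bullet> z)) * ?c)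
          = jump_factor \<zeta> (z, t) * of_real (frac_kernel s (z, t))" for z
        using True by (simp add: jump_factor_def frac_kernel_def algebra_simps)
      moreover have "complex_of_real (exp (- t * (norm ?w)\<^sup>2)) * ?c = exp (- (of_real t * m))"
      proof -
        have "complex_of_real (exp (- t * (norm ?w)\<^sup>2)) * ?c = exp (complex_of_real (- t * (norm ?w)\<^sup>2) + \<i> * of_real (- (2 * pi * (snd \<zeta> * t))))"
          by (simp only: exp_add exp_of_real cis_conv_exp)
        also have "complex_of_real (- t * (norm ?w)\<^sup>2) + \<i> * of_real (- (2 * pi * (snd \<zeta> * t))) = - (of_real t * m)"
          by (simp add: complex_eq_iff m)
        finally show ?thesis .
      qed
      ultimately have "has_bochner_integral lborel (\<lambda>z. jump_factor \<zeta> (z, t) * of_real (frac_kernel s (z, t)))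
          (complex_of_real (t powr (- 1 - s)) * (complex_of_real 1 - exp (- (of_real t * m))))"
        by (simp only:)
      then show ?thesis using True
        by (simp add: has_bochner_integral_iff stable_density_def scaleR_conv_of_real)
    qed (simp add: stable_density_def frac_kernel_def)
  qed
  also have "\<dots> = of_real (stable_const s) * m powr of_real s"
    using \<zeta> by (intro subordinate_eq_powr s) (simp add: m)
  also have "m powr of_real s = heat_symbol s \<zeta>"
    by (cases \<zeta>) (simp add: heat_symbol_def m_def)
  finally show ?thesis .
qed

lemma wave_shift: "wave t (P + Q) \<zeta> = wave t P \<zeta> * cis (2 * pi * (Q \<bullet> \<zeta>))"
  by (simp add: wave_def inner_add_left distrib_left cis_mult[symmetric])

lemma AE_fst_nonzero: "AE \<zeta> in (lebesgue :: ((real^'n) \<times> real) measure). fst \<zeta> \<noteq> 0"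
proof (rule AE_completion, rule AE_I)
  have "{\<zeta> \<in> space lborel. \<not> fst \<zeta> \<noteq> 0} = {0::real^'n} \<times> (UNIV :: real set)" by auto
  then show "{\<zeta> \<in> space lborel. \<not> fst \<zeta> \<noteq> 0} \<subseteq> {0::real^'n} \<times> (UNIV :: real set)" by simp
  have "emeasure (lborel \<Otimes>\<^sub>M lborel) ({0::real^'n} \<times> (UNIV :: real set)) = 0"
    by (subst lborel.emeasure_pair_measure_Times) auto
  then show "emeasure lborel ({0::real^'n} \<times> (UNIV :: real set)) = 0" by (simp add: lborel_prod)
  have "closed ({0::real^'n} \<times> (UNIV :: real set))" by (intro closed_Times) auto
  then show "{0::real^'n} \<times> (UNIV :: real set) \<in> sets lborel" by simp
qed

text \<open>A Gaussian in all n + 1 variables together; t is its width parameter and not the time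
  coordinate. It looks at times both before and after that of P.\<close>

definition gauss_average :: "real \<Rightarrow> ('a::euclidean_space \<Rightarrow> real) \<Rightarrow> 'a \<Rightarrow> real" where
  "gauss_average t u P = (\<integral>y. u y * heat_kernel t (P - y) \<partial>lebesgue)"

text \<open>The averages of u and of w are integrals of their transforms against the same wave, and
  these transforms differ by the symbol. Integrating the multiplier of a jump over all jumps also
  produces the symbol, so Fubini in \<zeta> and Z identifies the singular integral.\<close>

lemma gauss_average_heat:
  fixes u :: "(real^'n) \<times> real \<Rightarrow> real"
  assumes s: "0 < s" "s < 1" and t: "0 < t"
    and hp: "has_heat_pow s (\<lambda>z. complex_of_real (u z)) w"
  shows "continuous_on UNIV (gauss_average t u)"
    and "\<exists>B. \<forall>P. gauss_average t u P \<le> B"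
    and "integrable lborel (\<lambda>Z. sdiff (gauss_average t u) P Z * frac_kernel s Z)"
    and "of_real (frac_heat s (gauss_average t u) P) =
      of_real (stable_const s) * (\<integral>y. w y * of_real (heat_kernel t (P - y)) \<partial>lebesgue)"
proof -
  interpret L: sigma_finite_measure "lebesgue :: ((real^'n) \<times> real) measure" by (rule sigma_finite_lebesgue)
  interpret LL: pair_sigma_finite "lebesgue :: ((real^'n) \<times> real) measure" "lborel :: ((real^'n) \<times> real) measure" ..
  let ?A = "gauss_average t u"
  obtain U where U: "has_L2_fourier (\<lambda>z. complex_of_real (u z)) U" and W: "has_L2_fourier w (\<lambda>\<zeta>. heat_symbol s \<zeta> * U \<zeta>)"
    using hp unfolding has_heat_pow_def by blast
  have UL: "L2_fun U" using U by (simp add: has_L2_fourier_def)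
  have [measurable]: "U \<in> borel_measurable lebesgue" using UL by (simp add: L2_fun_def)
  have wave_leb [measurable]: "wave t P \<in> borel_measurable lebesgue" for P :: "(real^'n) \<times> real"
    by (intro measurable_completion) simp
  have rep: "of_real (?A P) = (\<integral>\<zeta>. U \<zeta> * wave t P \<zeta> \<partial>lebesgue)" for P
    unfolding L2_fourier_wave[OF U t] gauss_average_def by (simp flip: integral_complex_of_real)
  have iw: "integrable lebesgue (\<lambda>\<zeta>. U \<zeta> * wave t P \<zeta>)" for P
    by (intro L2_fun_mult_integrable UL L2_fun_wave t)
  \<comment> \<open>One integrable majorant, independent of P, serves for continuity, boundedness
    and the Fubini argument.\<close>
  define D where "D \<zeta> = norm (U \<zeta>) * ((1 + (norm \<zeta>)\<^sup>2) * exp (- (4 * pi\<^sup>2 * t) * (norm \<zeta>)\<^sup>2))" for \<zeta>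
  have D: "integrable lebesgue D"
  proof -
    have "integrable lebesgue (\<lambda>\<zeta>. norm (U \<zeta> * (of_real (1 + (norm \<zeta>)\<^sup>2) * wave t 0 \<zeta>)))"
      by (intro integrable_norm L2_fun_mult_integrable UL L2_fun_weighted_wave t)
    moreover have "norm (U \<zeta> * (of_real (1 + (norm \<zeta>)\<^sup>2) * wave t 0 \<zeta>)) = D \<zeta>" for \<zeta>
    proof -
      have "norm (complex_of_real (1 + (norm \<zeta>)\<^sup>2)) = 1 + (norm \<zeta>)\<^sup>2"
        by (simp only: norm_of_real abs_of_nonneg[OF add_nonneg_nonneg[OF zero_le_one zero_le_power2]])
      then show ?thesis by (simp only: norm_mult norm_wave D_def)
    qed
    ultimately show ?thesis by simp
  qed
  have nD: "norm (U \<zeta> * wave t P \<zeta>) \<le> D \<zeta>" for P \<zeta>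
  proof -
    have "1 * exp (- (4 * pi\<^sup>2 * t) * (norm \<zeta>)\<^sup>2) \<le> (1 + (norm \<zeta>)\<^sup>2) * exp (- (4 * pi\<^sup>2 * t) * (norm \<zeta>)\<^sup>2)"
      by (rule mult_right_mono) auto
    then show ?thesis unfolding norm_mult norm_wave D_def mult_1_left by (rule mult_left_mono) simp
  qed
  show "continuous_on UNIV ?A"
  proof -
    have "isCont ?A P" for P
      unfolding continuous_at_sequentially
    proof (intro allI impI)
      fix X assume X: "X \<longlonglongrightarrow> P"
      have "(\<lambda>n. \<integral>\<zeta>. U \<zeta> * wave t (X n) \<zeta> \<partial>lebesgue) \<longlonglongrightarrow> (\<integral>\<zeta>. U \<zeta> * wave t P \<zeta> \<partial>lebesgue)"
      proof (rule integral_dominated_convergence[OF _ _ D])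
        show "AE \<zeta> in lebesgue. (\<lambda>n. U \<zeta> * wave t (X n) \<zeta>) \<longlonglongrightarrow> U \<zeta> * wave t P \<zeta>"
          unfolding wave_def cis_conv_exp by (intro AE_I2 tendsto_intros X)
      qed (use nD in auto)
      then have "(\<lambda>n. complex_of_real (?A (X n))) \<longlonglongrightarrow> complex_of_real (?A P)" by (simp only: rep)
      then show "(?A \<circ> X) \<longlonglongrightarrow> ?A P" by (simp only: tendsto_of_real_iff comp_def)
    qed
    then show ?thesis by (simp add: continuous_on_eq_continuous_at)
  qed
  have "?A P \<le> (\<integral>\<zeta>. D \<zeta> \<partial>lebesgue)" for P
  proof -
    have "?A P \<le> norm (complex_of_real (?A P))" by simp
    also have "\<dots> \<le> (\<integral>\<zeta>. norm (U \<zeta> * wave t P \<zeta>) \<partial>lebesgue)" unfolding rep by (rule integral_norm_bound)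
    also have "\<dots> \<le> (\<integral>\<zeta>. D \<zeta> \<partial>lebesgue)" using iw by (intro integral_mono D nD) auto
    finally show ?thesis .
  qed
  then show "\<exists>B. \<forall>P. ?A P \<le> B" by blast
  have sd: "of_real (sdiff ?A P Z) = (\<integral>\<zeta>. U \<zeta> * wave t P \<zeta> * jump_factor \<zeta> Z \<partial>lebesgue)" for Z
  proof -
    let ?Q1 = "(fst Z, - snd Z)" and ?Q2 = "(- fst Z, - snd Z)"
    have e: "(fst P + fst Z, snd P - snd Z) = P + ?Q1" "(fst P - fst Z, snd P - snd Z) = P + ?Q2"
      by (auto simp: prod_eq_iff)
    have "complex_of_real (sdiff ?A P Z) = of_real (?A P) - (of_real (?A (P + ?Q1)) + of_real (?A (P + ?Q2))) / 2"
      unfolding sdiff_def e by simp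
    also have "\<dots> = (\<integral>\<zeta>. U \<zeta> * wave t P \<zeta> - (U \<zeta> * wave t (P + ?Q1) \<zeta> + U \<zeta> * wave t (P + ?Q2) \<zeta>) / 2 \<partial>lebesgue)"
      unfolding rep using iw by (simp add: Bochner_Integration.integral_diff Bochner_Integration.integral_add)
    also have "\<dots> = (\<integral>\<zeta>. U \<zeta> * wave t P \<zeta> * jump_factor \<zeta> Z \<partial>lebesgue)"
    proof (intro Bochner_Integration.integral_cong refl)
      fix \<zeta>
      have "cis (2 * pi * (?Q1 \<bullet> \<zeta>)) + cis (2 * pi * (?Q2 \<bullet> \<zeta>)) = 2 * (of_real (cos ((2 * pi) *\<^sub>R fst \<zeta> \<bullet> fst Z)) * cis (- (2 * pi * (snd \<zeta> * snd Z))))"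
      proof -
        define \<alpha> where "\<alpha> = (2 * pi) *\<^sub>R fst \<zeta> \<bullet> fst Z"
        define \<beta> where "\<beta> = - (2 * pi * (snd \<zeta> * snd Z))"
        have a: "2 * pi * (?Q1 \<bullet> \<zeta>) = \<alpha> + \<beta>" "2 * pi * (?Q2 \<bullet> \<zeta>) = - \<alpha> + \<beta>"
          by (auto simp: \<alpha>_def \<beta>_def inner_prod_def inner_commute algebra_simps)
        have "cis \<alpha> + cis (- \<alpha>) = 2 * of_real (cos \<alpha>)" by (simp add: complex_eq_iff)
        then show ?thesis
          unfolding a cis_mult[symmetric] distrib_right[symmetric] by (simp add: \<alpha>_def \<beta>_def)
      qed
      then show "U \<zeta> * wave t P \<zeta> - (U \<zeta> * wave t (P + ?Q1) \<zeta> + U \<zeta> * wave t (P + ?Q2) \<zeta>) / 2 = U \<zeta> * wave t P \<zeta> * jump_factor \<zeta> Z"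
        unfolding wave_shift mult.assoc[symmetric] distrib_left[symmetric]
        by (simp add: jump_factor_def right_diff_distrib mult.assoc)
    qed
    finally show ?thesis .
  qed
  let ?m = "\<lambda>Z :: (real^'n) \<times> real. min 1 ((norm (fst Z))\<^sup>2 + \<bar>snd Z\<bar>) * frac_kernel s Z"
  define F where "F \<zeta> Z = U \<zeta> * wave t P \<zeta> * (jump_factor \<zeta> Z * of_real (frac_kernel s Z))" for \<zeta> Z
  have kp [measurable]: "(\<lambda>p. frac_kernel s (snd p)) \<in> borel_measurable (lebesgue \<Otimes>\<^sub>M lborel :: (((real^'n) \<times> real) \<times> ((real^'n) \<times> real)) measure)"
    by (rule measurable_compose[OF measurable_lebesgue_pair(3)]) measurable
  have wp [measurable]: "(\<lambda>p. wave t P (fst p)) \<in> borel_measurable (lebesgue \<Otimes>\<^sub>M lborel :: (((real^'n) \<times> real) \<times> ((real^'n) \<times> real)) measure)"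
    by (rule measurable_compose[OF measurable_lebesgue_pair(1)]) measurable
  \<comment> \<open>The bound for the multiplier separates \<zeta> from Z: \<open>D\<close> contains
    the growth in \<zeta>, and the kernel meets only the integrable weight
    \<open>?m\<close>.\<close>
  have FI: "integrable (lebesgue \<Otimes>\<^sub>M lborel) (case_prod F)"
  proof (rule Bochner_Integration.integrable_bound)
    show "integrable (lebesgue \<Otimes>\<^sub>M lborel) (\<lambda>p. (20 * D (fst p)) * ?m (snd p))"
      using integrable_pair_mult[OF sigma_finite_lebesgue sigma_finite_lborel, of "\<lambda>\<zeta>. 20 * D \<zeta>" ?m] D
      by (auto intro: integrable_min_frac_kernel s)
    show "case_prod F \<in> borel_measurable (lebesgue \<Otimes>\<^sub>M lborel)"
      unfolding F_def split_beta' by measurable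
    show "AE p in lebesgue \<Otimes>\<^sub>M lborel. norm (case_prod F p) \<le> norm ((20 * D (fst p)) * ?m (snd p))"
    proof (rule AE_I2)
      fix p :: "((real^'n) \<times> real) \<times> ((real^'n) \<times> real)"
      obtain \<zeta> Z where p: "p = (\<zeta>, Z)" by (cases p)
      let ?e = "norm (U \<zeta>) * exp (- (4 * pi\<^sup>2 * t) * (norm \<zeta>)\<^sup>2) * frac_kernel s Z"
      have "norm (F \<zeta> Z) = norm (jump_factor \<zeta> Z) * ?e"
        by (simp add: F_def norm_mult norm_wave)
      also have "\<dots> \<le> (20 * (1 + (norm \<zeta>)\<^sup>2) * min 1 ((norm (fst Z))\<^sup>2 + \<bar>snd Z\<bar>)) * ?e"
        by (intro mult_right_mono jump_factor_bound) simp
      also have "\<dots> = (20 * D \<zeta>) * ?m Z" by (simp add: D_def mult_ac)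
      finally show "norm (case_prod F p) \<le> norm ((20 * D (fst p)) * ?m (snd p))"
        by (simp add: p)
    qed
  qed
  have inner: "(\<integral>\<zeta>. F \<zeta> Z \<partial>lebesgue) = of_real (sdiff ?A P Z * frac_kernel s Z)" for Z
    unfolding F_def of_real_mult sd integral_mult_left_zero[symmetric] by (simp add: mult.assoc)
  have "integrable lborel (\<lambda>Z. complex_of_real (sdiff ?A P Z * frac_kernel s Z))"
    using LL.integrable_snd[OF FI] unfolding inner .
  then show "integrable lborel (\<lambda>Z. sdiff ?A P Z * frac_kernel s Z)"
    by (simp only: complex_of_real_integrable_eq)
  have "of_real (frac_heat s ?A P) = (\<integral>Z. complex_of_real (sdiff ?A P Z * frac_kernel s Z) \<partial>lborel)"
    by (simp only: frac_heat_def integral_complex_of_real)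
  also have "\<dots> = (\<integral>\<zeta>. (\<integral>Z. F \<zeta> Z \<partial>lborel) \<partial>lebesgue)"
    unfolding inner[symmetric] by (rule LL.Fubini_integral[OF FI])
  also have "\<dots> = (\<integral>\<zeta>. of_real (stable_const s) * ((heat_symbol s \<zeta> * U \<zeta>) * wave t P \<zeta>) \<partial>lebesgue)"
  proof (rule integral_cong_AE)
    show "(\<lambda>\<zeta>. \<integral>Z. F \<zeta> Z \<partial>lborel) \<in> borel_measurable lebesgue"
      using LL.integrable_fst[OF FI] by (rule borel_measurable_integrable)
    have "L2_fun (\<lambda>\<zeta>. heat_symbol s \<zeta> * U \<zeta>)" using W by (simp add: has_L2_fourier_def)
    then have [measurable]: "(\<lambda>\<zeta>. heat_symbol s \<zeta> * U \<zeta>) \<in> borel_measurable lebesgue" by (simp add: L2_fun_def)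
    show "(\<lambda>\<zeta>. of_real (stable_const s) * ((heat_symbol s \<zeta> * U \<zeta>) * wave t P \<zeta>)) \<in> borel_measurable lebesgue"
      by measurable
    \<comment> \<open>The formula for the integrated multiplier is available for \<xi> \<noteq> 0
      only, which excludes a null set.\<close>
    show "AE \<zeta> in lebesgue. (\<integral>Z. F \<zeta> Z \<partial>lborel) = of_real (stable_const s) * ((heat_symbol s \<zeta> * U \<zeta>) * wave t P \<zeta>)"
      using AE_fst_nonzero
    proof eventually_elim
      case (elim \<zeta>)
      then show ?case
        unfolding F_def integral_mult_right_zero integral_jump_factor[OF s elim] by (simp add: mult_ac)
    qed
  qed
  also have "\<dots> = of_real (stable_const s) * (\<integral>y. w y * of_real (heat_kernel t (P - y)) \<partial>lebesgue)"
    unfolding integral_mult_right_zero L2_fourier_wave[OF W t] ..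
  finally show "of_real (frac_heat s ?A P) = of_real (stable_const s) * (\<integral>y. w y * of_real (heat_kernel t (P - y)) \<partial>lebesgue)" .
qed


section \<open>Removing the average\<close>

lemma gauss_peak_tendsto:
  fixes a c :: real
  assumes "0 < a" "0 < c"
  shows "((\<lambda>t. (4 * pi * t) powr (- a) * exp (- c / t)) \<longlongrightarrow> 0) (at_right 0)"
  using assms by real_asymp

lemma L2_fun_heat_kernel_integrable:
  fixes f :: "'a::euclidean_space \<Rightarrow> complex"
  assumes f: "L2_fun f" and t: "0 < t"
  shows "integrable lebesgue (\<lambda>y. norm (f y) * heat_kernel t (P - y))"
  using integrable_norm[OF L2_fun_mult_integrable[OF f L2_fun_heat_kernel[OF t, of P]]]
  by (simp add: norm_mult)

lemma heat_kernel_shift_lebesgue: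
  assumes "0 < t"
  shows "integrable lebesgue (\<lambda>y::'a::euclidean_space. heat_kernel t (P - y))"
    and "(\<integral>y. heat_kernel t (P - (y::'a)) \<partial>lebesgue) = 1"
  using heat_kernel_translate_integral[OF assms, of P]
  by (auto simp: integrable_completion integral_completion has_bochner_integral_iff)

lemma L2_real_measurable:
  fixes u :: "'a::euclidean_space \<Rightarrow> real"
  assumes "L2_fun (\<lambda>z. complex_of_real (u z))"
  shows "u \<in> borel_measurable lebesgue"
  using assms borel_measurable_complex_iff[of "\<lambda>z. complex_of_real (u z)" lebesgue] by (simp add: L2_fun_def)

lemma L2_real_locally_integrable:
  fixes u :: "'a::euclidean_space \<Rightarrow> real"
  assumes u: "L2_fun (\<lambda>z. complex_of_real (u z))" and S: "S \<in> lmeasurable"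
  shows "integrable lebesgue (\<lambda>z. indicator S z * u z)"
proof (rule Bochner_Integration.integrable_bound)
  have "integrable lebesgue (indicator S :: 'a \<Rightarrow> real)" using S by (simp add: lmeasurable_iff_integrable)
  moreover have "integrable lebesgue (\<lambda>z. (u z)\<^sup>2)"
    using L2_fun_integrable_square[OF u] by simp
  ultimately show "integrable lebesgue (\<lambda>z. indicator S z + (u z)\<^sup>2)"
    by (rule Bochner_Integration.integrable_add)
  have "(indicator S :: 'a \<Rightarrow> real) \<in> borel_measurable lebesgue"
    by (rule borel_measurable_indicator[OF fmeasurableD[OF S]])
  then show "(\<lambda>z. indicator S z * u z) \<in> borel_measurable lebesgue"
    by (rule borel_measurable_times[OF _ L2_real_measurable[OF u]])
  show "AE z in lebesgue. norm (indicator S z * u z) \<le> norm (indicator S z + (u z)\<^sup>2)"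
  proof (rule AE_I2)
    fix z
    have "\<bar>u z\<bar> \<le> 1 + (u z)\<^sup>2"
      using zero_le_power2[of "\<bar>u z\<bar> - 1"] by (simp add: power2_diff)
    then show "norm (indicator S z * u z) \<le> norm (indicator S z + (u z)\<^sup>2)"
      by (simp add: indicator_def)
  qed
qed

lemma integrable_gauss_tail:
  fixes f :: "'a::euclidean_space \<Rightarrow> complex"
  assumes f: "L2_fun f" and t: "0 < t"
  shows "integrable lebesgue (\<lambda>y. indicator {y. d \<le> norm (P - y)} y * (norm (f y) * heat_kernel t (P - y)))"
proof (rule Bochner_Integration.integrable_bound[OF L2_fun_heat_kernel_integrable[OF f t, of P]])
  have "f \<in> borel_measurable lebesgue" using f by (simp add: L2_fun_def)
  moreover have "indicator {y. d \<le> norm (P - y)} \<in> borel_measurable (lebesgue :: 'a measure)"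
    by (intro measurable_completion borel_measurable_indicator) measurable
  moreover have "(\<lambda>y. heat_kernel t (P - y)) \<in> borel_measurable (lebesgue :: 'a measure)"
    by (intro measurable_completion) measurable
  ultimately show "(\<lambda>y. indicator {y. d \<le> norm (P - y)} y * (norm (f y) * heat_kernel t (P - y))) \<in> borel_measurable lebesgue"
    by measurable
qed (auto simp: indicator_def)

text \<open>Off the ball the kernel h is at most M(t), which tends to 0, so h^2 \<le> M(t) h.
  Young's inequality |f| h \<le> (\<eta> / 2) |f|^2 + h^2 / (2 \<eta>) then bounds the tail
  uniformly in P, as h has mass 1.\<close>

lemma gauss_tail:
  fixes f :: "'a::euclidean_space \<Rightarrow> complex"
  assumes f: "L2_fun f" and d: "0 < d" and e: "0 < e"
  shows "eventually (\<lambda>t. \<forall>P. (\<integral>y. indicator {y. d \<le> norm (P - y)} y * (norm (f y) * heat_kernel t (P - y)) \<partial>lebesgue) \<le> e) (at_right 0)"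
proof -
  define G where "G = (\<integral>y. (norm (f y))\<^sup>2 \<partial>lebesgue)"
  \<comment> \<open>This makes the part of the bound that does not shrink with t at most e / 2; the
    other part falls below e / 2 once M(t) < e \<eta>.\<close>
  define \<eta> where "\<eta> = e / (G + 1)"
  have G: "0 \<le> G" unfolding G_def by (intro integral_nonneg_AE AE_I2) simp
  have \<eta>: "0 < \<eta>" using G e by (simp add: \<eta>_def)
  have \<eta>G: "\<eta> * G \<le> e" using G e by (simp add: \<eta>_def field_simps)
  let ?M = "\<lambda>t. (4 * pi * t) powr (- (DIM('a) / 2)) * exp (- (d\<^sup>2 / 4) / t)"
  have "(?M \<longlongrightarrow> 0) (at_right 0)" using d by (intro gauss_peak_tendsto) auto
  then have "eventually (\<lambda>t. ?M t < e * \<eta>) (at_right 0)"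
    using e \<eta> by (intro order_tendstoD) auto
  moreover have "eventually (\<lambda>t. t > 0) (at_right (0::real))" by (rule eventually_at_right_less)
  ultimately show ?thesis
  proof eventually_elim
    case (elim t)
    then have t: "0 < t" and M: "?M t < e * \<eta>" by auto
    show ?case
    proof
      fix P
      have le: "indicator {y. d \<le> norm (P - y)} y * (norm (f y) * heat_kernel t (P - y))
          \<le> \<eta> / 2 * (norm (f y))\<^sup>2 + ?M t / (2 * \<eta>) * heat_kernel t (P - y)" for y
      proof (cases "d \<le> norm (P - y)")
        case True
        let ?a = "norm (f y)" and ?h = "heat_kernel t (P - y)"
        have "d\<^sup>2 \<le> (norm (P - y))\<^sup>2" using True d by (intro power_mono) auto
        then have "- (norm (P - y))\<^sup>2 / (4 * t) \<le> - (d\<^sup>2 / 4) / t" using t by (simp add: field_simps)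
        then have "?h \<le> ?M t" unfolding heat_kernel_def by (intro mult_left_mono) auto
        then have "?h * ?h \<le> ?M t * ?h" by (rule mult_right_mono) simp
        then have hh: "?h * ?h / (2 * \<eta>) \<le> ?M t * ?h / (2 * \<eta>)" using \<eta> by (intro divide_right_mono) auto
        have "0 \<le> (\<eta> * ?a - ?h)\<^sup>2 / (2 * \<eta>)" using \<eta> by simp
        also have "\<dots> = \<eta> / 2 * ?a\<^sup>2 + ?h * ?h / (2 * \<eta>) - ?a * ?h"
          using \<eta> by (simp add: field_simps power2_eq_square)
        finally have "?a * ?h \<le> \<eta> / 2 * ?a\<^sup>2 + ?h * ?h / (2 * \<eta>)" by simp
        with hh True show ?thesis by simp
      qed (use \<eta> in simp)
      have iG: "integrable lebesgue (\<lambda>y. (norm (f y))\<^sup>2)" by (rule L2_fun_integrable_square[OF f])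
      have "(\<integral>y. indicator {y. d \<le> norm (P - y)} y * (norm (f y) * heat_kernel t (P - y)) \<partial>lebesgue)
          \<le> (\<integral>y. \<eta> / 2 * (norm (f y))\<^sup>2 + ?M t / (2 * \<eta>) * heat_kernel t (P - y) \<partial>lebesgue)"
      proof (rule integral_mono)
        show "integrable lebesgue (\<lambda>y. indicator {y. d \<le> norm (P - y)} y * (norm (f y) * heat_kernel t (P - y)))"
          by (rule integrable_gauss_tail[OF f t])
        show "integrable lebesgue (\<lambda>y. \<eta> / 2 * (norm (f y))\<^sup>2 + ?M t / (2 * \<eta>) * heat_kernel t (P - y))"
          by (intro Bochner_Integration.integrable_add integrable_mult_right iG heat_kernel_shift_lebesgue t)
      qed (rule le)
      also have "\<dots> = \<eta> / 2 * G + ?M t / (2 * \<eta>) * 1"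
        using iG heat_kernel_shift_lebesgue[OF t, of P]
        by (subst Bochner_Integration.integral_add) (simp_all add: G_def)
      also have "\<dots> \<le> e / 2 + e / 2"
        using \<eta>G M \<eta> by (intro add_mono) (auto simp: field_simps)
      finally show "(\<integral>y. indicator {y. d \<le> norm (P - y)} y * (norm (f y) * heat_kernel t (P - y)) \<partial>lebesgue) \<le> e" by simp
    qed
  qed
qed

lemma L2_real_heat_kernel_integrable:
  fixes u :: "'a::euclidean_space \<Rightarrow> real"
  assumes u: "L2_fun (\<lambda>z. complex_of_real (u z))" and t: "0 < t"
  shows "integrable lebesgue (\<lambda>y. u y * heat_kernel t (P - y))"
proof -
  have "integrable lebesgue (\<lambda>y. complex_of_real (u y * heat_kernel t (P - y)))"
    using L2_fun_mult_integrable[OF u L2_fun_heat_kernel[OF t, of P]] by simp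
  then show ?thesis by (simp only: complex_of_real_integrable_eq)
qed

lemma gauss_average_nonneg:
  assumes "AE z in lebesgue. 0 \<le> u z"
  shows "0 \<le> gauss_average t u P"
  unfolding gauss_average_def using assms by (intro integral_nonneg_AE) (auto elim!: eventually_mono)

text \<open>The equation is available on Q only. At distance d from the complement, what lies
  outside contributes a Gaussian tail of w, which e absorbs uniformly in P.\<close>

lemma gauss_average_equation:
  fixes u V \<psi> :: "'a::euclidean_space \<Rightarrow> real"
  assumes u: "L2_fun (\<lambda>z. complex_of_real (u z))" and w: "L2_fun w"
    and pos: "AE z in lebesgue. 0 \<le> u z"
    and eq: "AE z in lebesgue. z \<in> Q \<longrightarrow> w z = complex_of_real (V z * u z + \<psi> z)"
    and V: "AE z in lebesgue. z \<in> Q \<longrightarrow> \<bar>V z\<bar> \<le> K" and \<psi>: "AE z in lebesgue. z \<in> Q \<longrightarrow> \<bar>\<psi> z\<bar> \<le> \<Psi>"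
    and K: "0 \<le> K" and \<Psi>: "0 \<le> \<Psi>" and d: "0 < d" and e: "0 < e"
  shows "eventually (\<lambda>t. \<forall>P. ball P d \<subseteq> Q \<longrightarrow>
    norm (\<integral>y. w y * of_real (heat_kernel t (P - y)) \<partial>lebesgue) \<le> K * gauss_average t u P + (\<Psi> + e)) (at_right 0)"
  using gauss_tail[OF w d e] eventually_at_right_less[of "0::real"]
proof eventually_elim
  case (elim t)
  then have t: "0 < t" by simp
  show ?case
  proof (intro allI impI)
    fix P assume Q: "ball P d \<subseteq> Q"
    let ?h = "\<lambda>y. heat_kernel t (P - y)"
    let ?tail = "\<lambda>y. indicator {y. d \<le> norm (P - y)} y * (norm (w y) * ?h y)"
    have it: "integrable lebesgue ?tail" by (rule integrable_gauss_tail[OF w t])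
    have iu: "integrable lebesgue (\<lambda>y. u y * ?h y)" by (rule L2_real_heat_kernel_integrable[OF u t])
    note ih = heat_kernel_shift_lebesgue[OF t, of P]
    have "norm (\<integral>y. w y * of_real (?h y) \<partial>lebesgue) \<le> (\<integral>y. norm (w y * of_real (?h y)) \<partial>lebesgue)"
      by (rule integral_norm_bound)
    also have "\<dots> \<le> (\<integral>y. K * (u y * ?h y) + \<Psi> * ?h y + ?tail y \<partial>lebesgue)"
    proof (rule integral_mono_AE)
      show "integrable lebesgue (\<lambda>y. norm (w y * of_real (?h y)))"
        by (intro integrable_norm L2_fun_mult_integrable w L2_fun_heat_kernel t)
      show "integrable lebesgue (\<lambda>y. K * (u y * ?h y) + \<Psi> * ?h y + ?tail y)"
        by (intro Bochner_Integration.integrable_add integrable_mult_right iu ih it)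
      \<comment> \<open>Inside the ball |w| \<le> K u + \<Psi>, since u \<ge> 0. Outside it w is
        covered by the tail, and the other two terms are nonnegative, so they may be integrated over
        the whole space and give the average of u itself.\<close>
      show "AE y in lebesgue. norm (w y * of_real (?h y)) \<le> K * (u y * ?h y) + \<Psi> * ?h y + ?tail y"
        using pos eq V \<psi>
      proof eventually_elim
        case (elim y)
        have h0: "0 \<le> ?h y" by simp
        show ?case
        proof (cases "d \<le> norm (P - y)")
          case True
          then show ?thesis using elim(1) K \<Psi> by (simp add: norm_mult)
        next
          case False
          then have "y \<in> Q" using Q by (auto simp: dist_norm)
          then have wy: "w y = complex_of_real (V y * u y + \<psi> y)" "\<bar>V y\<bar> \<le> K" "\<bar>\<psi> y\<bar> \<le> \<Psi>"
            using elim by auto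
          have "norm (w y) = \<bar>V y * u y + \<psi> y\<bar>" unfolding wy(1) norm_of_real ..
          also have "\<dots> \<le> \<bar>V y\<bar> * u y + \<bar>\<psi> y\<bar>"
            using elim(1) by (intro order_trans[OF abs_triangle_ineq]) (simp add: abs_mult)
          also have "\<dots> \<le> K * u y + \<Psi>"
            using wy elim(1) by (intro add_mono mult_right_mono) auto
          finally have "norm (w y) * ?h y \<le> (K * u y + \<Psi>) * ?h y"
            by (rule mult_right_mono) simp
          then show ?thesis using False by (simp add: norm_mult distrib_right mult.assoc)
        qed
      qed
    qed
    also have "\<dots> = K * gauss_average t u P + \<Psi> + (\<integral>y. ?tail y \<partial>lebesgue)"
      using iu ih it by (simp add: gauss_average_def)
    also have "\<dots> \<le> K * gauss_average t u P + (\<Psi> + e)"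
      using elim by simp
    finally show "norm (\<integral>y. w y * of_real (?h y) \<partial>lebesgue) \<le> K * gauss_average t u P + (\<Psi> + e)" .
  qed
qed

text \<open>The distance r = |x - y| is dominated by (r^2 + t) / sqrt t, so the second moment
  already available bounds the first one by a multiple of sqrt t.\<close>

lemma heat_kernel_first_moment:
  fixes f :: "'a::euclidean_space \<Rightarrow> real"
  assumes t: "0 < t" and lip: "\<And>x y. \<bar>f x - f y\<bar> \<le> L * norm (x - y)" and f: "\<And>x. \<bar>f x\<bar> \<le> 1"
  shows "\<bar>(\<integral>x. f x * heat_kernel t (x - y) \<partial>lborel) - f y\<bar> \<le> L * moment_const TYPE('a) * sqrt t"
proof -
  have L: "0 \<le> L"
  proof -
    obtain b :: 'a where b: "b \<in> Basis" using nonempty_Basis by blast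
    then show ?thesis using lip[of b 0] by (simp add: norm_Basis)
  qed
  have M: "1 \<le> moment_const TYPE('a)" by (rule moment_const_ge)
  have cont: "continuous_on UNIV f"
  proof (rule lipschitz_on_continuous_on[of L])
    show "L-lipschitz_on UNIV f" using lip L by (intro lipschitz_onI) (auto simp: dist_norm)
  qed
  then have [measurable]: "f \<in> borel_measurable borel" by (rule borel_measurable_continuous_onI)
  have shift: "has_bochner_integral lborel (\<lambda>x::'a. heat_kernel t (x - y)) 1"
  proof -
    have "heat_kernel t (x - y) = heat_kernel t (y - x)" for x by (simp add: heat_kernel_def norm_minus_commute)
    then show ?thesis using heat_kernel_translate_integral[OF t, of y] by simp
  qed
  have nn: "(\<integral>\<^sup>+x. ennreal (((norm (x - y))\<^sup>2 + t) * heat_kernel t (x - y)) \<partial>lborel) \<le> ennreal (moment_const TYPE('a) * t)"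
  proof -
    have "(\<integral>\<^sup>+x. ennreal (((norm (x - y))\<^sup>2 + t) * heat_kernel t (x - y)) \<partial>lborel)
        = (\<integral>\<^sup>+x. ennreal (((norm x)\<^sup>2 + t) * heat_kernel t x) \<partial>(distr lborel borel (\<lambda>x. x - y)))"
      by (subst nn_integral_distr) auto
    also have "distr lborel borel (\<lambda>x. x - y) = lborel"
    proof -
      have "(\<lambda>x. x - y) = (+) (- y)" by auto
      then show ?thesis by (simp only: lborel_distr_plus)
    qed
    finally show ?thesis using heat_kernel_moment[OF t, where 'a='a] by simp
  qed
  have im: "integrable lborel (\<lambda>x. ((norm (x - y))\<^sup>2 + t) * heat_kernel t (x - y))"
    by (rule integrableI_nonneg) (use t le_less_trans[OF nn ennreal_less_top] in simp_all)
  have Im: "(\<integral>x. ((norm (x - y))\<^sup>2 + t) * heat_kernel t (x - y) \<partial>lborel) \<le> moment_const TYPE('a) * t"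
    using M t nn by (intro integral_real_bounded) auto
  have i1: "integrable lborel (\<lambda>x. f x * heat_kernel t (x - y))"
  proof (rule Bochner_Integration.integrable_bound)
    show "integrable lborel (\<lambda>x. heat_kernel t (x - y))" using shift by (simp add: has_bochner_integral_iff)
    show "AE x in lborel. norm (f x * heat_kernel t (x - y)) \<le> norm (heat_kernel t (x - y))"
      using f by (intro AE_I2) (simp add: abs_mult mult_left_le_one_le)
  qed measurable
  have i2: "integrable lborel (\<lambda>x. f y * heat_kernel t (x - y))"
    using shift by (intro integrable_mult_right) (simp add: has_bochner_integral_iff)
  have fy: "(\<integral>x. f y * heat_kernel t (x - y) \<partial>lborel) = f y"
    using shift by (simp add: has_bochner_integral_iff)
  have "\<bar>(\<integral>x. f x * heat_kernel t (x - y) \<partial>lborel) - f y\<bar> = \<bar>\<integral>x. f x * heat_kernel t (x - y) - f y * heat_kernel t (x - y) \<partial>lborel\<bar>"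
    unfolding Bochner_Integration.integral_diff[OF i1 i2] fy ..
  also have "\<dots> \<le> (\<integral>x. \<bar>f x * heat_kernel t (x - y) - f y * heat_kernel t (x - y)\<bar> \<partial>lborel)"
    using integral_norm_bound[of lborel "\<lambda>x. f x * heat_kernel t (x - y) - f y * heat_kernel t (x - y)"] by simp
  also have "\<dots> \<le> (\<integral>x. L / sqrt t * (((norm (x - y))\<^sup>2 + t) * heat_kernel t (x - y)) \<partial>lborel)"
  proof (rule integral_mono)
    show "integrable lborel (\<lambda>x. \<bar>f x * heat_kernel t (x - y) - f y * heat_kernel t (x - y)\<bar>)"
      using i1 i2 by (intro integrable_abs Bochner_Integration.integrable_diff)
    show "integrable lborel (\<lambda>x. L / sqrt t * (((norm (x - y))\<^sup>2 + t) * heat_kernel t (x - y)))"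
      by (intro integrable_mult_right im)
    fix x
    let ?r = "norm (x - y)"
    have "?r * sqrt t \<le> ?r\<^sup>2 + t"
    proof -
      have "2 * (?r * sqrt t) \<le> ?r\<^sup>2 + (sqrt t)\<^sup>2"
        using zero_le_power2[of "?r - sqrt t"] by (simp add: power2_diff)
      moreover have "0 \<le> ?r * sqrt t" "(sqrt t)\<^sup>2 = t" using t by auto
      ultimately show ?thesis by argo
    qed
    then have "?r \<le> (?r\<^sup>2 + t) / sqrt t" using t by (simp add: pos_le_divide_eq)
    then have "L * ?r \<le> L * ((?r\<^sup>2 + t) / sqrt t)" using L by (rule mult_left_mono)
    then have "\<bar>f x - f y\<bar> \<le> L / sqrt t * (?r\<^sup>2 + t)" using lip[of x y] by simp
    then have "\<bar>f x - f y\<bar> * heat_kernel t (x - y) \<le> L / sqrt t * (?r\<^sup>2 + t) * heat_kernel t (x - y)"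
      by (rule mult_right_mono) simp
    then show "\<bar>f x * heat_kernel t (x - y) - f y * heat_kernel t (x - y)\<bar> \<le> L / sqrt t * ((?r\<^sup>2 + t) * heat_kernel t (x - y))"
      by (simp add: left_diff_distrib[symmetric] abs_mult mult.assoc)
  qed
  also have "\<dots> \<le> L / sqrt t * (moment_const TYPE('a) * t)"
    using L t unfolding integral_mult_right_zero by (intro mult_left_mono Im) auto
  also have "\<dots> = L * moment_const TYPE('a) * sqrt t"
    using t by (simp add: field_simps)
  finally show ?thesis .
qed

text \<open>By Fubini and symmetry of the kernel the average is moved onto the Lipschitz function f,
  where it changes little. Fubini needs an integrable factor, so u is first cut off to a ball; the
  part cut away is seen from the support of f only through Gaussian tails.\<close>

lemma gauss_average_weak_limit:
  fixes u f :: "'a::euclidean_space \<Rightarrow> real"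
  assumes u: "L2_fun (\<lambda>z. complex_of_real (u z))"
    and lip: "\<And>x y. \<bar>f x - f y\<bar> \<le> L * norm (x - y)" and f: "\<And>x. 0 \<le> f x" "\<And>x. f x \<le> 1"
    and supp: "\<And>x. R \<le> norm x \<Longrightarrow> f x = 0"
    and avg: "\<And>t. 0 < t \<Longrightarrow> continuous_on UNIV (gauss_average t u)"
  shows "((\<lambda>t. \<integral>P. f P * gauss_average t u P \<partial>lborel) \<longlongrightarrow> (\<integral>P. f P * u P \<partial>lebesgue)) (at_right 0)"
proof -
  interpret L: sigma_finite_measure "lebesgue :: 'a measure" by (rule sigma_finite_lebesgue)
  interpret LL: pair_sigma_finite "lebesgue :: 'a measure" "lborel :: 'a measure" ..
  have L0: "0 \<le> L"
  proof -
    obtain b :: 'a where b: "b \<in> Basis" using nonempty_Basis by blast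
    then show ?thesis using lip[of b 0] by (simp add: norm_Basis)
  qed
  have fabs: "\<bar>f x\<bar> \<le> 1" for x using f[of x] by simp
  have cont: "continuous_on UNIV f"
  proof (rule lipschitz_on_continuous_on[of L])
    show "L-lipschitz_on UNIV f" using lip L0 by (intro lipschitz_onI) (auto simp: dist_norm)
  qed
  then have fm[measurable]: "f \<in> borel_measurable borel" by (rule borel_measurable_continuous_onI)
  have um[measurable]: "u \<in> borel_measurable lebesgue" by (rule L2_real_measurable[OF u])
  have comp_int: "integrable lborel (\<lambda>P. f P * g P)" if g: "continuous_on UNIV g" for g
  proof -
    have "integrable lborel (\<lambda>x. indicator (cball 0 R) x *\<^sub>R (f x * g x))"
      by (intro borel_integrable_compact) (auto intro!: continuous_intros continuous_on_subset[OF g] continuous_on_subset[OF cont])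
    moreover have "indicator (cball 0 R) x *\<^sub>R (f x * g x) = f x * g x" for x
      using supp[of x] by (auto simp: indicator_def)
    ultimately show ?thesis by (simp only:)
  qed
  have fint: "integrable lborel f" using comp_int[of "\<lambda>_. 1"] by simp
  \<comment> \<open>The margin 1 around the support of f is the radius used in the tail
    estimate.\<close>
  define S where "S = ball (0::'a) (R + 1)"
  define v where "v y = indicator S y * u y" for y
  have Sm: "S \<in> lmeasurable" by (simp add: S_def)
  have vint: "integrable lebesgue v"
    unfolding v_def[abs_def] by (rule L2_real_locally_integrable[OF u Sm])
  then have vm[measurable]: "v \<in> borel_measurable lebesgue" by (rule borel_measurable_integrable)
  define N where "N = (\<integral>y. \<bar>v y\<bar> \<partial>lebesgue)"
  define If where "If = (\<integral>P. f P \<partial>lborel)"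
  have If0: "0 \<le> If" unfolding If_def using f by (intro integral_nonneg_AE AE_I2) auto
  have N0: "0 \<le> N" unfolding N_def by (intro integral_nonneg_AE AE_I2) auto
  let ?I = "\<lambda>t. \<integral>P. f P * gauss_average t u P \<partial>lborel" and ?J = "\<integral>P. f P * u P \<partial>lebesgue"
  let ?M = "moment_const TYPE('a)"
  have est: "\<bar>?I t - ?J\<bar> \<le> e * If + L * ?M * sqrt t * N"
    if t: "0 < t" and tail: "\<And>P. (\<integral>y. indicator {y. 1 \<le> norm (P - y)} y * (norm (complex_of_real (u y)) * heat_kernel t (P - y)) \<partial>lebesgue) \<le> e"
    for t e
  proof -
    define F where "F y P = v y * (f P * heat_kernel t (P - y))" for y P
    let ?c = "(4 * pi * t) powr (- (DIM('a) / 2))"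
    have FI: "integrable (lebesgue \<Otimes>\<^sub>M lborel) (case_prod F)"
    proof (rule Bochner_Integration.integrable_bound)
      show "integrable (lebesgue \<Otimes>\<^sub>M lborel) (\<lambda>p. (?c * v (fst p)) * f (snd p))"
        using integrable_pair_mult[OF sigma_finite_lebesgue sigma_finite_lborel, of "\<lambda>y. ?c * v y" f] vint fint by auto
      have [measurable]: "(\<lambda>p. f (snd p)) \<in> borel_measurable (lebesgue \<Otimes>\<^sub>M lborel :: ('a \<times> 'a) measure)"
        by (rule measurable_compose[OF measurable_lebesgue_pair(3)]) measurable
      have [measurable]: "(\<lambda>p. heat_kernel t (snd p - fst p)) \<in> borel_measurable (lebesgue \<Otimes>\<^sub>M lborel :: ('a \<times> 'a) measure)"
        unfolding heat_kernel_def by measurable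
      show "case_prod F \<in> borel_measurable (lebesgue \<Otimes>\<^sub>M lborel)"
        unfolding F_def split_beta' by measurable
      show "AE p in lebesgue \<Otimes>\<^sub>M lborel. norm (case_prod F p) \<le> norm ((?c * v (fst p)) * f (snd p))"
      proof (rule AE_I2)
        fix p :: "'a \<times> 'a"
        obtain y P where p: "p = (y, P)" by (cases p)
        have "\<bar>v y * f P\<bar> * heat_kernel t (P - y) \<le> \<bar>v y * f P\<bar> * ?c"
          by (intro mult_left_mono heat_kernel_le t) auto
        then show "norm (case_prod F p) \<le> norm ((?c * v (fst p)) * f (snd p))"
          by (simp add: p F_def abs_mult mult_ac)
      qed
    qed
    let ?w = "\<lambda>P. \<integral>y. v y * heat_kernel t (P - y) \<partial>lebesgue"
    have iv: "integrable lebesgue (\<lambda>y. v y * heat_kernel t (P - y))" for P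
    proof (rule Bochner_Integration.integrable_bound[OF L2_real_heat_kernel_integrable[OF u t, of P]])
      have "(\<lambda>y. heat_kernel t (P - y)) \<in> borel_measurable (lebesgue :: 'a measure)"
        by (intro measurable_completion) measurable
      then show "(\<lambda>y. v y * heat_kernel t (P - y)) \<in> borel_measurable lebesgue" by measurable
    qed (auto simp: v_def indicator_def)
    have inner: "(\<integral>y. F y P \<partial>lebesgue) = f P * ?w P" for P
    proof -
      have "(\<integral>y. F y P \<partial>lebesgue) = (\<integral>y. f P * (v y * heat_kernel t (P - y)) \<partial>lebesgue)"
        by (simp add: F_def mult_ac)
      then show ?thesis by simp
    qed
    have wint: "integrable lborel (\<lambda>P. f P * ?w P)" using LL.integrable_snd[OF FI] unfolding inner .
    have swap: "(\<integral>P. f P * ?w P \<partial>lborel) = (\<integral>y. v y * (\<integral>P. f P * heat_kernel t (P - y) \<partial>lborel) \<partial>lebesgue)"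
    proof -
      have "(\<integral>P. f P * ?w P \<partial>lborel) = (\<integral>y. (\<integral>P. F y P \<partial>lborel) \<partial>lebesgue)"
        unfolding inner[symmetric] by (rule LL.Fubini_integral[OF FI])
      then show ?thesis by (simp add: F_def)
    qed
    have near: "\<bar>(\<integral>P. f P * ?w P \<partial>lborel) - ?J\<bar> \<le> L * ?M * sqrt t * N"
    proof -
      have fu: "f y * u y = v y * f y" for y
      proof (cases "y \<in> S")
        case False
        then have "f y = 0" using supp[of y] by (simp add: S_def)
        then show ?thesis by simp
      qed (simp add: v_def)
      have i1: "integrable lebesgue (\<lambda>y. v y * (\<integral>P. f P * heat_kernel t (P - y) \<partial>lborel))"
        using LL.integrable_fst[OF FI] by (simp add: F_def)
      have fleb: "f \<in> borel_measurable lebesgue" by (intro measurable_completion) simp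
      have i2: "integrable lebesgue (\<lambda>y. v y * f y)"
        by (rule Bochner_Integration.integrable_bound[OF vint])
          (use fleb f in \<open>auto simp: abs_mult mult_left_le\<close>)
      have "(\<integral>P. f P * ?w P \<partial>lborel) - ?J = (\<integral>y. v y * ((\<integral>P. f P * heat_kernel t (P - y) \<partial>lborel) - f y) \<partial>lebesgue)"
        unfolding swap fu right_diff_distrib by (rule Bochner_Integration.integral_diff[OF i1 i2, symmetric])
      also have "\<bar>\<dots>\<bar> \<le> (\<integral>y. \<bar>v y * ((\<integral>P. f P * heat_kernel t (P - y) \<partial>lborel) - f y)\<bar> \<partial>lebesgue)"
        using integral_norm_bound[of lebesgue "\<lambda>y. v y * ((\<integral>P. f P * heat_kernel t (P - y) \<partial>lborel) - f y)"] by simp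
      also have "\<dots> \<le> (\<integral>y. L * ?M * sqrt t * \<bar>v y\<bar> \<partial>lebesgue)"
      proof (rule integral_mono)
        show "integrable lebesgue (\<lambda>y. \<bar>v y * ((\<integral>P. f P * heat_kernel t (P - y) \<partial>lborel) - f y)\<bar>)"
          unfolding right_diff_distrib by (intro integrable_abs Bochner_Integration.integrable_diff i1 i2)
        show "integrable lebesgue (\<lambda>y. L * ?M * sqrt t * \<bar>v y\<bar>)"
          by (intro integrable_mult_right integrable_abs vint)
        show "\<bar>v y * ((\<integral>P. f P * heat_kernel t (P - y) \<partial>lborel) - f y)\<bar> \<le> L * ?M * sqrt t * \<bar>v y\<bar>" for y
          using mult_left_mono[OF heat_kernel_first_moment[OF t lip fabs, of y], of "\<bar>v y\<bar>"]
          by (simp add: abs_mult mult_ac)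
      qed
      finally show ?thesis by (simp add: N_def)
    qed
    have far: "\<bar>gauss_average t u P - ?w P\<bar> \<le> e" if P: "norm P < R" for P
    proof -
      let ?tl = "\<lambda>y. indicator {y. 1 \<le> norm (P - y)} y * (norm (complex_of_real (u y)) * heat_kernel t (P - y))"
      have iu: "integrable lebesgue (\<lambda>y. u y * heat_kernel t (P - y))" by (rule L2_real_heat_kernel_integrable[OF u t])
      have it: "integrable lebesgue ?tl" by (rule integrable_gauss_tail[OF u t])
      have "gauss_average t u P - ?w P = (\<integral>y. u y * heat_kernel t (P - y) - v y * heat_kernel t (P - y) \<partial>lebesgue)"
        unfolding gauss_average_def by (rule Bochner_Integration.integral_diff[OF iu iv, symmetric])
      also have "\<bar>\<dots>\<bar> \<le> (\<integral>y. \<bar>u y * heat_kernel t (P - y) - v y * heat_kernel t (P - y)\<bar> \<partial>lebesgue)"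
        using integral_norm_bound[of lebesgue "\<lambda>y. u y * heat_kernel t (P - y) - v y * heat_kernel t (P - y)"] by simp
      also have "\<dots> \<le> (\<integral>y. ?tl y \<partial>lebesgue)"
      proof (rule integral_mono)
        show "integrable lebesgue (\<lambda>y. \<bar>u y * heat_kernel t (P - y) - v y * heat_kernel t (P - y)\<bar>)"
          by (intro integrable_abs Bochner_Integration.integrable_diff iu iv)
        show "integrable lebesgue ?tl" by (rule it)
        fix y
        show "\<bar>u y * heat_kernel t (P - y) - v y * heat_kernel t (P - y)\<bar> \<le> ?tl y"
        proof (cases "y \<in> S")
          case False
          then have "1 \<le> norm (P - y)"
            using P norm_triangle_ineq2[of y P] by (simp add: S_def norm_minus_commute)
          then show ?thesis using False by (simp add: v_def abs_mult)
        qed (simp add: v_def)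
      qed
      also have "\<dots> \<le> e" by (rule tail)
      finally show ?thesis .
    qed
    have "?I t - (\<integral>P. f P * ?w P \<partial>lborel) = (\<integral>P. f P * (gauss_average t u P - ?w P) \<partial>lborel)"
      unfolding right_diff_distrib by (rule Bochner_Integration.integral_diff[OF comp_int[OF avg[OF t]] wint, symmetric])
    also have "\<bar>\<dots>\<bar> \<le> (\<integral>P. \<bar>f P * (gauss_average t u P - ?w P)\<bar> \<partial>lborel)"
      using integral_norm_bound[of lborel "\<lambda>P. f P * (gauss_average t u P - ?w P)"] by simp
    also have "\<dots> \<le> (\<integral>P. e * f P \<partial>lborel)"
    proof (rule integral_mono)
      show "integrable lborel (\<lambda>P. \<bar>f P * (gauss_average t u P - ?w P)\<bar>)"
        unfolding right_diff_distrib by (intro integrable_abs Bochner_Integration.integrable_diff wint comp_int avg t)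
      show "integrable lborel (\<lambda>P. e * f P)" by (intro integrable_mult_right fint)
      fix P
      show "\<bar>f P * (gauss_average t u P - ?w P)\<bar> \<le> e * f P"
      proof (cases "norm P < R")
        case True
        then show ?thesis using mult_left_mono[OF far f(1)[of P]] f(1)[of P] by (simp add: abs_mult mult.commute)
      qed (use supp[of P] in simp)
    qed
    finally have "\<bar>?I t - (\<integral>P. f P * ?w P \<partial>lborel)\<bar> \<le> e * If" by (simp add: If_def)
    with near show ?thesis by linarith
  qed
  show ?thesis
  proof (rule tendstoI)
    fix e :: real assume e: "0 < e"
    define e1 where "e1 = e / (2 * (If + 1))"
    have e1: "0 < e1" using e If0 by (simp add: e1_def)
    have e1If: "e1 * If < e / 2" using e If0 by (simp add: e1_def field_simps)
    have "((\<lambda>t. L * ?M * sqrt t * N) \<longlongrightarrow> L * ?M * sqrt 0 * N) (at_right 0)"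
      by (intro tendsto_intros)
    then have "eventually (\<lambda>t. L * ?M * sqrt t * N < e / 2) (at_right 0)"
      using e by (intro order_tendstoD) auto
    then show "eventually (\<lambda>t. dist (?I t) ?J < e) (at_right 0)"
      using gauss_tail[OF u zero_less_one e1] eventually_at_right_less[of "0::real"]
    proof eventually_elim
      case (elim t)
      have "\<bar>?I t - ?J\<bar> \<le> e1 * If + L * ?M * sqrt t * N"
        using elim by (intro est) auto
      then show ?case using elim(1) e1If unfolding dist_real_def by linarith
    qed
  qed
qed


section \<open>The Harnack inequality\<close>

definition bump :: "nat \<Rightarrow> 'a::euclidean_space set \<Rightarrow> 'a \<Rightarrow> real" where
  "bump k K x = max 0 (1 - real k * infdist x K)"

lemma bump_nonneg [simp]: "0 \<le> bump k K x" and bump_le_1: "bump k K x \<le> 1"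
  by (simp_all add: bump_def infdist_nonneg)

lemma bump_lipschitz: "\<bar>bump k K x - bump k K y\<bar> \<le> real k * norm (x - y)"
proof -
  have "\<bar>bump k K x - bump k K y\<bar> \<le> \<bar>(1 - real k * infdist x K) - (1 - real k * infdist y K)\<bar>"
    unfolding bump_def by linarith
  also have "\<dots> = real k * \<bar>infdist x K - infdist y K\<bar>"
    by (simp add: right_diff_distrib[symmetric] abs_mult abs_minus_commute)
  also have "\<dots> \<le> real k * norm (x - y)"
    using infdist_triangle_abs[of x K y] by (intro mult_left_mono) (auto simp: dist_norm)
  finally show ?thesis .
qed

lemma bump_continuous: "continuous_on UNIV (bump k K)"
  unfolding bump_def by (intro continuous_intros)

lemma bump_pos_infdist: "0 < k \<Longrightarrow> 0 < bump k K x \<Longrightarrow> infdist x K < 1 / real k"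
  by (auto simp: bump_def field_simps split: if_splits simp: max_def)

lemma bump_tendsto:
  assumes K: "closed K" "K \<noteq> {}"
  shows "(\<lambda>k. bump (k + k0) K x) \<longlonglongrightarrow> indicator K x"
proof (cases "x \<in> K")
  case True
  then have "bump k K x = 1" for k by (simp add: bump_def)
  then show ?thesis using True by simp
next
  case False
  have d: "0 < infdist x K" by (rule infdist_pos_not_in_closed[OF K False])
  obtain n where n: "1 / infdist x K < real n" using reals_Archimedean2 by blast
  have "bump (k + k0) K x = 0" if "n \<le> k" for k
  proof -
    have "1 < real n * infdist x K" using n d by (simp add: field_simps)
    also have "\<dots> \<le> real (k + k0) * infdist x K" using that d by (intro mult_right_mono) auto
    finally show ?thesis by (simp add: bump_def)
  qed
  then have "eventually (\<lambda>k. bump (k + k0) K x = 0) sequentially"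
    by (auto simp: eventually_sequentially)
  then show ?thesis using False by (simp add: tendsto_eventually)
qed

lemma bump_integral_tendsto:
  fixes h :: "'a::euclidean_space \<Rightarrow> real"
  assumes K: "compact K" "K \<noteq> {}" and supp: "\<And>k x. R \<le> norm x \<Longrightarrow> bump (k + k0) K x = 0"
    and h: "h \<in> borel_measurable lebesgue" "integrable lebesgue (\<lambda>x. indicator (ball 0 R) x * \<bar>h x\<bar>)"
  shows "(\<lambda>k. \<integral>x. bump (k + k0) K x * h x \<partial>lebesgue) \<longlonglongrightarrow> (\<integral>x. indicator K x * h x \<partial>lebesgue)"
proof (rule integral_dominated_convergence[OF _ _ h(2)])
  have "K \<in> sets lebesgue" using K(1) by (intro fmeasurableD lmeasurable_compact)
  then show "(\<lambda>x. indicator K x * h x) \<in> borel_measurable lebesgue"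
    by (intro borel_measurable_times borel_measurable_indicator h)
  have "bump k K \<in> borel_measurable lebesgue" for k
    by (intro measurable_completion) (simp add: borel_measurable_continuous_onI[OF bump_continuous])
  then show "(\<lambda>x. bump (k + k0) K x * h x) \<in> borel_measurable lebesgue" for k
    by (intro borel_measurable_times h)
  show "AE x in lebesgue. (\<lambda>k. bump (k + k0) K x * h x) \<longlonglongrightarrow> indicator K x * h x"
    using K by (intro AE_I2 tendsto_intros bump_tendsto compact_imp_closed)
  show "AE x in lebesgue. norm (bump (k + k0) K x * h x) \<le> indicator (ball 0 R) x * \<bar>h x\<bar>" for k
  proof (rule AE_I2)
    fix x :: 'a
    show "norm (bump (k + k0) K x * h x) \<le> indicator (ball 0 R) x * \<bar>h x\<bar>"
      using bump_le_1[of "k + k0" K x] supp[of x k] mult_left_le_one_le[of "\<bar>h x\<bar>" "bump (k + k0) K x"]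
      by (cases "norm x < R") (auto simp: abs_mult)
  qed
qed

lemma bump_integrable:
  fixes g :: "'a::euclidean_space \<Rightarrow> real"
  assumes supp: "\<And>x. R \<le> norm x \<Longrightarrow> bump k K x = 0" and g: "continuous_on UNIV g"
  shows "integrable lborel (\<lambda>x. bump k K x * g x)"
proof -
  have "integrable lborel (\<lambda>x. indicator (cball 0 R) x *\<^sub>R (bump k K x * g x))"
    by (intro borel_integrable_compact) (auto intro!: continuous_intros continuous_on_subset[OF g] continuous_on_subset[OF bump_continuous])
  moreover have "indicator (cball 0 R) x *\<^sub>R (bump k K x * g x) = bump k K x * g x" for x
    using supp[of x] by (auto simp: indicator_def)
  ultimately show ?thesis by (simp only:)
qed

text \<open>The pointwise inequality is integrated in x and in y separately, so it is needed only
  where both weights are positive. The result involves A only through integrals against fixed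
  weights and thus survives a weak limit.\<close>

lemma weighted_comparison:
  fixes f g A :: "'a::euclidean_space \<Rightarrow> real"
  assumes f: "\<And>x. 0 \<le> f x" "integrable lborel f" "integrable lborel (\<lambda>x. f x * A x)"
    and g: "\<And>x. 0 \<le> g x" "integrable lborel g" "integrable lborel (\<lambda>x. g x * A x)"
    and le: "\<And>x y. 0 < f x \<Longrightarrow> 0 < g y \<Longrightarrow> A x \<le> C * (A y + E)"
  shows "(\<integral>x. f x * A x \<partial>lborel) * (\<integral>x. g x \<partial>lborel)
    \<le> C * ((\<integral>x. f x \<partial>lborel) * ((\<integral>x. g x * A x \<partial>lborel) + E * (\<integral>x. g x \<partial>lborel)))"
proof -
  define IF where "IF = (\<integral>x. f x \<partial>lborel)"
  define IA where "IA = (\<integral>x. f x * A x \<partial>lborel)"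
  have "g y * IA \<le> C * IF * (g y * A y + E * g y)" for y
  proof (cases "0 < g y")
    case True
    have "IA \<le> (\<integral>x. f x * (C * (A y + E)) \<partial>lborel)"
      unfolding IA_def
    proof (rule integral_mono)
      show "f x * A x \<le> f x * (C * (A y + E))" for x
        using le[OF _ True, of x] f(1)[of x] by (cases "f x = 0") (auto intro!: mult_left_mono)
    qed (use f in auto)
    also have "\<dots> = IF * (C * (A y + E))" by (simp add: IF_def)
    finally have "g y * IA \<le> g y * (IF * (C * (A y + E)))" using True by (intro mult_left_mono) auto
    then show ?thesis by (simp add: algebra_simps)
  next
    case False
    then have "g y = 0" using g(1)[of y] by linarith
    then show ?thesis by simp
  qed
  then have "(\<integral>y. g y * IA \<partial>lborel) \<le> (\<integral>y. C * IF * (g y * A y + E * g y) \<partial>lborel)"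
    using g by (intro integral_mono) auto
  also have "\<dots> = C * IF * ((\<integral>x. g x * A x \<partial>lborel) + E * (\<integral>x. g x \<partial>lborel))"
    using g by simp
  finally show ?thesis by (simp add: IF_def IA_def mult_ac)
qed

lemma compact_subset_pos_measure:
  fixes E :: "'a::euclidean_space set"
  assumes E: "E \<in> sets lebesgue" "bounded E" and pos: "0 < emeasure lebesgue E"
  obtains K where "compact K" "K \<subseteq> E" "0 < measure lebesgue K"
proof -
  have lm: "E \<in> lmeasurable" by (rule bounded_set_imp_lmeasurable[OF E(2,1)])
  have m: "0 < measure lebesgue E"
    using pos lm by (simp add: emeasure_eq_measure2)
  obtain T where T: "closed T" "T \<subseteq> E" "E - T \<in> lmeasurable" "emeasure lebesgue (E - T) < ennreal (measure lebesgue E)"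
    using sets_lebesgue_inner_closed[OF E(1) m] by blast
  have cT: "compact T" using T E(2) by (meson bounded_subset compact_eq_bounded_closed)
  have "measure lebesgue (E - T) < measure lebesgue E"
    using T by (simp add: emeasure_eq_measure2 ennreal_less_iff)
  moreover have "measure lebesgue (T \<union> (E - T)) \<le> measure lebesgue T + measure lebesgue (E - T)"
    by (intro measure_Un_le fmeasurableD lmeasurable_compact cT T(3))
  moreover have "T \<union> (E - T) = E" using T by blast
  ultimately have "0 < measure lebesgue T" by simp
  then show ?thesis using that cT T by blast
qed

lemma Linf_norm_AE:
  assumes "f \<in> Linf_on S" and S: "S \<in> sets lebesgue"
  shows "AE z in lebesgue. z \<in> S \<longrightarrow> \<bar>f z\<bar> \<le> Linf_norm S f"
proof -
  let ?e = "esssup_on S (\<lambda>z. \<bar>f z\<bar>)"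
  have fin: "?e < \<infinity>" using assms(1) by (simp add: Linf_on_def)
  have "AE z in restrict_space lebesgue S. ereal \<bar>f z\<bar> \<le> ?e"
    unfolding esssup_on_def by (rule esssup_AE)
  then have "AE z in lebesgue. z \<in> S \<longrightarrow> ereal \<bar>f z\<bar> \<le> ?e"
    using S by (simp add: AE_restrict_space_iff)
  then show ?thesis
  proof eventually_elim
    case (elim z)
    show ?case
    proof
      assume "z \<in> S"
      then have "ereal \<bar>f z\<bar> \<le> ?e" using elim by simp
      then show "\<bar>f z\<bar> \<le> Linf_norm S f" using fin unfolding Linf_norm_def by (cases ?e) auto
    qed
  qed
qed

text \<open>A negative value would contradict |f| \<ge> 0 at almost every point of S, making the
  open set U a null set.\<close>

lemma Linf_norm_nonneg:
  assumes f: "f \<in> Linf_on S" and S: "S \<in> sets lebesgue" and O: "open U" "U \<noteq> {}" "U \<subseteq> S"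
  shows "0 \<le> Linf_norm S f"
proof (rule ccontr)
  assume neg: "\<not> 0 \<le> Linf_norm S f"
  have "AE z in lebesgue. z \<notin> U"
    using Linf_norm_AE[OF f S]
  proof eventually_elim
    case (elim z)
    then show ?case using neg O(3) abs_ge_zero[of "f z"] by auto
  qed
  then have "U \<in> null_sets lebesgue"
    using O(1) by (subst AE_iff_null_sets) auto
  then show False using open_not_negligible[OF O(1,2)] by (simp add: negligible_iff_null_sets)
qed

text \<open>Two limits in this order: first the width of the Gaussian tends to 0 with the weights
  fixed, then the weights shrink to the indicators of the compact sets.\<close>

lemma harnack_on_compacts:
  fixes u V \<psi> :: "(real^'n) \<times> real \<Rightarrow> real"
  assumes s: "0 < s" "s < 1" and r: "0 < r"
    and Q: "Q = ball 0 (2 * r) \<times> {- (2 * r\<^sup>2)<..0}"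
    and harnack: "harnack_bound TYPE(real^'n) s (stable_const s * (r powr (2 * s) * K)) C0"
    and pos: "AE z in lebesgue. 0 \<le> u z"
    and hp: "has_heat_pow s (\<lambda>z. complex_of_real (u z)) w"
    and eq: "AE z in lebesgue. z \<in> Q \<longrightarrow> w z = complex_of_real (V z * u z + \<psi> z)"
    and V: "AE z in lebesgue. z \<in> Q \<longrightarrow> \<bar>V z\<bar> \<le> K" and \<psi>: "AE z in lebesgue. z \<in> Q \<longrightarrow> \<bar>\<psi> z\<bar> \<le> \<Psi>"
    and K: "0 \<le> K" and \<Psi>: "0 \<le> \<Psi>" and e: "0 < e"
    and K1: "compact K1" "K1 \<noteq> {}" "K1 \<subseteq> ball 0 r \<times> {- (r\<^sup>2)<..<- (r\<^sup>2 / 2)}"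
    and K2: "compact K2" "K2 \<noteq> {}" "K2 \<subseteq> ball 0 r \<times> {- (r\<^sup>2 / 4)<..<0}"
  shows "(\<integral>z. indicator K1 z * u z \<partial>lebesgue) * measure lebesgue K2 \<le>
    C0 * (measure lebesgue K1 * ((\<integral>z. indicator K2 z * u z \<partial>lebesgue)
      + r powr (2 * s) * (stable_const s * (\<Psi> + e)) * measure lebesgue K2))"
proof -
  let ?O1 = "ball (0::real^'n) r \<times> {- (r\<^sup>2)<..<- (r\<^sup>2 / 2)}" and ?O2 = "ball (0::real^'n) r \<times> {- (r\<^sup>2 / 4)<..<0}"
  define c where "c = stable_const s"
  have c: "0 < c" unfolding c_def by (rule stable_const_pos[OF s])
  have r2: "0 < r\<^sup>2" using r by simp
  have O: "open ?O1" "open ?O2" by (auto intro!: open_Times)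
  obtain d1 where d1: "0 < d1" "{x. infdist x K1 \<le> d1} \<subseteq> ?O1"
    using compact_in_open_separated[OF K1(2,1) O(1) K1(3)] by blast
  obtain d2 where d2: "0 < d2" "{x. infdist x K2 \<le> d2} \<subseteq> ?O2"
    using compact_in_open_separated[OF K2(2,1) O(2) K2(3)] by blast
  \<comment> \<open>A closed neighbourhood of \<open>K2\<close> that will contain the supports of
    its weights. It is compact and lies before time 0, so its latest time t2 is negative and leaves
    room for the Gaussian.\<close>
  define N2 where "N2 = {x. infdist x K2 \<le> d2}"
  have "compact N2" unfolding N2_def by (rule compact_infdist_le[OF K2(2,1) d2(1)])
  moreover have "N2 \<noteq> {}"
  proof -
    obtain z where "z \<in> K2" using K2(2) by blast
    then have "z \<in> N2" using d2(1) by (simp add: N2_def)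
    then show ?thesis by blast
  qed
  moreover have "continuous_on N2 snd" by (intro continuous_intros)
  ultimately obtain m where m: "m \<in> N2" "\<And>y. y \<in> N2 \<Longrightarrow> snd y \<le> snd m"
    using continuous_attains_sup[of N2 snd] by blast
  define t2 where "t2 = snd m"
  have t2: "t2 < 0" using m(1) d2(2) by (auto simp: N2_def t2_def)
  obtain k1 :: nat where k1: "1 / d1 < real k1" using reals_Archimedean2 by blast
  obtain k2 :: nat where k2: "1 / d2 < real k2" using reals_Archimedean2 by blast
  \<comment> \<open>Shifting the index by \<open>k0\<close> makes every weight of the sequence
    narrow enough to stay inside the chosen neighbourhoods.\<close>
  define k0 where "k0 = max 1 (max k1 k2)"
  have k0: "0 < k0" "1 / d1 < real k0" "1 / d2 < real k0" using k1 k2 by (auto simp: k0_def max_def)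
  have inf_lt: "infdist x K < d" if "0 < bump (k + k0) K x" "1 / d < real k0" "0 < d" for k d x and K :: "((real^'n) \<times> real) set"
  proof -
    have kk: "0 < k + k0" using k0 by simp
    have "infdist x K < 1 / real (k + k0)" by (rule bump_pos_infdist[OF kk that(1)])
    also have "\<dots> \<le> 1 / real k0" using k0 by (intro divide_left_mono) auto
    also have "\<dots> < d" using that k0 by (simp add: field_simps)
    finally show ?thesis .
  qed
  have b1: "x \<in> ?O1" if "0 < bump (k + k0) K1 x" for k x
    using inf_lt[OF that k0(2) d1(1)] d1(2) by (auto simp: less_imp_le)
  have b2: "x \<in> N2" if "0 < bump (k + k0) K2 x" for k x
    using inf_lt[OF that k0(3) d2(1)] by (auto simp: N2_def less_imp_le)
  define R where "R = r + r\<^sup>2"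
  have inR: "norm x < R" if "x \<in> ?O1 \<or> x \<in> ?O2" for x
  proof -
    have "norm x \<le> norm (fst x) + \<bar>snd x\<bar>"
      using norm_Pair_le[of "fst x" "snd x"] by simp
    moreover have "norm (fst x) < r" "\<bar>snd x\<bar> \<le> r\<^sup>2" using that r2 by (auto simp: mem_Times_iff)
    ultimately show ?thesis by (simp add: R_def)
  qed
  have s1: "bump (k + k0) K1 x = 0" if "R \<le> norm x" for k x
    using b1[of k x] inR[of x] that bump_nonneg[of "k + k0" K1 x] by linarith
  have s2: "bump (k + k0) K2 x = 0" if "R \<le> norm x" for k x
  proof -
    have "\<not> 0 < bump (k + k0) K2 x"
    proof
      assume "0 < bump (k + k0) K2 x"
      then have "x \<in> ?O2" using b2[of k x] d2(2) unfolding N2_def by blast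
      then show False using inR[of x] that by linarith
    qed
    then show ?thesis using bump_nonneg[of "k + k0" K2 x] by linarith
  qed
  have uL: "L2_fun (\<lambda>z. complex_of_real (u z))" and wL: "L2_fun w"
    using hp by (auto simp: has_heat_pow_def has_L2_fourier_def)
  let ?A = "\<lambda>t. gauss_average t u"
  note heat = gauss_average_heat[OF s _ hp]
  \<comment> \<open>The margins from 19 / 10 to 2 in space and time, and from t2 to 0: balls of
    radius d around the points considered stay in Q.\<close>
  define d where "d = min (r / 10) (min (r\<^sup>2 / 10) (- t2))"
  have d: "0 < d" using r t2 by (simp add: d_def)
  define E where "E = r powr (2 * s) * (c * (\<Psi> + e))"
  have ev: "eventually (\<lambda>t. \<forall>P1 P2. P1 \<in> ?O1 \<longrightarrow> P2 \<in> N2 \<longrightarrow> ?A t P1 \<le> C0 * (?A t P2 + E)) (at_right 0)"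
    using gauss_average_equation[OF uL wL pos eq V \<psi> K \<Psi> d e] eventually_at_right_less[of "0::real"]
  proof eventually_elim
    case (elim t)
    then have t: "0 < t" by simp
    obtain B where B: "\<And>P. ?A t P \<le> B" using heat(2)[OF t] by blast
    have bh: "bounded_heat_function s (?A t) B"
      using s heat(1)[OF t] heat(3)[OF t] B gauss_average_nonneg[OF pos] by unfold_locales auto
    have fh: "\<bar>frac_heat s (?A t) P\<bar> \<le> (c * K) * ?A t P + c * (\<Psi> + e)"
      if P: "norm (fst P) \<le> 19 / 10 * r" "- 19 / 10 * r\<^sup>2 \<le> snd P" "snd P \<le> t2" for P
    proof -
      have "ball P d \<subseteq> Q"
      proof
        fix Y assume "Y \<in> ball P d"
        then have Y: "dist P Y < d" by simp
        have "norm (fst P - fst Y) < d" "\<bar>snd P - snd Y\<bar> < d"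
          using Y dist_fst_le[of P Y] dist_snd_le[of P Y] by (auto simp: dist_norm)
        moreover have "norm (fst Y) \<le> norm (fst P) + norm (fst P - fst Y)"
          using norm_triangle_ineq4[of "fst P" "fst P - fst Y"] by simp
        moreover have "d \<le> r / 10" "d \<le> r\<^sup>2 / 10" "d \<le> - t2" by (auto simp: d_def)
        ultimately have "norm (fst Y) < 2 * r" "- (2 * r\<^sup>2) < snd Y" "snd Y \<le> 0"
          using P by argo+
        then show "Y \<in> Q" unfolding Q by (simp add: mem_Times_iff)
      qed
      then have "norm (\<integral>y. w y * of_real (heat_kernel t (P - y)) \<partial>lebesgue) \<le> K * ?A t P + (\<Psi> + e)"
        using elim by blast
      then have "c * norm (\<integral>y. w y * of_real (heat_kernel t (P - y)) \<partial>lebesgue) \<le> c * (K * ?A t P + (\<Psi> + e))"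
        using c by (intro mult_left_mono) auto
      moreover have "\<bar>frac_heat s (?A t) P\<bar> = norm (complex_of_real (frac_heat s (?A t) P))" by simp
      ultimately show ?thesis
        using c unfolding heat(4)[OF t] c_def[symmetric] norm_mult by (simp add: distrib_left mult.assoc)
    qed
    show ?case
    proof (intro allI impI)
      fix P1 P2 :: "(real^'n) \<times> real" assume P1: "P1 \<in> ?O1" and P2: "P2 \<in> N2"
      have P2': "P2 \<in> ?O2" using P2 d2(2) by (auto simp: N2_def)
      show "?A t P1 \<le> C0 * (?A t P2 + E)"
        unfolding E_def
      proof (rule harnack[unfolded harnack_bound_def, rule_format, OF bh r _ _ _ _ _ _ _ _ _ fh])
        show "0 \<le> c * (\<Psi> + e)" using c \<Psi> e by simp
        show "t2 \<le> 0" using t2 by simp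
        show "r powr (2 * s) * (c * K) \<le> stable_const s * (r powr (2 * s) * K)" by (simp add: c_def)
        show "norm (fst P1) \<le> r" "- r\<^sup>2 \<le> snd P1" "snd P1 \<le> - r\<^sup>2 / 2" using P1 by (auto simp: mem_Times_iff)
        show "norm (fst P2) \<le> r" "- r\<^sup>2 / 4 \<le> snd P2" using P2' by (auto simp: mem_Times_iff)
        show "snd P2 \<le> t2" using m(2)[OF P2] by (simp add: t2_def)
      qed auto
    qed
  qed
  have um: "u \<in> borel_measurable lebesgue" by (rule L2_real_measurable[OF uL])
  have uloc: "integrable lebesgue (\<lambda>x. indicator (ball 0 R) x * \<bar>u x\<bar>)"
    using integrable_abs[OF L2_real_locally_integrable[OF uL lmeasurable_ball, of 0 R]] by (simp add: abs_mult)
  have oneloc: "integrable lebesgue (\<lambda>x :: (real^'n) \<times> real. indicator (ball 0 R) x * \<bar>1 :: real\<bar>)"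
    using lmeasurable_ball[of "0 :: (real^'n) \<times> real" R] by (simp add: lmeasurable_iff_integrable)
  let ?I = "\<lambda>k K. \<integral>x. bump (k + k0) K x \<partial>lborel" and ?J = "\<lambda>k K. \<integral>x. bump (k + k0) K x * u x \<partial>lebesgue"
  \<comment> \<open>The limit of vanishing width, with the weights fixed.\<close>
  have step: "?J k K1 * ?I k K2 \<le> C0 * (?I k K1 * (?J k K2 + E * ?I k K2))" for k
  proof -
    let ?T = "\<lambda>t K. \<integral>x. bump (k + k0) K x * ?A t x \<partial>lborel"
    have l1: "((\<lambda>t. ?T t K1) \<longlongrightarrow> ?J k K1) (at_right 0)"
      by (rule gauss_average_weak_limit[OF uL bump_lipschitz bump_nonneg bump_le_1 s1 heat(1)])
    have l2: "((\<lambda>t. ?T t K2) \<longlongrightarrow> ?J k K2) (at_right 0)"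
      by (rule gauss_average_weak_limit[OF uL bump_lipschitz bump_nonneg bump_le_1 s2 heat(1)])
    have i: "integrable lborel (bump (k + k0) K1)" "integrable lborel (bump (k + k0) K2)"
      using bump_integrable[where g="\<lambda>_. 1", OF s1] bump_integrable[where g="\<lambda>_. 1", OF s2] by auto
    have "eventually (\<lambda>t. ?T t K1 * ?I k K2 \<le> C0 * (?I k K1 * (?T t K2 + E * ?I k K2))) (at_right 0)"
      using ev eventually_at_right_less[of "0::real"]
    proof eventually_elim
      case (elim t)
      then have t: "0 < t" by simp
      have main: "?A t x \<le> C0 * (?A t y + E)" if "x \<in> ?O1" "y \<in> N2" for x y
        using elim(1) that by blast
      show ?case
        by (rule weighted_comparison[OF bump_nonneg i(1) bump_integrable[OF s1 heat(1)[OF t]] bump_nonneg i(2) bump_integrable[OF s2 heat(1)[OF t]] main[OF b1 b2]])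
    qed
    moreover have "((\<lambda>t. C0 * (?I k K1 * (?T t K2 + E * ?I k K2))) \<longlongrightarrow> C0 * (?I k K1 * (?J k K2 + E * ?I k K2))) (at_right 0)"
      by (intro tendsto_intros l2)
    moreover have "((\<lambda>t. ?T t K1 * ?I k K2) \<longlongrightarrow> ?J k K1 * ?I k K2) (at_right 0)"
      by (intro tendsto_intros l1)
    ultimately show ?thesis
      by (intro tendsto_le[OF trivial_limit_at_right_real])
  qed
  have I_eq: "?I k K = (\<integral>x. bump (k + k0) K x * 1 \<partial>lebesgue)" for k and K :: "((real^'n) \<times> real) set"
    by (subst integral_completion) (auto intro: borel_measurable_continuous_onI bump_continuous)
  have mK: "(\<integral>x. indicator K x * 1 \<partial>lebesgue) = measure lebesgue K" for K :: "((real^'n) \<times> real) set"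
    by simp
  have lim1: "(\<lambda>k. ?I k K1) \<longlonglongrightarrow> measure lebesgue K1"
    unfolding I_eq mK[symmetric] by (rule bump_integral_tendsto[OF K1(1,2) s1 borel_measurable_const oneloc])
  have lim2: "(\<lambda>k. ?I k K2) \<longlonglongrightarrow> measure lebesgue K2"
    unfolding I_eq mK[symmetric] by (rule bump_integral_tendsto[OF K2(1,2) s2 borel_measurable_const oneloc])
  have limu: "(\<lambda>k. ?J k K1) \<longlonglongrightarrow> (\<integral>z. indicator K1 z * u z \<partial>lebesgue)"
    by (rule bump_integral_tendsto[OF K1(1,2) s1 um uloc])
  have limu': "(\<lambda>k. ?J k K2) \<longlonglongrightarrow> (\<integral>z. indicator K2 z * u z \<partial>lebesgue)"
    by (rule bump_integral_tendsto[OF K2(1,2) s2 um uloc])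
  \<comment> \<open>The limit in which the weights shrink to the indicators.\<close>
  have "(\<integral>z. indicator K1 z * u z \<partial>lebesgue) * measure lebesgue K2 \<le>
    C0 * (measure lebesgue K1 * ((\<integral>z. indicator K2 z * u z \<partial>lebesgue) + E * measure lebesgue K2))"
    by (rule LIMSEQ_le[of "\<lambda>k. ?J k K1 * ?I k K2" _ "\<lambda>k. C0 * (?I k K1 * (?J k K2 + E * ?I k K2))"])
      (intro tendsto_intros lim1 lim2 limu limu', intro tendsto_intros lim1 lim2 limu limu', use step in blast)
  then show ?thesis by (simp add: E_def c_def)
qed

theorem theorem5p2:
  fixes s :: real
  assumes "0 < s" "s < 1"
  shows "\<exists>C :: real \<Rightarrow> real. (\<forall>K. 0 < C K) \<and>
    (\<forall>(r::real) (V :: (real^'n) \<times> real \<Rightarrow> real) (\<psi> :: (real^'n) \<times> real \<Rightarrow> real)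
       (u :: (real^'n) \<times> real \<Rightarrow> real).
       let Q = ball 0 (2 * r) \<times> {- (2 * r\<^sup>2)<..0} in
       0 < r \<longrightarrow> V \<in> Linf_on Q \<longrightarrow> \<psi> \<in> Linf_on Q \<longrightarrow>
       (AE z in lebesgue. 0 \<le> u z) \<longrightarrow>
       heat_pow_solution s Q V \<psi> u \<longrightarrow>
       esssup_on (ball 0 r \<times> {- (r\<^sup>2)<..<- (r\<^sup>2 / 2)}) u
         \<le> ereal (C (r powr (2 * s) * Linf_norm Q V)) *
            (essinf_on (ball 0 r \<times> {- (r\<^sup>2 / 4)<..<0}) u
              + ereal (r powr (2 * s) * Linf_norm Q \<psi>)))"
proof -
  define c where "c = stable_const s"
  have c: "0 < c" unfolding c_def by (rule stable_const_pos[OF assms])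
  have "\<exists>C>0. harnack_bound TYPE(real^'n) s (c * K) C" if "0 \<le> K" for K
    using c that by (intro harnack_bounded assms) simp
  then obtain C0 where C0: "\<And>K. 0 \<le> K \<Longrightarrow> 0 < C0 K"
    and harnack: "\<And>K. 0 \<le> K \<Longrightarrow> harnack_bound TYPE(real^'n) s (c * K) (C0 K)"
    by metis
  \<comment> \<open>The averaged inequality carries \<open>stable_const\<close> in front of the norm
    of \<psi>; the factor max 1 c absorbs it. For negative K the value 1 merely keeps
    \<open>C\<close> positive.\<close>
  define C where "C K = (if 0 \<le> K then C0 K * max 1 c else 1)" for K
  have Cpos: "0 < C K" for K using C0[of K] by (simp add: C_def)
  show ?thesis
  proof (intro exI[of _ C] conjI allI Cpos, unfold Let_def, intro impI)
    fix r :: real and V \<psi> u :: "(real^'n) \<times> real \<Rightarrow> real"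
    define Q :: "((real^'n) \<times> real) set" where "Q = ball 0 (2 * r) \<times> {- (2 * r\<^sup>2)<..0}"
    define O1 :: "((real^'n) \<times> real) set" where "O1 = ball 0 r \<times> {- (r\<^sup>2)<..<- (r\<^sup>2 / 2)}"
    define O2 :: "((real^'n) \<times> real) set" where "O2 = ball 0 r \<times> {- (r\<^sup>2 / 4)<..<0}"
    assume r: "0 < r" and "V \<in> Linf_on (ball 0 (2 * r) \<times> {- (2 * r\<^sup>2)<..0})" "\<psi> \<in> Linf_on (ball 0 (2 * r) \<times> {- (2 * r\<^sup>2)<..0})"
      and pos: "AE z in lebesgue. 0 \<le> u z" and "heat_pow_solution s (ball 0 (2 * r) \<times> {- (2 * r\<^sup>2)<..0}) V \<psi> u"
    then have V: "V \<in> Linf_on Q" and \<psi>: "\<psi> \<in> Linf_on Q" and sol: "heat_pow_solution s Q V \<psi> u"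
      by (simp_all add: Q_def)
    have r2: "0 < r\<^sup>2" using r by simp
    obtain w where hp: "has_heat_pow s (\<lambda>z. complex_of_real (u z)) w"
      and eq: "AE z in lebesgue. z \<in> Q \<longrightarrow> w z = complex_of_real (V z * u z + \<psi> z)"
      using sol unfolding heat_pow_solution_def by blast
    have O: "open O1" "open O2" unfolding O1_def O2_def by (auto intro!: open_Times)
    have Obd: "bounded O1" "bounded O2" unfolding O1_def O2_def by (auto intro!: bounded_Times)
    have Oleb: "O1 \<in> sets lebesgue" "O2 \<in> sets lebesgue" using O by auto
    have "ball (0::real^'n) (2 * r) \<times> {- (2 * r\<^sup>2)<..0} \<in> sets (lborel \<Otimes>\<^sub>M lborel)"
      by (intro pair_measureI) auto
    then have Qleb: "Q \<in> sets lebesgue" unfolding lborel_prod Q_def by (rule sets_completionI_sets)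
    have O2Q: "O2 \<subseteq> Q" using r r2 by (auto simp: O2_def Q_def)
    have "(0, - (r\<^sup>2 / 8)) \<in> O2" using r r2 by (simp add: O2_def)
    then have O2ne: "O2 \<noteq> {}" by blast
    define Kv where "Kv = Linf_norm Q V"
    define \<Psi> where "\<Psi> = Linf_norm Q \<psi>"
    have Kv: "0 \<le> Kv" and \<Psi>: "0 \<le> \<Psi>"
      unfolding Kv_def \<Psi>_def using V \<psi> by (auto intro!: Linf_norm_nonneg[OF _ Qleb O(2) O2ne O2Q])
    define x where "x = r powr (2 * s) * Kv"
    define D where "D = r powr (2 * s)"
    have x: "0 \<le> x" using Kv by (simp add: x_def)
    have D: "0 < D" using r by (simp add: D_def)
    have uL: "L2_fun (\<lambda>z. complex_of_real (u z))"
      using hp by (auto simp: has_heat_pow_def has_L2_fourier_def)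
    have um: "u \<in> borel_measurable lebesgue" by (rule L2_real_measurable[OF uL])
    have uO: "(\<lambda>z. ereal (u z)) \<in> borel_measurable (restrict_space lebesgue S)"
      "(\<lambda>z. ereal (- u z)) \<in> borel_measurable (restrict_space lebesgue S)" for S
      using um by (auto intro!: measurable_restrict_space1 borel_measurable_ereal borel_measurable_uminus)
    have lev: "{z \<in> S. a < u z} \<in> sets lebesgue" "{z \<in> S. u z < a} \<in> sets lebesgue" if "S \<in> sets lebesgue" for S a
    proof -
      have "{z \<in> space lebesgue. a < u z} \<in> sets lebesgue" "{z \<in> space lebesgue. u z < a} \<in> sets lebesgue"
        using um by measurable
      then have "S \<inter> {z. a < u z} \<in> sets lebesgue" "S \<inter> {z. u z < a} \<in> sets lebesgue"
        using that by (auto intro: sets.Int)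
      then show "{z \<in> S. a < u z} \<in> sets lebesgue" "{z \<in> S. u z < a} \<in> sets lebesgue"
        by (simp_all add: Int_def)
    qed
    have posS: "0 < emeasure lebesgue {z \<in> O1. a < u z}" if "ereal a < esssup_on O1 u" for a
      using esssup_pos_measure[OF uO(1) that[unfolded esssup_on_def]] Oleb
      by (subst (asm) emeasure_restrict_space) (auto simp: space_restrict_space)
    have posI: "0 < emeasure lebesgue {z \<in> O2. u z < b}" if "essinf_on O2 u < ereal b" for b
    proof -
      have "ereal (- b) < esssup_on O2 (\<lambda>z. - u z)"
        using that unfolding essinf_on_def by (simp add: ereal_uminus_less_reorder)
      from esssup_pos_measure[OF uO(2) this[unfolded esssup_on_def]] show ?thesis using Oleb
        by (subst (asm) emeasure_restrict_space) (auto simp: space_restrict_space)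
    qed
    \<comment> \<open>If the inequality failed, levels a and b could be put strictly between the two
      sides. Then u > a on a part of \<open>O1\<close> and u < b on a part of \<open>O2\<close>,
      both of positive measure, and the integrated inequality on compact subsets of these parts
      gives a contradiction.\<close>
    have key: False if a: "ereal a < esssup_on O1 u" and b: "essinf_on O2 u < ereal b" and b0: "0 \<le> b"
      and ab: "C x * (b + D * \<Psi>) < a" for a b
    proof -
      \<comment> \<open>With this choice the error C x * D * e is half of the gap left by the
        hypothesis on a and b.\<close>
      define e where "e = (a - C x * (b + D * \<Psi>)) / (2 * (C x * D))"
      have e: "0 < e" using ab Cpos[of x] D by (simp add: e_def)
      obtain K1 where K1: "compact K1" "K1 \<subseteq> {z \<in> O1. a < u z}" "0 < measure lebesgue K1"
        by (rule compact_subset_pos_measure[OF lev(1)[OF Oleb(1)] _ posS[OF a]]) (auto intro: bounded_subset[OF Obd(1)])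
      obtain K2 where K2: "compact K2" "K2 \<subseteq> {z \<in> O2. u z < b}" "0 < measure lebesgue K2"
        by (rule compact_subset_pos_measure[OF lev(2)[OF Oleb(2)] _ posI[OF b]]) (auto intro: bounded_subset[OF Obd(2)])
      have ne: "K1 \<noteq> {}" "K2 \<noteq> {}" using K1(3) K2(3) by auto
      let ?m1 = "measure lebesgue K1" and ?m2 = "measure lebesgue K2"
      have hx: "harnack_bound TYPE(real^'n) s (stable_const s * (r powr (2 * s) * Kv)) (C0 x)"
        using harnack[OF x] by (simp add: c_def x_def)
      have H: "(\<integral>z. indicator K1 z * u z \<partial>lebesgue) * ?m2 \<le>
        C0 x * (?m1 * ((\<integral>z. indicator K2 z * u z \<partial>lebesgue) + D * (c * (\<Psi> + e)) * ?m2))"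
        unfolding D_def c_def
        by (rule harnack_on_compacts[OF assms r Q_def hx pos hp eq
              Linf_norm_AE[OF V Qleb, folded Kv_def] Linf_norm_AE[OF \<psi> Qleb, folded \<Psi>_def] Kv \<Psi> e K1(1) ne(1) _ K2(1) ne(2)])
          (use K1(2) K2(2) in \<open>auto simp: O1_def O2_def x_def\<close>)
      have i1: "integrable lebesgue (indicator K :: _ \<Rightarrow> real)" if "compact K" for K :: "((real^'n) \<times> real) set"
        using lmeasurable_compact[OF that] by (simp add: lmeasurable_iff_integrable)
      have i2: "integrable lebesgue (\<lambda>z. indicator K z * u z)" if "compact K" for K
        by (rule L2_real_locally_integrable[OF uL lmeasurable_compact[OF that]])
      have "(\<integral>z. a * indicator K1 z \<partial>lebesgue) \<le> (\<integral>z. indicator K1 z * u z \<partial>lebesgue)"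
        using K1(2) by (intro integral_mono integrable_mult_right i1 i2 K1(1)) (auto simp: indicator_def)
      then have L: "a * ?m1 \<le> (\<integral>z. indicator K1 z * u z \<partial>lebesgue)" by simp
      have "(\<integral>z. indicator K2 z * u z \<partial>lebesgue) \<le> (\<integral>z. b * indicator K2 z \<partial>lebesgue)"
        using K2(2) by (intro integral_mono integrable_mult_right i1 i2 K2(1)) (auto simp: indicator_def)
      then have U: "(\<integral>z. indicator K2 z * u z \<partial>lebesgue) \<le> b * ?m2" by simp
      have "a * ?m1 * ?m2 \<le> (\<integral>z. indicator K1 z * u z \<partial>lebesgue) * ?m2"
        using L K2(3) by (intro mult_right_mono) auto
      also have "\<dots> \<le> C0 x * (?m1 * (b * ?m2 + D * (c * (\<Psi> + e)) * ?m2))"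
        by (rule order_trans[OF H])
          (intro mult_left_mono add_mono U order_refl, use C0[OF x] in auto)
      also have "\<dots> = (C0 x * (b + c * (D * (\<Psi> + e)))) * (?m1 * ?m2)"
        by (simp add: algebra_simps)
      finally have "a * (?m1 * ?m2) \<le> (C0 x * (b + c * (D * (\<Psi> + e)))) * (?m1 * ?m2)"
        by (simp only: mult.assoc)
      then have "a \<le> C0 x * (b + c * (D * (\<Psi> + e)))"
        using K1(3) K2(3) by (simp only: mult_le_cancel_right_pos mult_pos_pos)
      also have "\<dots> \<le> C0 x * (max 1 c * b + max 1 c * (D * (\<Psi> + e)))"
      proof -
        have "b \<le> max 1 c * b" using b0 mult_right_mono[of 1 "max 1 c" b] by simp
        moreover have "c * (D * (\<Psi> + e)) \<le> max 1 c * (D * (\<Psi> + e))"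
          using D \<Psi> e by (intro mult_right_mono) auto
        ultimately show ?thesis using C0[OF x] by (intro mult_left_mono add_mono) auto
      qed
      also have "\<dots> = C x * (b + D * (\<Psi> + e))"
        using x by (simp add: C_def algebra_simps)
      also have "\<dots> = C x * (b + D * \<Psi>) + (C x * D) * e"
        by (simp add: algebra_simps)
      also have "(C x * D) * e = (a - C x * (b + D * \<Psi>)) / 2"
        using Cpos[of x] D by (simp add: e_def)
      finally show False using ab by argo
    qed
    have Iinf: "0 \<le> essinf_on O2 u"
    proof -
      have "AE z in restrict_space lebesgue O2. ereal (- u z) \<le> 0"
        using pos Oleb by (auto simp: AE_restrict_space_iff elim!: eventually_mono)
      then have "esssup_on O2 (\<lambda>z. - u z) \<le> 0"
        unfolding esssup_on_def by (intro esssup_I uO)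
      then show ?thesis unfolding essinf_on_def by (simp add: ereal_uminus_le_reorder)
    qed
    have "esssup_on O1 u \<le> ereal (C x) * (essinf_on O2 u + ereal (D * \<Psi>))"
    proof (cases "essinf_on O2 u")
      case (real i)
      then have i: "0 \<le> i" using Iinf by simp
      show ?thesis
      proof (rule ccontr)
        assume "\<not> ?thesis"
        then have "ereal (C x * (i + D * \<Psi>)) < esssup_on O1 u" by (simp add: real not_le)
        then obtain a where a: "C x * (i + D * \<Psi>) < a" "ereal a < esssup_on O1 u"
          using ereal_dense2[of "ereal (C x * (i + D * \<Psi>))" "esssup_on O1 u"] by auto
        \<comment> \<open>Raising the infimum i to b uses up only half of the gap below a.\<close>
        define b where "b = i + (a - C x * (i + D * \<Psi>)) / (2 * C x)"
        have b: "i < b" using a(1) Cpos[of x] by (simp add: b_def)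
        have "C x * (b + D * \<Psi>) = C x * (i + D * \<Psi>) + (a - C x * (i + D * \<Psi>)) / 2"
          using Cpos[of x] by (simp add: b_def field_simps)
        then have "C x * (b + D * \<Psi>) < a" using a(1) by argo
        then show False using key[OF a(2), of b] b i real by simp
      qed
    next
      case PInf
      then show ?thesis using Cpos[of x] by simp
    next
      case MInf
      then show ?thesis using Iinf by simp
    qed
    then show "esssup_on (ball 0 r \<times> {- (r\<^sup>2)<..<- (r\<^sup>2 / 2)}) u
         \<le> ereal (C (r powr (2 * s) * Linf_norm (ball 0 (2 * r) \<times> {- (2 * r\<^sup>2)<..0}) V)) *
            (essinf_on (ball 0 r \<times> {- (r\<^sup>2 / 4)<..<0}) u
              + ereal (r powr (2 * s) * Linf_norm (ball 0 (2 * r) \<times> {- (2 * r\<^sup>2)<..0}) \<psi>))"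
      by (simp only: x_def D_def Kv_def \<Psi>_def Q_def O1_def O2_def)
  qed
qed

end
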